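(* Let $A$ be a commutative local ring. If $A$ is not a field, assume that the cardinality of its residue field is at least $4$. Then the natural map of graded rings $$\hat{K}^{MW}(A) \to K^{MW}(A),\qquad [a]\mapsto [a],\ \langle a\rangle\mapsto 1+\eta[a]\quad (a\in A^* ),$$ induces an isomorphism $\hat{K}^{MW}_n(A) \cong K^{MW}_n(A)$ for all $n\geq 2$.
   Context: For a commutative ring $A$, $\mathbb Z[A^*]$ is the integral group ring of the group of units, with basis elements $\langle a\rangle$, $a\in A^*$; $I[A^*]$ is its augmentation ideal, and $[a]\in I[A^*]$ denotes $\langle a\rangle-1$. $\hat K^{MW}_*(A)=\bigoplus_{n\ge 0}\hat K^{MW}_n(A)$ is the graded $\mathbb Z[A^*]$-algebra obtained as the quotient of the tensor algebra of $I[A^*]$ (placed in degree $1$) over $\mathbb Z[A^*]$ by the two-sided ideal generated by the elements $[a][1-a]$ for all $a\in A^*$ with $1-a\in A^*$. Milnor-Witt $K$-theory $K^{MW}_*(A)=\bigoplus_{n\in\mathbb Z}K^{MW}_n(A)$ is the graded associative ring generated by symbols $[a]$, $a\in A^*$, of degree $1$ and one symbol $\eta$ of degree $-1$ subject to the relations: (1) $[a][1-a]=0$ for $a,1-a\in A^*$; (2) $[ab]=[a]+[b]+\eta[a][b]$ for $a,b\in A^*$; (3) $\eta[a]=[a]\eta$ for $a\in A^*$; (4) $\eta^2[-1]+2\eta=0$. *)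

theory Defs
  imports "HOL-Algebra.IntRing" "HOL-Algebra.Module"
begin

section \<open>Local rings\<close>

definition local_ring :: "('a, 'm) ring_scheme \<Rightarrow> bool" where
  "local_ring A \<longleftrightarrow> cring A \<and> (\<exists>!M. maximalideal M A)"

definition residue_field :: "('a, 'm) ring_scheme \<Rightarrow> 'a set ring" where
  "residue_field A = A Quot (THE M. maximalideal M A)"


section \<open>Monoid rings and free algebras\<close>

text \<open>
  The monoid ring of a monoid \<open>G\<close> over a ring \<open>R\<close>: finitely supported functions from the
  carrier of \<open>G\<close> to \<open>R\<close> (extended by zero outside the carrier), with convolution.
\<close>

definition supp :: "('r, 'm) ring_scheme \<Rightarrow> ('g \<Rightarrow> 'r) \<Rightarrow> 'g set" where
  "supp R f = {x. f x \<noteq> \<zero>\<^bsub>R\<^esub>}"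

definition single :: "('r, 'm) ring_scheme \<Rightarrow> 'g \<Rightarrow> 'r \<Rightarrow> 'g \<Rightarrow> 'r" where
  "single R x r = (\<lambda>y. if y = x then r else \<zero>\<^bsub>R\<^esub>)"

definition monoid_ring ::
    "('r, 'm) ring_scheme \<Rightarrow> ('g, 'n) monoid_scheme \<Rightarrow> ('g \<Rightarrow> 'r) ring" where
  "monoid_ring R G =
    \<lparr>carrier = {f. range f \<subseteq> carrier R \<and> finite (supp R f) \<and> supp R f \<subseteq> carrier G},
     mult = (\<lambda>f g x. \<Oplus>\<^bsub>R\<^esub>y\<in>supp R f. \<Oplus>\<^bsub>R\<^esub>z\<in>supp R g.
               (if y \<otimes>\<^bsub>G\<^esub> z = x then f y \<otimes>\<^bsub>R\<^esub> g z else \<zero>\<^bsub>R\<^esub>)),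
     one = single R \<one>\<^bsub>G\<^esub> \<one>\<^bsub>R\<^esub>,
     zero = (\<lambda>x. \<zero>\<^bsub>R\<^esub>),
     add = (\<lambda>f g x. f x \<oplus>\<^bsub>R\<^esub> g x)\<rparr>"

definition free_monoid :: "'x set \<Rightarrow> 'x list monoid" where
  "free_monoid X = \<lparr>carrier = lists X, mult = (@), one = []\<rparr>"

text \<open>
  For commutative \<open>R\<close> this is the free associative unital \<open>R\<close>-algebra on the set \<open>X\<close>:
  its elements are the \<open>R\<close>-linear combinations of words in \<open>X\<close>.
\<close>

definition free_algebra :: "('r, 'm) ring_scheme \<Rightarrow> 'x set \<Rightarrow> ('x list \<Rightarrow> 'r) ring" where
  "free_algebra R X = monoid_ring R (free_monoid X)"

definition homogeneous ::
    "('r, 'm) ring_scheme \<Rightarrow> 'x set \<Rightarrow> ('x list \<Rightarrow> 'd) \<Rightarrow> 'd \<Rightarrow> ('x list \<Rightarrow> 'r) set" where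
  "homogeneous R X deg n = {f \<in> carrier (free_algebra R X). \<forall>w\<in>supp R f. deg w = n}"


section \<open>Tensor algebra of a module\<close>

text \<open>
  In word length \<open>n\<close>, the ideal below is the submodule of the free \<open>R\<close>-module on \<open>M\<^sup>n\<close> spanned
  by the multilinearity relations. Hence the image of the words of length \<open>n\<close> is the \<open>n\<close>-th
  tensor power of \<open>M\<close> over \<open>R\<close>, and multiplication is concatenation of tensors.
\<close>

definition tensor_ideal ::
    "('r, 'm) ring_scheme \<Rightarrow> ('r, 'x, 'n) module_scheme \<Rightarrow> ('x list \<Rightarrow> 'r) set" where
  "tensor_ideal R M =
    (let F = free_algebra R (carrier M); X = (\<lambda>m. single R [m] \<one>\<^bsub>R\<^esub>) in
     Idl\<^bsub>F\<^esub>
       ({X (m \<oplus>\<^bsub>M\<^esub> m') \<ominus>\<^bsub>F\<^esub> (X m \<oplus>\<^bsub>F\<^esub> X m') | m m'. m \<in> carrier M \<and> m' \<in> carrier M} \<union>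
        {X (r \<odot>\<^bsub>M\<^esub> m) \<ominus>\<^bsub>F\<^esub> single R [] r \<otimes>\<^bsub>F\<^esub> X m | r m. r \<in> carrier R \<and> m \<in> carrier M}))"

definition tensor_algebra ::
    "('r, 'm) ring_scheme \<Rightarrow> ('r, 'x, 'n) module_scheme \<Rightarrow> ('x list \<Rightarrow> 'r) set ring" where
  "tensor_algebra R M = free_algebra R (carrier M) Quot tensor_ideal R M"

definition tensor_class ::
    "('r, 'm) ring_scheme \<Rightarrow> ('r, 'x, 'n) module_scheme \<Rightarrow> ('x list \<Rightarrow> 'r) \<Rightarrow> ('x list \<Rightarrow> 'r) set"
  where "tensor_class R M f = tensor_ideal R M +>\<^bsub>free_algebra R (carrier M)\<^esub> f"

definition tensor_scalar ::
    "('r, 'm) ring_scheme \<Rightarrow> ('r, 'x, 'n) module_scheme \<Rightarrow> 'r \<Rightarrow> ('x list \<Rightarrow> 'r) set" where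
  "tensor_scalar R M r = tensor_class R M (single R [] r)"

definition tensor_incl ::
    "('r, 'm) ring_scheme \<Rightarrow> ('r, 'x, 'n) module_scheme \<Rightarrow> 'x \<Rightarrow> ('x list \<Rightarrow> 'r) set" where
  "tensor_incl R M m = tensor_class R M (single R [m] \<one>\<^bsub>R\<^esub>)"

definition tensor_power ::
    "('r, 'm) ring_scheme \<Rightarrow> ('r, 'x, 'n) module_scheme \<Rightarrow> nat \<Rightarrow> ('x list \<Rightarrow> 'r) set set" where
  "tensor_power R M n = tensor_class R M ` homogeneous R (carrier M) length n"


section \<open>The group ring of units and its augmentation ideal\<close>

definition unit_group_ring :: "('a, 'm) ring_scheme \<Rightarrow> ('a \<Rightarrow> int) ring" where
  "unit_group_ring A = monoid_ring \<Z> (units_of A)"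

definition angle :: "'a \<Rightarrow> 'a \<Rightarrow> int" where
  "angle a = single \<Z> a 1"

definition augmentation :: "('a \<Rightarrow> int) \<Rightarrow> int" where
  "augmentation f = (\<Sum>a\<in>supp \<Z> f. f a)"

definition aug_ideal :: "('a, 'm) ring_scheme \<Rightarrow> ('a \<Rightarrow> int) set" where
  "aug_ideal A = a_kernel (unit_group_ring A) \<Z> augmentation"

definition aug_module :: "('a, 'm) ring_scheme \<Rightarrow> ('a \<Rightarrow> int, 'a \<Rightarrow> int) module" where
  "aug_module A =
    (let Z = unit_group_ring A in
     \<lparr>carrier = aug_ideal A, mult = mult Z, one = one Z, zero = zero Z, add = add Z,
      smult = mult Z\<rparr>)"

definition bracket :: "('a, 'm) ring_scheme \<Rightarrow> 'a \<Rightarrow> 'a \<Rightarrow> int" where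
  "bracket A a = angle a \<ominus>\<^bsub>unit_group_ring A\<^esub> \<one>\<^bsub>unit_group_ring A\<^esub>"


section \<open>The graded algebra \<open>K\<close>-hat\<close>

text \<open>
  Elements are cosets, in the tensor algebra, of cosets in the free algebra. The relations are
  homogeneous, so the algebra is graded and its degree \<open>n\<close> part is the image of the \<open>n\<close>-th tensor
  power.
\<close>

type_synonym 'a khat = "(('a \<Rightarrow> int) list \<Rightarrow> 'a \<Rightarrow> int) set set"

abbreviation aug_tensor_algebra ::
    "('a, 'm) ring_scheme \<Rightarrow> (('a \<Rightarrow> int) list \<Rightarrow> 'a \<Rightarrow> int) set ring" where
  "aug_tensor_algebra A \<equiv> tensor_algebra (unit_group_ring A) (aug_module A)"

definition Khat_ideal ::
    "('a, 'm) ring_scheme \<Rightarrow> (('a \<Rightarrow> int) list \<Rightarrow> 'a \<Rightarrow> int) set set" where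
  "Khat_ideal A =
    (let T = aug_tensor_algebra A;
         br = (\<lambda>a. tensor_incl (unit_group_ring A) (aug_module A) (bracket A a)) in
     Idl\<^bsub>T\<^esub> {br a \<otimes>\<^bsub>T\<^esub> br (\<one>\<^bsub>A\<^esub> \<ominus>\<^bsub>A\<^esub> a) | a. a \<in> Units A \<and> \<one>\<^bsub>A\<^esub> \<ominus>\<^bsub>A\<^esub> a \<in> Units A})"

definition Khat :: "('a, 'm) ring_scheme \<Rightarrow> 'a khat ring" where
  "Khat A = aug_tensor_algebra A Quot Khat_ideal A"

definition Khat_class ::
    "('a, 'm) ring_scheme \<Rightarrow> (('a \<Rightarrow> int) list \<Rightarrow> 'a \<Rightarrow> int) set \<Rightarrow> 'a khat" where
  "Khat_class A t = Khat_ideal A +>\<^bsub>aug_tensor_algebra A\<^esub> t"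

definition Khat_angle :: "('a, 'm) ring_scheme \<Rightarrow> 'a \<Rightarrow> 'a khat" where
  "Khat_angle A a =
    Khat_class A (tensor_scalar (unit_group_ring A) (aug_module A) (angle a))"

definition Khat_bracket :: "('a, 'm) ring_scheme \<Rightarrow> 'a \<Rightarrow> 'a khat" where
  "Khat_bracket A a =
    Khat_class A (tensor_incl (unit_group_ring A) (aug_module A) (bracket A a))"

definition Khat_deg :: "('a, 'm) ring_scheme \<Rightarrow> nat \<Rightarrow> 'a khat set" where
  "Khat_deg A n = Khat_class A ` tensor_power (unit_group_ring A) (aug_module A) n"


section \<open>Milnor-Witt \<open>K\<close>-theory\<close>

datatype 'a mw_gen = Sym 'a | Eta

definition mw_gens :: "('a, 'm) ring_scheme \<Rightarrow> 'a mw_gen set" where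
  "mw_gens A = insert Eta (Sym ` Units A)"

fun gen_degree :: "'a mw_gen \<Rightarrow> int" where
  "gen_degree (Sym a) = 1"
| "gen_degree Eta = - 1"

definition word_degree :: "'a mw_gen list \<Rightarrow> int" where
  "word_degree w = sum_list (map gen_degree w)"

definition KMW_ideal :: "('a, 'm) ring_scheme \<Rightarrow> ('a mw_gen list \<Rightarrow> int) set" where
  "KMW_ideal A =
    (let F = free_algebra \<Z> (mw_gens A);
         s = (\<lambda>a. single \<Z> [Sym a] 1);
         e = single \<Z> [Eta] 1 in
     Idl\<^bsub>F\<^esub>
       ({s a \<otimes>\<^bsub>F\<^esub> s (\<one>\<^bsub>A\<^esub> \<ominus>\<^bsub>A\<^esub> a) | a. a \<in> Units A \<and> \<one>\<^bsub>A\<^esub> \<ominus>\<^bsub>A\<^esub> a \<in> Units A} \<union>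
        {s (a \<otimes>\<^bsub>A\<^esub> b) \<ominus>\<^bsub>F\<^esub> (s a \<oplus>\<^bsub>F\<^esub> s b \<oplus>\<^bsub>F\<^esub> e \<otimes>\<^bsub>F\<^esub> s a \<otimes>\<^bsub>F\<^esub> s b) | a b.
            a \<in> Units A \<and> b \<in> Units A} \<union>
        {e \<otimes>\<^bsub>F\<^esub> s a \<ominus>\<^bsub>F\<^esub> s a \<otimes>\<^bsub>F\<^esub> e | a. a \<in> Units A} \<union>
        {e \<otimes>\<^bsub>F\<^esub> e \<otimes>\<^bsub>F\<^esub> s (\<ominus>\<^bsub>A\<^esub> \<one>\<^bsub>A\<^esub>) \<oplus>\<^bsub>F\<^esub> (e \<oplus>\<^bsub>F\<^esub> e)}))"

definition KMW :: "('a, 'm) ring_scheme \<Rightarrow> ('a mw_gen list \<Rightarrow> int) set ring" where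
  "KMW A = free_algebra \<Z> (mw_gens A) Quot KMW_ideal A"

definition KMW_class ::
    "('a, 'm) ring_scheme \<Rightarrow> ('a mw_gen list \<Rightarrow> int) \<Rightarrow> ('a mw_gen list \<Rightarrow> int) set" where
  "KMW_class A f = KMW_ideal A +>\<^bsub>free_algebra \<Z> (mw_gens A)\<^esub> f"

definition KMW_bracket :: "('a, 'm) ring_scheme \<Rightarrow> 'a \<Rightarrow> ('a mw_gen list \<Rightarrow> int) set" where
  "KMW_bracket A a = KMW_class A (single \<Z> [Sym a] 1)"

definition KMW_eta :: "('a, 'm) ring_scheme \<Rightarrow> ('a mw_gen list \<Rightarrow> int) set" where
  "KMW_eta A = KMW_class A (single \<Z> [Eta] 1)"

definition KMW_deg :: "('a, 'm) ring_scheme \<Rightarrow> int \<Rightarrow> ('a mw_gen list \<Rightarrow> int) set set" where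
  "KMW_deg A n = KMW_class A ` homogeneous \<Z> (mw_gens A) word_degree n"


section \<open>The natural map\<close>

text \<open>Extensionality only pins down the irrelevant values outside the carrier.\<close>

definition natural_map ::
    "('a, 'm) ring_scheme \<Rightarrow> ('a khat \<Rightarrow> ('a mw_gen list \<Rightarrow> int) set) \<Rightarrow> bool" where
  "natural_map A \<Phi> \<longleftrightarrow>
    \<Phi> \<in> ring_hom (Khat A) (KMW A) \<and> \<Phi> \<in> extensional (carrier (Khat A)) \<and>
    (\<forall>n. \<Phi> ` Khat_deg A n \<subseteq> KMW_deg A (int n)) \<and>
    (\<forall>a\<in>Units A. \<Phi> (Khat_bracket A a) = KMW_bracket A a) \<and>
    (\<forall>a\<in>Units A. \<Phi> (Khat_angle A a) =
       \<one>\<^bsub>KMW A\<^esub> \<oplus>\<^bsub>KMW A\<^esub> KMW_eta A \<otimes>\<^bsub>KMW A\<^esub> KMW_bracket A a)"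

definition Khat_group :: "('a, 'm) ring_scheme \<Rightarrow> nat \<Rightarrow> 'a khat monoid" where
  "Khat_group A n =
    \<lparr>carrier = Khat_deg A n, mult = add (Khat A), one = \<zero>\<^bsub>Khat A\<^esub>\<rparr>"

definition KMW_group ::
    "('a, 'm) ring_scheme \<Rightarrow> int \<Rightarrow> ('a mw_gen list \<Rightarrow> int) set monoid" where
  "KMW_group A n =
    \<lparr>carrier = KMW_deg A n, mult = add (KMW A), one = \<zero>\<^bsub>KMW A\<^esub>\<rparr>"

end

theory Submission
  imports Defs "HOL-Algebra.Ring_Divisibility"
begin

text \<open>
  In Milnor-Witt K-theory put \<open>\<langle>a\<rangle> = 1 + \<eta>[a]\<close>. The defining relations make \<open>\<langle>_\<rangle>\<close> multiplicative and
  central, with \<open>\<langle>1\<rangle> = 1\<close> (lemma \<open>ang_one\<close>), and turn \<open>[ab] = [a] + [b] + \<eta>[a][b]\<close> into linearity of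
  \<open>\<langle>a\<rangle> - 1 \<mapsto> [a]\<close> over the group ring. So the universal properties of group ring, tensor algebra and
  quotient provide the natural map (\<open>natural_map_exists\<close>). It is unique because \<open>K\<close>-hat is generated as a
  ring by the elements \<open>\<langle>a\<rangle>\<close> and \<open>[a]\<close> (\<open>natural_map_unique\<close>).

  The inverse in degree \<open>n \<ge> 2\<close> is constructed by hand. As \<open>\<eta>\<close> commutes with the symbols and
  \<open>\<eta>[a] = \<langle>a\<rangle> - 1\<close>, a word of degree \<open>n\<close> with symbols \<open>[a\<^sub>1], \<dots>, [a\<^sub>m]\<close> and \<open>k = m - n\<close> occurrences of \<open>\<eta>\<close>
  has to go to \<open>(\<langle>a\<^sub>1\<rangle> - 1) \<dots> (\<langle>a\<^sub>k\<rangle> - 1)[a\<^bsub>k+1\<^esub>] \<dots> [a\<^sub>m]\<close> (\<open>symbol_prod\<close>). For the additive extension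
  \<open>backward\<close> to vanish on the two-sided ideal of relations, it is enough that it kills each relation
  multiplied by words on both sides (\<open>vanish_on_ideal\<close>). In \<open>K\<close>-hat the element
  \<open>(\<langle>a\<rangle> - 1)[b] = [ab] - [a] - [b]\<close> is symmetric in \<open>a\<close> and \<open>b\<close>, so the factors \<open>\<langle>a\<rangle> - 1\<close> may be taken from
  any positions (\<open>K_extract\<close>). This settles all relations except \<open>\<eta>\<^sup>2[-1] + 2\<eta> = 0\<close>, which amounts to
  \<open>h(\<langle>a\<rangle> - 1)[b][c] = 0\<close> for \<open>h = 1 + \<langle>-1\<rangle>\<close> (\<open>hyperbolic_D_br_br\<close>).

  That identity follows from the symmetry just mentioned and from \<open>\<langle>-1\<rangle>[b][c] = -[c][b]\<close> (\<open>br_br_swap\<close>), which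
  in turn comes from expanding \<open>[bc][-bc] = 0\<close>. The relation \<open>[a][-a] = 0\<close> (\<open>br_br_uminus\<close>) is
  classical when \<open>1 - a\<close> is a unit, and trivial for \<open>a = 1\<close>, which settles the case of a field. Otherwise it
  is reduced to the classical case by means of auxiliary units, and this is where the residue field
  must have at least four elements (\<open>rich_units_residue\<close>).

  Finally, the natural map sends the value of a word under \<open>backward\<close> to the class of that word, which
  gives surjectivity. Since \<open>K\<close>-hat in positive degree is additively generated by the products
  \<open>[a\<^sub>1] \<dots> [a\<^sub>n]\<close> (\<open>Khat_deg_Kspan\<close>), \<open>backward\<close> also provides a left inverse, which gives injectivity.
\<close>

section \<open>Monoid rings\<close>

lemma (in abelian_monoid) finsum_split:
  assumes "\<And>x. x \<in> A \<Longrightarrow> f x \<in> carrier G" "\<And>x. x \<in> A \<Longrightarrow> g x \<in> carrier G"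
    and "\<And>x. x \<in> A \<Longrightarrow> h x = f x \<oplus> g x"
  shows "finsum G h A = finsum G f A \<oplus> finsum G g A"
proof -
  have "finsum G h A = (\<Oplus>x\<in>A. f x \<oplus> g x)"
    using assms by (intro finsum_cong') auto
  also have "\<dots> = finsum G f A \<oplus> finsum G g A"
    using assms by (intro finsum_addf) auto
  finally show ?thesis .
qed

text \<open>The general theory of the monoid ring of \<open>G\<close> over a possibly noncommutative ring \<open>R\<close>. It is
  instantiated three times: to the group ring of the units, to the free ring on the generators of
  Milnor-Witt K-theory, and to the free algebra over the group ring on the augmentation ideal.\<close>

locale monoid_algebra = R: ring R + G: monoid G
  for R :: "('r, 'm) ring_scheme" (structure) and G :: "('g, 'n) monoid_scheme"
begin

abbreviation MR :: "('g \<Rightarrow> 'r) ring" where "MR \<equiv> monoid_ring R G"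

lemma MR_carrier:
  "f \<in> carrier MR \<longleftrightarrow> (\<forall>x. f x \<in> carrier R) \<and> finite (supp R f) \<and> supp R f \<subseteq> carrier G"
  by (auto simp: monoid_ring_def)

lemma MR_val [simp]: "f \<in> carrier MR \<Longrightarrow> f x \<in> carrier R"
  by (simp add: MR_carrier)

lemma MR_supp: "f \<in> carrier MR \<Longrightarrow> finite (supp R f)" "f \<in> carrier MR \<Longrightarrow> supp R f \<subseteq> carrier G"
  by (simp_all add: MR_carrier)

lemma MR_zero: "\<zero>\<^bsub>MR\<^esub> = (\<lambda>x. \<zero>)" and MR_one: "\<one>\<^bsub>MR\<^esub> = single R \<one>\<^bsub>G\<^esub> \<one>"
  and MR_add: "f \<oplus>\<^bsub>MR\<^esub> g = (\<lambda>x. f x \<oplus> g x)"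
  by (simp_all add: monoid_ring_def)

lemma MR_memI:
  assumes "\<And>x. f x \<in> carrier R" "finite S" "S \<subseteq> carrier G" "\<And>x. x \<notin> S \<Longrightarrow> f x = \<zero>"
  shows "f \<in> carrier MR"
proof -
  have "supp R f \<subseteq> S" using assms(4) by (auto simp: supp_def)
  then show ?thesis using assms(1-3) by (auto simp: MR_carrier intro: finite_subset)
qed

lemma single_closed [simp]:
  assumes "x \<in> carrier G" "r \<in> carrier R"
  shows "single R x r \<in> carrier MR"
  by (rule MR_memI[where S = "{x}"]) (use assms in \<open>auto simp: single_def\<close>)

lemma add_closed: "f \<in> carrier MR \<Longrightarrow> g \<in> carrier MR \<Longrightarrow> f \<oplus>\<^bsub>MR\<^esub> g \<in> carrier MR"
  by (rule MR_memI[where S = "supp R f \<union> supp R g"]) (auto simp: MR_add MR_carrier supp_def)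

lemma zero_closed: "\<zero>\<^bsub>MR\<^esub> \<in> carrier MR"
  by (rule MR_memI[where S = "{}"]) (auto simp: MR_zero)

lemma MR_abelian_group: "abelian_group MR"
proof (rule abelian_groupI)
  fix f assume f: "f \<in> carrier MR"
  let ?g = "\<lambda>x. \<ominus> f x"
  have "?g \<in> carrier MR"
    by (rule MR_memI[where S = "supp R f"]) (use f in \<open>auto simp: MR_carrier supp_def\<close>)
  moreover have "?g \<oplus>\<^bsub>MR\<^esub> f = \<zero>\<^bsub>MR\<^esub>"
    using f by (auto simp: MR_add MR_zero R.l_neg)
  ultimately show "\<exists>y\<in>carrier MR. y \<oplus>\<^bsub>MR\<^esub> f = \<zero>\<^bsub>MR\<^esub>" by blast
qed (auto simp: add_closed zero_closed, auto simp: MR_add MR_zero R.a_ac)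

lemma single_add:
  assumes "r \<in> carrier R" "s \<in> carrier R"
  shows "single R x (r \<oplus> s) = single R x r \<oplus>\<^bsub>MR\<^esub> single R x s"
  using assms by (auto simp: single_def MR_add)

lemma single_zero: "single R x \<zero> = \<zero>\<^bsub>MR\<^esub>"
  by (auto simp: single_def MR_zero)

lemma MR_induct [consumes 1, case_names zero add]:
  assumes f: "f \<in> carrier MR"
    and zero: "P \<zero>\<^bsub>MR\<^esub>"
    and add: "\<And>f x r. f \<in> carrier MR \<Longrightarrow> x \<in> carrier G \<Longrightarrow> r \<in> carrier R \<Longrightarrow> P f \<Longrightarrow>
      P (single R x r \<oplus>\<^bsub>MR\<^esub> f)"
  shows "P f"
proof -
  have "f \<in> carrier MR \<longrightarrow> supp R f \<subseteq> S \<longrightarrow> P f" if "finite S" "S \<subseteq> carrier G" for S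
    using that
  proof (induction S arbitrary: f rule: finite_induct)
    case empty
    have "f = \<zero>\<^bsub>MR\<^esub>" if "supp R f \<subseteq> {}"
      using that by (auto simp: supp_def MR_zero)
    then show ?case using zero by auto
  next
    case (insert x S)
    show ?case
    proof (intro impI)
      assume f: "f \<in> carrier MR" and sub: "supp R f \<subseteq> insert x S"
      let ?g = "\<lambda>y. if y = x then \<zero> else f y"
      have sg: "supp R ?g \<subseteq> S" using sub by (auto simp: supp_def)
      have g: "?g \<in> carrier MR"
        by (rule MR_memI[where S = S]) (use insert.hyps insert.prems f sub in \<open>auto simp: supp_def\<close>)
      have "P ?g" using insert.IH insert.prems g sg by blast
      moreover have "f = single R x (f x) \<oplus>\<^bsub>MR\<^esub> ?g"
        using f by (auto simp: single_def MR_add)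
      ultimately show "P f"
        using add[OF g, of x "f x"] insert.prems f by auto
    qed
  qed
  then show ?thesis using f MR_supp[OF f] by blast
qed

subsection \<open>Multiplication\<close>

lemma MR_mult:
  assumes f: "f \<in> carrier MR" and g: "g \<in> carrier MR"
    and S: "finite S" "supp R f \<subseteq> S" and T: "finite T" "supp R g \<subseteq> T"
  shows "(f \<otimes>\<^bsub>MR\<^esub> g) x =
    (\<Oplus>y\<in>S. \<Oplus>z\<in>T. (if y \<otimes>\<^bsub>G\<^esub> z = x then f y \<otimes> g z else \<zero>))"
proof -
  let ?t = "\<lambda>y z. if y \<otimes>\<^bsub>G\<^esub> z = x then f y \<otimes> g z else \<zero>"
  have fv: "f y \<in> carrier R" "g y \<in> carrier R" for y using f g by auto
  have inner: "(\<Oplus>z\<in>supp R g. ?t y z) = (\<Oplus>z\<in>T. ?t y z)" for y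
    by (rule R.add.finprod_mono_neutral_cong_left)
      (use T fv in \<open>auto simp: supp_def\<close>)
  have "(\<Oplus>y\<in>supp R f. \<Oplus>z\<in>T. ?t y z) = (\<Oplus>y\<in>S. \<Oplus>z\<in>T. ?t y z)"
  proof (rule R.add.finprod_mono_neutral_cong_left)
    show "(\<Oplus>z\<in>T. ?t y z) = \<zero>" if "y \<in> S - supp R f" for y
      using that fv by (intro R.add.finprod_one_eqI) (auto simp: supp_def)
  qed (use S fv in \<open>auto intro!: R.finsum_closed\<close>)
  then show ?thesis by (simp add: monoid_ring_def inner)
qed

lemma mult_closed:
  assumes f: "f \<in> carrier MR" and g: "g \<in> carrier MR"
  shows "f \<otimes>\<^bsub>MR\<^esub> g \<in> carrier MR"
proof (rule MR_memI[where S = "(\<lambda>(y, z). y \<otimes>\<^bsub>G\<^esub> z) ` (supp R f \<times> supp R g)"])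
  note eq = MR_mult[OF f g MR_supp(1)[OF f] order_refl MR_supp(1)[OF g] order_refl]
  have fv: "f y \<in> carrier R" "g y \<in> carrier R" for y using f g by auto
  show "(f \<otimes>\<^bsub>MR\<^esub> g) x \<in> carrier R" for x
    unfolding eq using fv by (auto intro!: R.finsum_closed)
  show "(f \<otimes>\<^bsub>MR\<^esub> g) x = \<zero>"
    if "x \<notin> (\<lambda>(y, z). y \<otimes>\<^bsub>G\<^esub> z) ` (supp R f \<times> supp R g)" for x
    unfolding eq using that by (intro R.add.finprod_one_eqI) auto
  show "finite ((\<lambda>(y, z). y \<otimes>\<^bsub>G\<^esub> z) ` (supp R f \<times> supp R g))"
    using MR_supp f g by auto
  show "(\<lambda>(y, z). y \<otimes>\<^bsub>G\<^esub> z) ` (supp R f \<times> supp R g) \<subseteq> carrier G"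
    using MR_supp(2)[OF f] MR_supp(2)[OF g] by auto
qed

lemma MR_l_distr:
  assumes f: "f \<in> carrier MR" and g: "g \<in> carrier MR" and h: "h \<in> carrier MR"
  shows "(f \<oplus>\<^bsub>MR\<^esub> g) \<otimes>\<^bsub>MR\<^esub> h = f \<otimes>\<^bsub>MR\<^esub> h \<oplus>\<^bsub>MR\<^esub> g \<otimes>\<^bsub>MR\<^esub> h"
proof
  fix x
  let ?S = "supp R f \<union> supp R g" and ?T = "supp R h"
  have S: "finite ?S" "supp R f \<subseteq> ?S" "supp R g \<subseteq> ?S" "supp R (f \<oplus>\<^bsub>MR\<^esub> g) \<subseteq> ?S"
    using MR_supp f g by (auto simp: supp_def MR_add)
  have T: "finite ?T" "supp R h \<subseteq> ?T" using MR_supp h by auto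
  have v: "f y \<in> carrier R" "g y \<in> carrier R" "h y \<in> carrier R" for y using f g h by auto
  show "((f \<oplus>\<^bsub>MR\<^esub> g) \<otimes>\<^bsub>MR\<^esub> h) x = (f \<otimes>\<^bsub>MR\<^esub> h \<oplus>\<^bsub>MR\<^esub> g \<otimes>\<^bsub>MR\<^esub> h) x"
    unfolding MR_mult[OF add_closed[OF f g] h S(1,4) T] MR_add[of "f \<otimes>\<^bsub>MR\<^esub> h"]
      MR_mult[OF f h S(1,2) T] MR_mult[OF g h S(1,3) T]
    by (intro R.finsum_split R.finsum_closed) (use v in \<open>auto simp: MR_add R.l_distr\<close>)
qed

lemma MR_r_distr:
  assumes f: "f \<in> carrier MR" and g: "g \<in> carrier MR" and h: "h \<in> carrier MR"
  shows "h \<otimes>\<^bsub>MR\<^esub> (f \<oplus>\<^bsub>MR\<^esub> g) = h \<otimes>\<^bsub>MR\<^esub> f \<oplus>\<^bsub>MR\<^esub> h \<otimes>\<^bsub>MR\<^esub> g"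
proof
  fix x
  let ?S = "supp R f \<union> supp R g" and ?T = "supp R h"
  have S: "finite ?S" "supp R f \<subseteq> ?S" "supp R g \<subseteq> ?S" "supp R (f \<oplus>\<^bsub>MR\<^esub> g) \<subseteq> ?S"
    using MR_supp f g by (auto simp: supp_def MR_add)
  have T: "finite ?T" "supp R h \<subseteq> ?T" using MR_supp h by auto
  have v: "f y \<in> carrier R" "g y \<in> carrier R" "h y \<in> carrier R" for y using f g h by auto
  show "(h \<otimes>\<^bsub>MR\<^esub> (f \<oplus>\<^bsub>MR\<^esub> g)) x = (h \<otimes>\<^bsub>MR\<^esub> f \<oplus>\<^bsub>MR\<^esub> h \<otimes>\<^bsub>MR\<^esub> g) x"
    unfolding MR_mult[OF h add_closed[OF f g] T S(1,4)] MR_add[of "h \<otimes>\<^bsub>MR\<^esub> f"]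
      MR_mult[OF h f T S(1,2)] MR_mult[OF h g T S(1,3)]
    by (intro R.finsum_split R.finsum_closed) (use v in \<open>auto simp: MR_add R.r_distr\<close>)
qed

lemma single_mult:
  assumes "x \<in> carrier G" "y \<in> carrier G" "r \<in> carrier R" "s \<in> carrier R"
  shows "single R x r \<otimes>\<^bsub>MR\<^esub> single R y s = single R (x \<otimes>\<^bsub>G\<^esub> y) (r \<otimes> s)"
proof
  fix z
  have "(single R x r \<otimes>\<^bsub>MR\<^esub> single R y s) z = 
    (\<Oplus>a\<in>{x}. \<Oplus>b\<in>{y}. if a \<otimes>\<^bsub>G\<^esub> b = z then single R x r a \<otimes> single R y s b else \<zero>)"
    by (rule MR_mult) (use assms in \<open>simp_all add: supp_def, auto simp: single_def split: if_splits\<close>)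
  also have "\<dots> = single R (x \<otimes>\<^bsub>G\<^esub> y) (r \<otimes> s) z"
    using assms by (auto simp: single_def)
  finally show "(single R x r \<otimes>\<^bsub>MR\<^esub> single R y s) z = single R (x \<otimes>\<^bsub>G\<^esub> y) (r \<otimes> s) z" .
qed

text \<open>Both sides of the associative law and of the unit laws are additive in each argument, so these
  laws need to be checked on \<^const>\<open>single\<close> only.\<close>

lemma MR_ring: "ring MR"
proof -
  interpret A: abelian_group MR by (rule MR_abelian_group)
  note [simp] = mult_closed MR_l_distr MR_r_distr single_mult single_closed
  have z: "\<zero>\<^bsub>MR\<^esub> \<otimes>\<^bsub>MR\<^esub> f = \<zero>\<^bsub>MR\<^esub>" "f \<otimes>\<^bsub>MR\<^esub> \<zero>\<^bsub>MR\<^esub> = \<zero>\<^bsub>MR\<^esub>"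
    if f: "f \<in> carrier MR" for f
  proof -
    have "\<zero>\<^bsub>MR\<^esub> \<otimes>\<^bsub>MR\<^esub> f \<oplus>\<^bsub>MR\<^esub> \<zero>\<^bsub>MR\<^esub> \<otimes>\<^bsub>MR\<^esub> f = \<zero>\<^bsub>MR\<^esub> \<otimes>\<^bsub>MR\<^esub> f"
      using f by (simp flip: MR_l_distr)
    then show "\<zero>\<^bsub>MR\<^esub> \<otimes>\<^bsub>MR\<^esub> f = \<zero>\<^bsub>MR\<^esub>"
      using f by (metis A.add.r_cancel_one A.zero_closed mult_closed)
    have "f \<otimes>\<^bsub>MR\<^esub> \<zero>\<^bsub>MR\<^esub> \<oplus>\<^bsub>MR\<^esub> f \<otimes>\<^bsub>MR\<^esub> \<zero>\<^bsub>MR\<^esub> = f \<otimes>\<^bsub>MR\<^esub> \<zero>\<^bsub>MR\<^esub>"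
      using f by (simp flip: MR_r_distr)
    then show "f \<otimes>\<^bsub>MR\<^esub> \<zero>\<^bsub>MR\<^esub> = \<zero>\<^bsub>MR\<^esub>"
      using f by (metis A.add.r_cancel_one A.zero_closed mult_closed)
  qed
  note [simp] = z
  show ?thesis
  proof (rule ringI)
    show "abelian_group MR" by (rule MR_abelian_group)
    show "Group.monoid MR"
    proof (rule monoidI)
      show "\<one>\<^bsub>MR\<^esub> \<in> carrier MR" by (simp add: MR_one)
      fix f assume f: "f \<in> carrier MR"
      show "\<one>\<^bsub>MR\<^esub> \<otimes>\<^bsub>MR\<^esub> f = f" 
        using f by (induction rule: MR_induct) (simp_all add: MR_one)
      show "f \<otimes>\<^bsub>MR\<^esub> \<one>\<^bsub>MR\<^esub> = f" 
        using f by (induction rule: MR_induct) (simp_all add: MR_one)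
      fix g h assume g: "g \<in> carrier MR" and h: "h \<in> carrier MR"
      show "f \<otimes>\<^bsub>MR\<^esub> g \<otimes>\<^bsub>MR\<^esub> h = f \<otimes>\<^bsub>MR\<^esub> (g \<otimes>\<^bsub>MR\<^esub> h)"
        using f
      proof (induction rule: MR_induct)
        case (add f x r)
        have "single R x r \<otimes>\<^bsub>MR\<^esub> g \<otimes>\<^bsub>MR\<^esub> h = single R x r \<otimes>\<^bsub>MR\<^esub> (g \<otimes>\<^bsub>MR\<^esub> h)"
          using g
        proof (induction rule: MR_induct)
          case add': (add g y s)
          have "single R x r \<otimes>\<^bsub>MR\<^esub> single R y s \<otimes>\<^bsub>MR\<^esub> h =
              single R x r \<otimes>\<^bsub>MR\<^esub> (single R y s \<otimes>\<^bsub>MR\<^esub> h)"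
            using h by (induction rule: MR_induct)
              (use add add' in \<open>simp_all add: R.m_assoc G.m_assoc\<close>)
          with add add' h show ?case by simp
        qed (use add h in simp)
        with add g h show ?case by simp
      qed (use g h in simp)
    qed (rule mult_closed)
  qed (simp_all)
qed

sublocale MR: ring MR by (rule MR_ring)

lemma single_minus:
  assumes "x \<in> carrier G" "r \<in> carrier R"
  shows "single R x (\<ominus> r) = \<ominus>\<^bsub>MR\<^esub> single R x r"
proof -
  have "single R x (\<ominus> r) \<oplus>\<^bsub>MR\<^esub> single R x r = \<zero>\<^bsub>MR\<^esub>"
    using assms by (simp add: single_add[symmetric] R.l_neg single_zero)
  then show ?thesis using assms by (simp add: MR.minus_equality)
qed

lemma MR_minus: "f \<in> carrier MR \<Longrightarrow> \<ominus>\<^bsub>MR\<^esub> f = (\<lambda>x. \<ominus> f x)"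
proof (rule MR.minus_equality)
  assume f: "f \<in> carrier MR"
  show "(\<lambda>x. \<ominus> f x) \<oplus>\<^bsub>MR\<^esub> f = \<zero>\<^bsub>MR\<^esub>" using f by (simp add: MR_add MR_zero R.l_neg)
  show "(\<lambda>x. \<ominus> f x) \<in> carrier MR"
    by (rule MR_memI[where S = "supp R f"]) (use f in \<open>auto simp: MR_carrier supp_def\<close>)
qed

text \<open>The elements supported in a set \<open>D\<close> of monoid elements. When \<open>D\<close> is the set of words of a given
  degree these are the homogeneous elements of that degree.\<close>

definition supported :: "'g set \<Rightarrow> ('g \<Rightarrow> 'r) set" where
  "supported D = {f \<in> carrier MR. supp R f \<subseteq> D}"

lemma supported_carrier: "f \<in> supported D \<Longrightarrow> f \<in> carrier MR"
  by (simp add: supported_def)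

lemma supported_iff: "f \<in> supported D \<longleftrightarrow> f \<in> carrier MR \<and> (\<forall>x. x \<notin> D \<longrightarrow> f x = \<zero>)"
  unfolding supported_def supp_def by blast

lemma supported_zero: "\<zero>\<^bsub>MR\<^esub> \<in> supported D"
  unfolding supported_iff by (simp add: MR_zero[symmetric]) (simp add: MR_zero)

lemma supported_add: "f \<in> supported D \<Longrightarrow> g \<in> supported D \<Longrightarrow> f \<oplus>\<^bsub>MR\<^esub> g \<in> supported D"
  unfolding supported_iff using add_closed[of f g] by (simp add: MR_add)

lemma supported_minus: "f \<in> supported D \<Longrightarrow> \<ominus>\<^bsub>MR\<^esub> f \<in> supported D"
  unfolding supported_iff using MR.a_inv_closed[of f] by (simp add: MR_minus)

lemma supported_single:
  assumes "x \<in> carrier G" "r \<in> carrier R" "x \<in> D"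
  shows "single R x r \<in> supported D"
proof -
  have "supp R (single R x r) \<subseteq> {x}" by (auto simp: supp_def single_def split: if_splits)
  then show ?thesis using assms by (auto simp: supported_def)
qed

lemma supported_induct [consumes 1, case_names zero add]:
  assumes f: "f \<in> supported D"
    and zero: "P \<zero>\<^bsub>MR\<^esub>"
    and add: "\<And>f x r. f \<in> supported D \<Longrightarrow> x \<in> carrier G \<Longrightarrow> x \<in> D \<Longrightarrow> r \<in> carrier R \<Longrightarrow>
      P f \<Longrightarrow> P (single R x r \<oplus>\<^bsub>MR\<^esub> f)"
  shows "P f"
proof -
  \<comment> \<open>Truncation to \<open>D\<close> reduces the claim to induction over the whole monoid ring.\<close>
  let ?c = "\<lambda>f x. if x \<in> D then f x else \<zero>"
  have cc: "?c f \<in> supported D" if "f \<in> carrier MR" for f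
  proof -
    have "?c f \<in> carrier MR"
      by (rule MR_memI[where S = "supp R f"]) (use that in \<open>auto simp: MR_carrier supp_def\<close>)
    then show ?thesis by (auto simp: supported_iff)
  qed
  have "P (?c f)" using supported_carrier[OF f]
  proof (induction rule: MR_induct)
    case zero
    have "?c \<zero>\<^bsub>MR\<^esub> = \<zero>\<^bsub>MR\<^esub>" by (auto simp: MR_zero)
    then show ?case using assms(2) by simp
  next
    case (add f x r)
    show ?case
    proof (cases "x \<in> D")
      case True
      have "?c (single R x r \<oplus>\<^bsub>MR\<^esub> f) = single R x r \<oplus>\<^bsub>MR\<^esub> ?c f"
        using True add by (auto simp: MR_add single_def)
      then show ?thesis using assms(3)[OF cc add(2) True add(3)] add by simp
    next
      case False
      have "?c (single R x r \<oplus>\<^bsub>MR\<^esub> f) = ?c f"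
        using False add by (auto simp: MR_add single_def)
      then show ?thesis using add by simp
    qed
  qed
  moreover have "f x = \<zero>" if "x \<notin> D" for x
    using f that by (simp add: supported_iff)
  then have "?c f = f" by auto
  ultimately show ?thesis by simp
qed

lemma supported_mult:
  assumes DE: "\<And>x y. x \<in> carrier G \<Longrightarrow> y \<in> carrier G \<Longrightarrow> x \<in> D \<Longrightarrow> y \<in> E \<Longrightarrow> x \<otimes>\<^bsub>G\<^esub> y \<in> H"
    and f: "f \<in> supported D" and g: "g \<in> supported E"
  shows "f \<otimes>\<^bsub>MR\<^esub> g \<in> supported H"
  using f
proof (induction rule: supported_induct)
  case zero
  then show ?case using g by (simp add: supported_carrier supported_zero)
next
  case (add f x r)
  have "single R x r \<otimes>\<^bsub>MR\<^esub> g \<in> supported H"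
    using g
  proof (induction rule: supported_induct)
    case zero
    then show ?case using add by (simp add: supported_carrier supported_zero)
  next
    case add': (add g y s)
    have "single R x r \<otimes>\<^bsub>MR\<^esub> single R y s \<in> supported H"
      using add add' by (simp add: single_mult supported_single DE)
    then show ?case using add add' by (simp add: MR.r_distr supported_carrier supported_add)
  qed
  then show ?case using add g by (simp add: MR.l_distr supported_carrier supported_add)
qed

subsection \<open>Additive extensions and the universal property\<close>

text \<open>The additive map on the monoid ring that sends \<open>r x\<close> to \<open>\<phi> x r\<close>. Letting \<open>\<phi>\<close> depend on the
  coefficient and the monoid element jointly covers both \<open>\<int>\<close>-linear extensions and the extension of a
  pair of a ring homomorphism on \<open>R\<close> and a monoid homomorphism on \<open>G\<close>.\<close>

definition additive_ext :: "('s, 'k) ring_scheme \<Rightarrow> ('g \<Rightarrow> 'r \<Rightarrow> 's) \<Rightarrow> ('g \<Rightarrow> 'r) \<Rightarrow> 's" where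
  "additive_ext S \<phi> f = (\<Oplus>\<^bsub>S\<^esub>x\<in>supp R f. \<phi> x (f x))"

context
  fixes S :: "('s, 'k) ring_scheme" and \<phi> :: "'g \<Rightarrow> 'r \<Rightarrow> 's"
  assumes S: "ring S"
    and closed: "\<And>x r. x \<in> carrier G \<Longrightarrow> r \<in> carrier R \<Longrightarrow> \<phi> x r \<in> carrier S"
    and additive: "\<And>x r s. x \<in> carrier G \<Longrightarrow> r \<in> carrier R \<Longrightarrow> s \<in> carrier R \<Longrightarrow>
      \<phi> x (r \<oplus> s) = \<phi> x r \<oplus>\<^bsub>S\<^esub> \<phi> x s"
begin

interpretation S: ring S by (rule S)

lemma additive_ext_coeff_zero:
  assumes x: "x \<in> carrier G"
  shows "\<phi> x \<zero> = \<zero>\<^bsub>S\<^esub>"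
proof -
  have "\<phi> x \<zero> \<oplus>\<^bsub>S\<^esub> \<phi> x \<zero> = \<phi> x \<zero>"
    using additive[OF x R.zero_closed R.zero_closed] unfolding R.l_zero[OF R.zero_closed] by (rule sym)
  then show ?thesis
    by (rule iffD1[OF S.add.r_cancel_one[OF closed[OF x R.zero_closed] closed[OF x R.zero_closed]]])
qed

lemma additive_ext_superset:
  assumes "f \<in> carrier MR" "finite T" "supp R f \<subseteq> T" "T \<subseteq> carrier G"
  shows "additive_ext S \<phi> f = (\<Oplus>\<^bsub>S\<^esub>x\<in>T. \<phi> x (f x))"
  unfolding additive_ext_def
proof (rule S.add.finprod_mono_neutral_cong_left)
  show "\<phi> i (f i) = \<zero>\<^bsub>S\<^esub>" if "i \<in> T - supp R f" for i
    using that assms additive_ext_coeff_zero by (auto simp: supp_def)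
  show "(\<lambda>x. \<phi> x (f x)) \<in> T \<rightarrow> carrier S"
    using assms closed MR_val by blast
qed (use assms in auto)

lemma additive_ext_closed: "f \<in> carrier MR \<Longrightarrow> additive_ext S \<phi> f \<in> carrier S"
  unfolding additive_ext_def by (rule S.finsum_closed) (auto intro!: closed dest: MR_supp(2))

lemma additive_ext_add:
  assumes f: "f \<in> carrier MR" and g: "g \<in> carrier MR"
  shows "additive_ext S \<phi> (f \<oplus>\<^bsub>MR\<^esub> g) = additive_ext S \<phi> f \<oplus>\<^bsub>S\<^esub> additive_ext S \<phi> g"
proof -
  let ?T = "supp R f \<union> supp R g"
  have T: "finite ?T" "supp R f \<subseteq> ?T" "supp R g \<subseteq> ?T" "supp R (f \<oplus>\<^bsub>MR\<^esub> g) \<subseteq> ?T" "?T \<subseteq> carrier G"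
    using MR_supp f g by (auto simp: supp_def MR_add)
  have c: "x \<in> ?T \<Longrightarrow> x \<in> carrier G" for x using T(5) by blast
  show ?thesis
    unfolding additive_ext_superset[OF add_closed[OF f g] T(1,4,5)] additive_ext_superset[OF f T(1,2,5)]
      additive_ext_superset[OF g T(1,3,5)]
    by (rule S.finsum_split) (simp_all add: f g c closed additive MR_add)
qed

lemma additive_ext_single:
  assumes "x \<in> carrier G" "r \<in> carrier R"
  shows "additive_ext S \<phi> (single R x r) = \<phi> x r"
proof -
  have "supp R (single R x r) \<subseteq> {x}" by (auto simp: supp_def single_def split: if_splits)
  from additive_ext_superset[OF single_closed[OF assms] _ this] show ?thesis
    using assms closed by (simp add: single_def)
qed

lemma additive_ext_zero: "additive_ext S \<phi> \<zero>\<^bsub>MR\<^esub> = \<zero>\<^bsub>S\<^esub>"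
  by (simp add: additive_ext_def MR_zero supp_def)

text \<open>The universal property of the monoid ring.\<close>

lemma additive_ext_ring_hom:
  assumes mult: "\<And>x y r s. x \<in> carrier G \<Longrightarrow> y \<in> carrier G \<Longrightarrow> r \<in> carrier R \<Longrightarrow> s \<in> carrier R \<Longrightarrow>
      \<phi> (x \<otimes>\<^bsub>G\<^esub> y) (r \<otimes> s) = \<phi> x r \<otimes>\<^bsub>S\<^esub> \<phi> y s"
    and one: "\<phi> \<one>\<^bsub>G\<^esub> \<one> = \<one>\<^bsub>S\<^esub>"
  shows "additive_ext S \<phi> \<in> ring_hom MR S"
proof (rule ring_hom_memI)
  fix f g assume f: "f \<in> carrier MR" and g: "g \<in> carrier MR"
  show "additive_ext S \<phi> (f \<otimes>\<^bsub>MR\<^esub> g) = additive_ext S \<phi> f \<otimes>\<^bsub>S\<^esub> additive_ext S \<phi> g"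
    using f
  proof (induction rule: MR_induct)
    case (add f x r)
    have "additive_ext S \<phi> (single R x r \<otimes>\<^bsub>MR\<^esub> g) = additive_ext S \<phi> (single R x r) \<otimes>\<^bsub>S\<^esub> additive_ext S \<phi> g"
      using g by (induction rule: MR_induct)
        (use add in \<open>simp_all add: MR.r_distr additive_ext_add additive_ext_zero additive_ext_single closed single_mult mult
          additive_ext_closed S.r_distr\<close>)
    then show ?case using add g by (simp add: MR.l_distr additive_ext_add additive_ext_closed S.l_distr)
  qed (use g additive_ext_closed in \<open>simp add: additive_ext_zero\<close>)
qed (simp_all add: additive_ext_closed additive_ext_add MR_one additive_ext_single one)

end

end

lemma free_monoid_monoid: "Group.monoid (free_monoid X)"
  by (rule monoidI) (auto simp: free_monoid_def)

section \<open>Symbols with Milnor-Witt relations\<close>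

text \<open>A ring with symbols \<open>W a = \<langle>a\<rangle>\<close> and \<open>br a = [a]\<close> subject to the relations shared by both rings of
  the theorem. In \<open>K\<close>-hat the \<open>\<langle>a\<rangle>\<close> come from the group ring, and in Milnor-Witt K-theory
  \<open>\<langle>a\<rangle> = 1 + \<eta>[a]\<close>.\<close>

locale mw_symbols = S?: ring S + A: cring A
  for S :: "('s, 'k) ring_scheme" (structure) and A :: "('a, 'm) ring_scheme" +
  fixes W br :: "'a \<Rightarrow> 's"
  assumes W_closed [simp]: "a \<in> Units A \<Longrightarrow> W a \<in> carrier S"
    and br_closed [simp]: "a \<in> Units A \<Longrightarrow> br a \<in> carrier S"
    and W_mult: "a \<in> Units A \<Longrightarrow> b \<in> Units A \<Longrightarrow> W (a \<otimes>\<^bsub>A\<^esub> b) = W a \<otimes> W b"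
    and W_one: "W \<one>\<^bsub>A\<^esub> = \<one>"
    and br_W: "a \<in> Units A \<Longrightarrow> b \<in> Units A \<Longrightarrow> br b \<otimes> W a = W a \<otimes> br b"
    and br_mult: "a \<in> Units A \<Longrightarrow> b \<in> Units A \<Longrightarrow> br (a \<otimes>\<^bsub>A\<^esub> b) = br a \<oplus> W a \<otimes> br b"
    and steinberg: "a \<in> Units A \<Longrightarrow> \<one>\<^bsub>A\<^esub> \<ominus>\<^bsub>A\<^esub> a \<in> Units A \<Longrightarrow>
      br a \<otimes> br (\<one>\<^bsub>A\<^esub> \<ominus>\<^bsub>A\<^esub> a) = \<zero>"
begin

lemma W_comm:
  assumes "a \<in> Units A" "b \<in> Units A"
  shows "W a \<otimes> W b = W b \<otimes> W a"
  using assms by (simp add: A.m_comm A.Units_closed flip: W_mult)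

lemma br_W':
  assumes "a \<in> Units A" "b \<in> Units A" "x \<in> carrier S"
  shows "br b \<otimes> (W a \<otimes> x) = W a \<otimes> (br b \<otimes> x)"
  using assms br_W[of a b] by (simp flip: m_assoc)

lemma W_comm':
  assumes "a \<in> Units A" "b \<in> Units A" "x \<in> carrier S"
  shows "W a \<otimes> (W b \<otimes> x) = W b \<otimes> (W a \<otimes> x)"
  using assms W_comm[of a b] by (simp flip: m_assoc)

lemmas W_left = br_W br_W' r_distr l_distr m_assoc r_minus l_minus

lemma W_inv_cancel:
  assumes "a \<in> Units A" "x \<in> carrier S" "W a \<otimes> x = \<zero>"
  shows "x = \<zero>"
proof -
  have "W (inv\<^bsub>A\<^esub> a) \<otimes> (W a \<otimes> x) = x"
    using assms(1,2) by (simp flip: m_assoc W_mult add: W_one)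
  then show ?thesis using assms by simp
qed

lemma br_one: "br \<one>\<^bsub>A\<^esub> = \<zero>"
proof -
  have "br \<one>\<^bsub>A\<^esub> \<oplus> br \<one>\<^bsub>A\<^esub> = br \<one>\<^bsub>A\<^esub>"
    using br_mult[of "\<one>\<^bsub>A\<^esub>" "\<one>\<^bsub>A\<^esub>"] by (simp add: W_one)
  then show ?thesis
    by (metis A.Units_one_closed S.add.r_cancel_one br_closed)
qed

lemma br_inv:
  assumes "a \<in> Units A"
  shows "br a = \<ominus> (W a \<otimes> br (inv\<^bsub>A\<^esub> a))"
proof -
  have "br a \<oplus> W a \<otimes> br (inv\<^bsub>A\<^esub> a) = \<zero>"
    using assms br_mult[of a "inv\<^bsub>A\<^esub> a"] by (simp add: br_one)
  then show ?thesis using assms by (simp add: minus_equality)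
qed

lemma uminus_unit: "a \<in> Units A \<Longrightarrow> \<ominus>\<^bsub>A\<^esub> a \<in> Units A"
proof -
  assume a: "a \<in> Units A"
  have "(\<ominus>\<^bsub>A\<^esub> a) \<otimes>\<^bsub>A\<^esub> (\<ominus>\<^bsub>A\<^esub> (inv\<^bsub>A\<^esub> a)) = \<one>\<^bsub>A\<^esub>" "(\<ominus>\<^bsub>A\<^esub> (inv\<^bsub>A\<^esub> a)) \<otimes>\<^bsub>A\<^esub> (\<ominus>\<^bsub>A\<^esub> a) = \<one>\<^bsub>A\<^esub>"
    using a by (simp_all add: A.l_minus A.r_minus A.Units_closed)
  moreover have "\<ominus>\<^bsub>A\<^esub> a \<in> carrier A" "\<ominus>\<^bsub>A\<^esub> (inv\<^bsub>A\<^esub> a) \<in> carrier A"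
    using a by (simp_all add: A.Units_closed)
  ultimately show ?thesis unfolding Units_def by blast
qed

abbreviation m1 where "m1 \<equiv> \<ominus>\<^bsub>A\<^esub> \<one>\<^bsub>A\<^esub>"

lemma m1_unit [simp]: "m1 \<in> Units A"
  by (simp add: uminus_unit)

lemma uminus_eq: "a \<in> Units A \<Longrightarrow> \<ominus>\<^bsub>A\<^esub> a = a \<otimes>\<^bsub>A\<^esub> m1"
  by (simp add: A.r_minus A.Units_closed)

text \<open>The relation \<open>[a][-a] = 0\<close> when \<open>1 - a\<close> is a unit: write \<open>1 - a = (-a)(1 - 1/a)\<close> and use the Steinberg
  relations of \<open>a\<close> and of \<open>1/a\<close>.\<close>

lemma br_br_uminus_of_unit:
  assumes a: "a \<in> Units A" and a1: "\<one>\<^bsub>A\<^esub> \<ominus>\<^bsub>A\<^esub> a \<in> Units A"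
  shows "br a \<otimes> br (\<ominus>\<^bsub>A\<^esub> a) = \<zero>"
proof -
  let ?i = "inv\<^bsub>A\<^esub> a" and ?n = "\<ominus>\<^bsub>A\<^esub> a"
  have ac: "a \<in> carrier A" using a by auto
  have ic: "?i \<in> carrier A" "?i \<in> Units A" using a by auto
  have n: "?n \<in> Units A" using a by (rule uminus_unit)
  have e: "(\<one>\<^bsub>A\<^esub> \<ominus>\<^bsub>A\<^esub> a) \<otimes>\<^bsub>A\<^esub> (\<ominus>\<^bsub>A\<^esub> ?i) = \<one>\<^bsub>A\<^esub> \<ominus>\<^bsub>A\<^esub> ?i"
    using ac ic a by (simp add: A.minus_eq A.l_distr A.l_minus A.r_minus A.minus_add A.a_comm)
  have c: "\<one>\<^bsub>A\<^esub> \<ominus>\<^bsub>A\<^esub> ?i \<in> Units A"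
    using A.Units_m_closed[OF a1 uminus_unit[OF ic(2)]] by (simp add: e)
  have "?n \<otimes>\<^bsub>A\<^esub> (\<one>\<^bsub>A\<^esub> \<ominus>\<^bsub>A\<^esub> ?i) = \<one>\<^bsub>A\<^esub> \<ominus>\<^bsub>A\<^esub> a"
    using ac ic a by (simp add: A.minus_eq A.r_distr A.l_minus A.r_minus A.minus_add A.a_comm)
  then have "br (\<one>\<^bsub>A\<^esub> \<ominus>\<^bsub>A\<^esub> a) = br ?n \<oplus> W ?n \<otimes> br (\<one>\<^bsub>A\<^esub> \<ominus>\<^bsub>A\<^esub> ?i)"
    using br_mult[OF n c] by simp
  then have "\<zero> = br a \<otimes> br ?n \<oplus> W ?n \<otimes> (br a \<otimes> br (\<one>\<^bsub>A\<^esub> \<ominus>\<^bsub>A\<^esub> ?i))"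
    using steinberg[OF a a1] a n c by (simp add: W_left)
  moreover have "br a \<otimes> br (\<one>\<^bsub>A\<^esub> \<ominus>\<^bsub>A\<^esub> ?i) = \<zero>"
    unfolding br_inv[OF a] using a c ic steinberg[OF ic(2) c] by (simp add: W_left)
  ultimately show ?thesis using a n by simp
qed

text \<open>The expansion of \<open>[ab][-ab]\<close>. The middle term is the deviation from the graded commutativity
  law \<open>[b][a] = -\<langle>-1\<rangle>[a][b]\<close>.\<close>

lemma br_br_uminus_mult:
  assumes a: "a \<in> Units A" and b: "b \<in> Units A"
  shows "br (a \<otimes>\<^bsub>A\<^esub> b) \<otimes> br (\<ominus>\<^bsub>A\<^esub> (a \<otimes>\<^bsub>A\<^esub> b)) =
    br a \<otimes> br (\<ominus>\<^bsub>A\<^esub> a) \<oplus> W a \<otimes> (W m1 \<otimes> (br a \<otimes> br b) \<oplus> br b \<otimes> br a)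
      \<oplus> W a \<otimes> (W a \<otimes> (br b \<otimes> br (\<ominus>\<^bsub>A\<^esub> b)))"
proof -
  note ab = a b uminus_unit[OF a] uminus_unit[OF b]
  have 1: "br (\<ominus>\<^bsub>A\<^esub> (a \<otimes>\<^bsub>A\<^esub> b)) = br (\<ominus>\<^bsub>A\<^esub> a) \<oplus> W (\<ominus>\<^bsub>A\<^esub> a) \<otimes> br b"
    using br_mult[of "\<ominus>\<^bsub>A\<^esub> a" b] ab by (simp add: A.l_minus A.Units_closed)
  have 2: "br (\<ominus>\<^bsub>A\<^esub> (a \<otimes>\<^bsub>A\<^esub> b)) = br a \<oplus> W a \<otimes> br (\<ominus>\<^bsub>A\<^esub> b)"
    using br_mult[of a "\<ominus>\<^bsub>A\<^esub> b"] ab by (simp add: A.r_minus A.Units_closed)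
  have 3: "W (\<ominus>\<^bsub>A\<^esub> a) = W a \<otimes> W m1"
    unfolding uminus_eq[OF a] using a by (simp add: W_mult)
  have "br (a \<otimes>\<^bsub>A\<^esub> b) \<otimes> br (\<ominus>\<^bsub>A\<^esub> (a \<otimes>\<^bsub>A\<^esub> b)) =
      br a \<otimes> br (\<ominus>\<^bsub>A\<^esub> (a \<otimes>\<^bsub>A\<^esub> b)) \<oplus> W a \<otimes> (br b \<otimes> br (\<ominus>\<^bsub>A\<^esub> (a \<otimes>\<^bsub>A\<^esub> b)))"
    using ab uminus_unit[of "a \<otimes>\<^bsub>A\<^esub> b"] by (simp add: br_mult W_left)
  also have "br a \<otimes> br (\<ominus>\<^bsub>A\<^esub> (a \<otimes>\<^bsub>A\<^esub> b)) =
      br a \<otimes> br (\<ominus>\<^bsub>A\<^esub> a) \<oplus> W a \<otimes> (W m1 \<otimes> (br a \<otimes> br b))"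
    unfolding 1 3 using ab by (simp add: W_left)
  also have "br b \<otimes> br (\<ominus>\<^bsub>A\<^esub> (a \<otimes>\<^bsub>A\<^esub> b)) =
      br b \<otimes> br a \<oplus> W a \<otimes> (br b \<otimes> br (\<ominus>\<^bsub>A\<^esub> b))"
    unfolding 2 using ab by (simp add: W_left)
  finally show ?thesis using ab by (simp add: W_left a_ac)
qed

end

text \<open>There are enough units to remove the condition that \<open>1 - a\<close> be a unit from \<open>[a][-a] = 0\<close>: if \<open>1 - a\<close>
  is not a unit and \<open>a \<noteq> 1\<close>, there are units \<open>b\<close> and \<open>c\<close> such that each \<open>d\<close> among \<open>b\<close>, \<open>c\<close>, \<open>b c\<close> has both
  \<open>1 - d\<close> and \<open>1 - a d\<close> invertible.\<close>

definition rich_units :: "('a, 'm) ring_scheme \<Rightarrow> bool" where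
  "rich_units A \<longleftrightarrow> (\<forall>a\<in>Units A. a = \<one>\<^bsub>A\<^esub> \<or> \<one>\<^bsub>A\<^esub> \<ominus>\<^bsub>A\<^esub> a \<in> Units A \<or>
    (\<exists>b\<in>Units A. \<exists>c\<in>Units A. \<forall>d\<in>{b, c, b \<otimes>\<^bsub>A\<^esub> c}.
      \<one>\<^bsub>A\<^esub> \<ominus>\<^bsub>A\<^esub> d \<in> Units A \<and> \<one>\<^bsub>A\<^esub> \<ominus>\<^bsub>A\<^esub> a \<otimes>\<^bsub>A\<^esub> d \<in> Units A))"

locale mw_symbols_rich = mw_symbols +
  assumes rich: "rich_units A"
begin

text \<open>If \<open>1 - a\<close> is not a unit and \<open>a \<noteq> 1\<close>, take \<open>b\<close> and \<open>c\<close> as provided by richness.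
  For \<open>d\<close> among \<open>b\<close>, \<open>c\<close>, \<open>b c\<close> the expansion of \<open>[ad][-ad] = 0\<close> shows that
  \<open>f(d) = \<langle>a\<rangle>(\<langle>-1\<rangle>[a][d] + [d][a])\<close> has the same value \<open>-[a][-a]\<close>. Since \<open>f(b c) = f(b) + \<langle>b\<rangle>f(c)\<close>, the
  element \<open>\<langle>b\<rangle>[a][-a]\<close> vanishes, and \<open>\<langle>b\<rangle>\<close> is invertible.\<close>

lemma br_br_uminus:
  assumes a: "a \<in> Units A"
  shows "br a \<otimes> br (\<ominus>\<^bsub>A\<^esub> a) = \<zero>"
proof -
  let ?z = "br a \<otimes> br (\<ominus>\<^bsub>A\<^esub> a)"
  note n = uminus_unit[OF a]
  consider "a = \<one>\<^bsub>A\<^esub>" | "\<one>\<^bsub>A\<^esub> \<ominus>\<^bsub>A\<^esub> a \<in> Units A" |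
    (trick) b c where "b \<in> Units A" "c \<in> Units A" "\<forall>d\<in>{b, c, b \<otimes>\<^bsub>A\<^esub> c}.
      \<one>\<^bsub>A\<^esub> \<ominus>\<^bsub>A\<^esub> d \<in> Units A \<and> \<one>\<^bsub>A\<^esub> \<ominus>\<^bsub>A\<^esub> a \<otimes>\<^bsub>A\<^esub> d \<in> Units A"
    using rich a unfolding rich_units_def by blast
  then show ?thesis
  proof cases
    case trick
    define f where "f d = W a \<otimes> (W m1 \<otimes> (br a \<otimes> br d) \<oplus> br d \<otimes> br a)" for d
    have f: "f d = \<ominus> ?z" if "d \<in> {b, c, b \<otimes>\<^bsub>A\<^esub> c}" for d
    proof -
      have d: "d \<in> Units A" "\<one>\<^bsub>A\<^esub> \<ominus>\<^bsub>A\<^esub> d \<in> Units A" "\<one>\<^bsub>A\<^esub> \<ominus>\<^bsub>A\<^esub> a \<otimes>\<^bsub>A\<^esub> d \<in> Units A"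
        using that trick by auto
      have "?z \<oplus> f d = \<zero>"
        using br_br_uminus_mult[OF a d(1)] br_br_uminus_of_unit[OF d(1,2)]
          br_br_uminus_of_unit[OF A.Units_m_closed[OF a d(1)] d(3)] a d n
        by (simp add: f_def)
      then have "f d \<oplus> ?z = \<zero>" using a d n by (simp add: a_comm f_def)
      then show ?thesis using a d n by (simp add: minus_equality f_def)
    qed
    have "f (b \<otimes>\<^bsub>A\<^esub> c) = f b \<oplus> W b \<otimes> f c"
      using trick a W_comm'[of b a] W_comm'[of b m1] by (simp add: f_def br_mult W_left a_ac)
    then have "\<ominus> ?z \<oplus> W b \<otimes> \<ominus> ?z = \<ominus> ?z"
      by (simp add: f)
    then have "W b \<otimes> \<ominus> ?z = \<zero>"
      using trick a n S.add.r_cancel_one[of "\<ominus> ?z" "W b \<otimes> \<ominus> ?z"] by simp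
    then have "\<ominus> ?z = \<zero>" by (rule W_inv_cancel[rotated 2]) (use trick a n in auto)
    then show ?thesis using a n by (metis S.add.inv_eq_1_iff S.m_closed br_closed)
  qed (use a n br_br_uminus_of_unit in \<open>auto simp: br_one\<close>)
qed

lemma br_br_swap:
  assumes a: "a \<in> Units A" and b: "b \<in> Units A"
  shows "W m1 \<otimes> (br a \<otimes> br b) = \<ominus> (br b \<otimes> br a)"
proof -
  have "W a \<otimes> (W m1 \<otimes> (br a \<otimes> br b) \<oplus> br b \<otimes> br a) = \<zero>"
    using br_br_uminus_mult[OF a b] br_br_uminus[OF a] br_br_uminus[OF b]
      br_br_uminus[OF A.Units_m_closed[OF a b]] a b by simp
  then have "W m1 \<otimes> (br a \<otimes> br b) \<oplus> br b \<otimes> br a = \<zero>"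
    by (rule W_inv_cancel[rotated 2]) (use a b in auto)
  then show ?thesis using a b by (simp add: minus_equality)
qed

end

context mw_symbols
begin

text \<open>The element \<open>\<langle>a\<rangle> - 1\<close>, which is \<open>\<eta>[a]\<close> in Milnor-Witt K-theory.\<close>

definition D :: "'a \<Rightarrow> 's" where "D a = W a \<ominus> \<one>"

lemma D_closed [simp]: "a \<in> Units A \<Longrightarrow> D a \<in> carrier S"
  by (simp add: D_def)

lemma W_eq: "a \<in> Units A \<Longrightarrow> W a = D a \<oplus> \<one>"
  by (simp add: D_def minus_eq a_assoc l_neg)

lemma D_mult:
  assumes a: "a \<in> Units A" and b: "b \<in> Units A"
  shows "D (a \<otimes>\<^bsub>A\<^esub> b) = D a \<oplus> D b \<oplus> D a \<otimes> D b"
proof -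
  have "D (a \<otimes>\<^bsub>A\<^esub> b) \<oplus> \<one> = (D a \<oplus> \<one>) \<otimes> (D b \<oplus> \<one>)"
    using a b W_mult[OF a b] by (simp add: W_eq)
  also have "\<dots> = (D a \<oplus> D b \<oplus> D a \<otimes> D b) \<oplus> \<one>"
    using a b by (simp add: l_distr r_distr a_ac)
  finally show ?thesis using a b by simp
qed

lemma br_mult':
  assumes "a \<in> Units A" "b \<in> Units A"
  shows "br (a \<otimes>\<^bsub>A\<^esub> b) = br a \<oplus> br b \<oplus> D a \<otimes> br b"
  using assms by (simp add: W_eq br_mult l_distr a_ac)

lemma D_comm: "a \<in> Units A \<Longrightarrow> b \<in> Units A \<Longrightarrow> D a \<otimes> D b = D b \<otimes> D a"
  using W_comm[of a b] 
  by (simp add: D_def minus_eq r_distr l_distr l_minus r_minus minus_add a_ac)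

lemma br_D: "a \<in> Units A \<Longrightarrow> b \<in> Units A \<Longrightarrow> br b \<otimes> D a = D a \<otimes> br b"
  by (simp add: D_def minus_eq r_distr l_distr l_minus r_minus br_W)

text \<open>The element \<open>(\<langle>a\<rangle> - 1)[b] = [ab] - [a] - [b]\<close> is symmetric in \<open>a\<close> and \<open>b\<close>.\<close>

lemma D_br_swap:
  assumes a: "a \<in> Units A" and b: "b \<in> Units A"
  shows "D a \<otimes> br b = D b \<otimes> br a"
proof -
  have "br a \<oplus> br b \<oplus> D a \<otimes> br b = br a \<oplus> br b \<oplus> D b \<otimes> br a"
    using br_mult'[OF a b] br_mult'[OF b a] a b by (simp add: A.m_comm A.Units_closed a_comm)
  then show ?thesis using a b by simp
qed

lemma D_comm': "a \<in> Units A \<Longrightarrow> b \<in> Units A \<Longrightarrow> x \<in> carrier S \<Longrightarrow>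
    D a \<otimes> (D b \<otimes> x) = D b \<otimes> (D a \<otimes> x)"
  using D_comm[of a b] by (simp flip: m_assoc)

lemma br_D': "a \<in> Units A \<Longrightarrow> b \<in> Units A \<Longrightarrow> x \<in> carrier S \<Longrightarrow>
    br b \<otimes> (D a \<otimes> x) = D a \<otimes> (br b \<otimes> x)"
  using br_D[of a b] by (simp flip: m_assoc)

lemma D_br_swap': "a \<in> Units A \<Longrightarrow> b \<in> Units A \<Longrightarrow> x \<in> carrier S \<Longrightarrow>
    D a \<otimes> (br b \<otimes> x) = D b \<otimes> (br a \<otimes> x)"
  using D_br_swap[of a b] by (simp flip: m_assoc)

end

context mw_symbols_rich
begin

text \<open>With \<open>h = 1 + \<langle>-1\<rangle>\<close>, the element \<open>t = (\<langle>a\<rangle> - 1)[b][c]\<close> is annihilated by \<open>h\<close>: it is symmetric in \<open>b\<close> and \<open>c\<close>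
  because it is symmetric under the exchanges of \<open>a\<close> with \<open>b\<close> and of \<open>a\<close> with \<open>c\<close>, whereas exchanging
  \<open>[b]\<close> and \<open>[c]\<close> multiplies it by \<open>-\<langle>-1\<rangle>\<close>.\<close>

lemma hyperbolic_D_br_br:
  assumes a: "a \<in> Units A" and b: "b \<in> Units A" and c: "c \<in> Units A"
  shows "(D m1 \<oplus> (\<one> \<oplus> \<one>)) \<otimes> (D a \<otimes> (br b \<otimes> br c)) = \<zero>"
proof -
  let ?t = "D a \<otimes> (br b \<otimes> br c)"
  have h: "D m1 \<oplus> (\<one> \<oplus> \<one>) = W m1 \<oplus> \<one>"
    by (simp add: D_def minus_eq a_assoc r_neg1 r_neg2)
  have "D a \<otimes> (br c \<otimes> br b) = ?t"
    using assms by (metis D_br_swap D_br_swap' br_D' br_closed)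
  moreover have "W m1 \<otimes> ?t = D a \<otimes> (W m1 \<otimes> (br b \<otimes> br c))"
    using assms W_comm[of m1 a] W_comm'[of m1 a] by (simp add: D_def minus_eq W_left)
  ultimately have "W m1 \<otimes> ?t = \<ominus> ?t"
    using assms by (simp add: br_br_swap r_minus)
  then show ?thesis
    unfolding h using assms by (simp add: l_distr l_neg)
qed

end

subsection \<open>Values of words in the symbols\<close>

text \<open>For a list \<open>a\<^sub>1, \<dots>, a\<^sub>m\<close> with \<open>m \<ge> k\<close> this is the product of \<open>D a\<^sub>1, \<dots>, D a\<^sub>k, [a\<^bsub>k+1\<^esub>], \<dots>, [a\<^sub>m]\<close>, in this
  order. It plays the role of \<open>\<eta>\<^sup>k [a\<^sub>1] \<dots> [a\<^sub>m]\<close>, but needs no \<open>\<eta>\<close>. For \<open>m < k\<close> it has the default value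
  \<open>0\<close>.\<close>

fun symbol_prod :: "('s, 'k) ring_scheme \<Rightarrow> ('a \<Rightarrow> 's) \<Rightarrow> ('a \<Rightarrow> 's) \<Rightarrow> nat \<Rightarrow> 'a list \<Rightarrow> 's" where
  "symbol_prod S D br 0 [] = \<one>\<^bsub>S\<^esub>"
| "symbol_prod S D br 0 (a # as) = br a \<otimes>\<^bsub>S\<^esub> symbol_prod S D br 0 as"
| "symbol_prod S D br (Suc k) [] = \<zero>\<^bsub>S\<^esub>"
| "symbol_prod S D br (Suc k) (a # as) = D a \<otimes>\<^bsub>S\<^esub> symbol_prod S D br k as"

context mw_symbols
begin

abbreviation K where "K \<equiv> symbol_prod S D br"

lemma K_closed [simp]: "set as \<subseteq> Units A \<Longrightarrow> K k as \<in> carrier S"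
proof (induction as arbitrary: k)
  case Nil
  show ?case by (cases k) auto
next
  case (Cons a as)
  then show ?case by (cases k) auto
qed

text \<open>The factors \<open>D\<close> can be taken from any position of the list. With this, \<open>K_steinberg\<close>, \<open>K_mult\<close>
  and \<open>K_hyperbolic\<close> translate relations of Milnor-Witt K-theory, multiplied by words on both
  sides, into identities between these products; the relation \<open>\<eta>[a] = [a]\<eta>\<close> needs no translation.\<close>

lemma K_extract:
  assumes "a \<in> Units A" "set us \<subseteq> Units A" "set vs \<subseteq> Units A"
  shows "K (Suc k) (us @ a # vs) = D a \<otimes> K k (us @ vs)"
  using assms(2)
proof (induction us arbitrary: k)
  case (Cons x us)
  show ?case
  proof (cases k)
    case 0
    \<comment> \<open>The factor \<open>D\<close> passes from \<open>x\<close> to \<open>a\<close> through the list by \<open>D_br_swap\<close>.\<close>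
    have "D x \<otimes> K 0 (us @ a # vs) = D a \<otimes> K 0 (x # us @ vs)"
      using Cons.prems assms
    proof (induction us arbitrary: x)
      case Nil
      then show ?case by (simp add: D_br_swap')
    next
      case (Cons y us)
      have "D x \<otimes> K 0 ((y # us) @ a # vs) = br x \<otimes> (D y \<otimes> K 0 (us @ a # vs))"
        using Cons.prems by (simp add: D_br_swap'[of x] br_D')
      also have "\<dots> = br x \<otimes> (D a \<otimes> K 0 (y # us @ vs))"
        using Cons.IH[of y] Cons.prems by simp
      also have "\<dots> = D a \<otimes> K 0 (x # (y # us) @ vs)"
        using Cons.prems by (simp add: br_D')
      finally show ?case .
    qed
    then show ?thesis by (simp add: 0)
  next
    case (Suc j)
    with Cons show ?thesis using assms by (simp add: D_comm')
  qed
qed simp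

lemma K_zero_append:
  "set us \<subseteq> Units A \<Longrightarrow> set vs \<subseteq> Units A \<Longrightarrow> K 0 (us @ vs) = K 0 us \<otimes> K 0 vs"
  by (induction us) (auto simp: m_assoc)

text \<open>The bound on \<open>k\<close> says that the product has degree at least two. It is what allows all factors \<open>D\<close>
  to be taken from the other entries.\<close>

lemma K_steinberg:
  assumes a: "a \<in> Units A" "\<one>\<^bsub>A\<^esub> \<ominus>\<^bsub>A\<^esub> a \<in> Units A"
    and "set us \<subseteq> Units A" "set vs \<subseteq> Units A" "k \<le> length us + length vs"
  shows "K k (us @ a # (\<one>\<^bsub>A\<^esub> \<ominus>\<^bsub>A\<^esub> a) # vs) = \<zero>"
  using assms(3-)
proof (induction k arbitrary: us vs)
  case 0
  have "br a \<otimes> (br (\<one>\<^bsub>A\<^esub> \<ominus>\<^bsub>A\<^esub> a) \<otimes> K 0 vs) = \<zero>"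
    using 0 a steinberg[OF a] by (simp flip: m_assoc)
  then show ?case using 0 a by (simp add: K_zero_append)
next
  case (Suc k)
  show ?case
  proof (cases us)
    case (Cons x us')
    with Suc a show ?thesis by simp
  next
    case Nil
    with Suc.prems obtain v vs' where vs: "vs = v # vs'" by (cases vs) auto
    with Suc.prems Nil have "K (Suc k) (us @ a # (\<one>\<^bsub>A\<^esub> \<ominus>\<^bsub>A\<^esub> a) # vs) =
        D v \<otimes> K k ([] @ a # (\<one>\<^bsub>A\<^esub> \<ominus>\<^bsub>A\<^esub> a) # vs')"
      using a K_extract[of v "[a, \<one>\<^bsub>A\<^esub> \<ominus>\<^bsub>A\<^esub> a]" vs' k] by simp
    then show ?thesis using Suc.IH[of "[]" vs'] Suc.prems Nil vs by simp
  qed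
qed

lemma K_mult:
  assumes a: "a \<in> Units A" and b: "b \<in> Units A"
    and us: "set us \<subseteq> Units A" and vs: "set vs \<subseteq> Units A"
  shows "K k (us @ (a \<otimes>\<^bsub>A\<^esub> b) # vs) =
    K k (us @ a # vs) \<oplus> K k (us @ b # vs) \<oplus> K (Suc k) (us @ a # b # vs)"
proof (cases k)
  case 0
  have "K (Suc 0) (us @ a # b # vs) = K 0 us \<otimes> (D a \<otimes> (br b \<otimes> K 0 vs))"
  proof -
    have "D a \<otimes> (K 0 us \<otimes> x) = K 0 us \<otimes> (D a \<otimes> x)" if "x \<in> carrier S" for x
      using us that by (induction us) (auto simp: m_assoc a br_D'[symmetric])
    then show ?thesis using K_extract[of a us "b # vs" 0] assms by (simp add: K_zero_append)
  qed
  then show ?thesis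
    unfolding 0 using assms by (simp add: K_zero_append br_mult' r_distr l_distr m_assoc)
next
  case (Suc j)
  have "K (Suc (Suc j)) (us @ a # b # vs) = D a \<otimes> (D b \<otimes> K j (us @ vs))"
    using K_extract[of a us "b # vs" "Suc j"] K_extract[of b us vs j] assms by simp
  then show ?thesis
    unfolding Suc using assms by (simp add: K_extract D_mult l_distr m_assoc)
qed

end

lemma (in mw_symbols_rich) K_hyperbolic:
  assumes "set us \<subseteq> Units A" "set vs \<subseteq> Units A" "k + 3 \<le> length us + length vs"
  shows "K (Suc (Suc k)) (us @ m1 # vs) \<oplus> (K (Suc k) (us @ vs) \<oplus> K (Suc k) (us @ vs)) = \<zero>"
proof -
  let ?h = "D m1 \<oplus> (\<one> \<oplus> \<one>)"
  have "?h \<otimes> K (Suc k) xs = \<zero>" if "set xs \<subseteq> Units A" "k + 3 \<le> length xs" for xs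
    using that
  proof (induction k arbitrary: xs)
    case 0
    then obtain x y z zs where xs: "xs = x # y # z # zs"
      by (auto simp: numeral_eq_Suc Suc_le_length_iff)
    have "?h \<otimes> K (Suc 0) xs = (?h \<otimes> (D x \<otimes> (br y \<otimes> br z))) \<otimes> K 0 zs"
      using 0 by (simp add: xs m_assoc)
    then show ?case using 0 by (simp add: xs hyperbolic_D_br_br)
  next
    case (Suc k)
    then obtain x ys where xs: "xs = x # ys" by (cases xs) auto
    have "?h \<otimes> K (Suc (Suc k)) xs = D x \<otimes> (?h \<otimes> K (Suc k) ys)"
      using Suc.prems by (simp add: xs l_distr r_distr D_comm')
    then show ?case using Suc by (simp add: xs)
  qed
  from this[of "us @ vs"] show ?thesis
    using assms by (simp add: K_extract l_distr)
qed

section \<open>Local rings\<close>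

text \<open>Krull's theorem for a nonunit, by Zorn's lemma.\<close>

lemma (in cring) nonunit_in_maximalideal:
  assumes x: "x \<in> carrier R" and nx: "x \<notin> Units R"
  shows "\<exists>M. maximalideal M R \<and> x \<in> M"
proof -
  let ?P = "{J. ideal J R \<and> x \<in> J \<and> \<one> \<notin> J}"
  have "PIdl x \<in> ?P"
  proof -
    have "\<one> \<notin> PIdl x"
      using nx x unfolding cgenideal_def Units_def by (auto simp: m_comm)
    then show ?thesis using cgenideal_ideal[OF x] cgenideal_self[OF x] by simp
  qed
  moreover have "\<Union>C \<in> ?P" if "C \<noteq> {}" "subset.chain ?P C" for C
  proof -
    have "subset.chain {I. ideal I R} C" using that by (auto simp: pred_on.chain_def)
    from chain_Union_is_ideal[OF this] show ?thesis
      using that by (auto simp: pred_on.chain_def)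
  qed
  ultimately have "\<exists>M\<in>?P. \<forall>J\<in>?P. M \<subseteq> J \<longrightarrow> J = M"
    by (intro subset_Zorn_nonempty) auto
  then obtain M where M: "M \<in> ?P" and M_max: "\<forall>J\<in>?P. M \<subseteq> J \<longrightarrow> J = M"
    by (rule bexE)
  have "maximalideal M R"
  proof (rule maximalidealI)
    show "carrier R \<noteq> M" using M by blast
    fix J assume J: "ideal J R" "M \<subseteq> J"
    then show "J = M \<or> J = carrier R"
      using M M_max ideal.one_imp_carrier[OF J(1)] by blast
  qed (use M in blast)
  then show ?thesis using M by blast
qed

lemma FactRing_zero: "\<zero>\<^bsub>R Quot I\<^esub> = I"
  by (simp add: FactRing_def)

lemma FactRing_carrier: "carrier (R Quot I) = (\<lambda>x. I +>\<^bsub>R\<^esub> x) ` carrier R"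
  by (auto simp: FactRing_simps)

lemma exists_notin_of_card_gt:
  assumes "infinite X \<or> card X > card S" "finite S"
  shows "\<exists>x\<in>X. x \<notin> S"
proof (rule ccontr)
  assume "\<not> ?thesis"
  then have "X \<subseteq> S" by blast
  then show False using assms finite_subset card_mono[OF assms(2)] by (metis not_less)
qed

text \<open>The units \<open>b\<close> and \<open>c\<close> are lifts of \<open>y\<close> and \<open>z\<close> in the residue field with \<open>y\<close>, \<open>z\<close>, \<open>y z\<close> all different from
  \<open>0\<close> and \<open>1\<close>. To find \<open>z\<close> three elements have to be avoided, whence the fourth one.\<close>

lemma rich_units_residue:
  fixes A :: "('a, 'm) ring_scheme" (structure) and k :: "('b, 'n) ring_scheme"
  assumes "cring A" "field k" "ring_hom_ring A k p"
    and surj: "p ` carrier A = carrier k"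
    and unit: "\<And>x. x \<in> carrier A \<Longrightarrow> p x \<noteq> \<zero>\<^bsub>k\<^esub> \<Longrightarrow> x \<in> Units A"
    and card: "infinite (carrier k) \<or> card (carrier k) \<ge> 4"
  shows "rich_units A"
proof -
  interpret cring A by fact
  interpret k: field k by fact
  interpret p: ring_hom_ring A k p by fact
  have card3: "card {u, v, w} \<le> 3" for u v w :: 'b
    by (simp add: card_insert_if)
  have *: "\<exists>y\<in>carrier k. y \<notin> {u, v, w}" for u v w
  proof (rule exists_notin_of_card_gt)
    show "infinite (carrier k) \<or> card {u, v, w} < card (carrier k)"
      using card card3[of u v w] by linarith
  qed simp
  obtain y where y: "y \<in> carrier k" "y \<noteq> \<zero>\<^bsub>k\<^esub>" "y \<noteq> \<one>\<^bsub>k\<^esub>"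
    using *[of "\<zero>\<^bsub>k\<^esub>" "\<zero>\<^bsub>k\<^esub>" "\<one>\<^bsub>k\<^esub>"] by blast
  obtain z where z: "z \<in> carrier k" "z \<noteq> \<zero>\<^bsub>k\<^esub>" "z \<noteq> \<one>\<^bsub>k\<^esub>" "z \<noteq> inv\<^bsub>k\<^esub> y"
    using *[of "\<zero>\<^bsub>k\<^esub>" "\<one>\<^bsub>k\<^esub>" "inv\<^bsub>k\<^esub> y"] by blast
  obtain b c where b: "b \<in> carrier A" "p b = y" and c: "c \<in> carrier A" "p c = z"
    using surj y(1) z(1) by (metis imageE)
  have yz: "y \<otimes>\<^bsub>k\<^esub> z \<noteq> \<one>\<^bsub>k\<^esub>"
    using y z k.comm_inv_char[of y z] by auto
  have bc: "b \<in> Units A" "c \<in> Units A"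
    using b c y z by (auto intro!: unit)
  have d: "d \<in> carrier A \<and> p d \<noteq> \<one>\<^bsub>k\<^esub>" if "d \<in> {b, c, b \<otimes> c}" for d
    using that b c y z yz by auto
  have sub: "\<one> \<ominus> x \<in> Units A" if "x \<in> carrier A" "p x \<noteq> \<one>\<^bsub>k\<^esub>" for x
  proof (rule unit)
    have "p (\<one> \<ominus> x) = \<one>\<^bsub>k\<^esub> \<ominus>\<^bsub>k\<^esub> p x"
      using that by (simp add: minus_eq k.minus_eq)
    then show "p (\<one> \<ominus> x) \<noteq> \<zero>\<^bsub>k\<^esub>"
      using that k.r_right_minus_eq[of "\<one>\<^bsub>k\<^esub>" "p x"] by auto
  qed (use that in simp)
  have "\<one> \<ominus> a \<in> Units A \<or> (\<forall>d\<in>{b, c, b \<otimes> c}. \<one> \<ominus> d \<in> Units A \<and> \<one> \<ominus> a \<otimes> d \<in> Units A)"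
    if a: "a \<in> Units A" for a
  proof (cases "p a = \<one>\<^bsub>k\<^esub>")
    case True
    have "\<one> \<ominus> d \<in> Units A \<and> \<one> \<ominus> a \<otimes> d \<in> Units A" if "d \<in> {b, c, b \<otimes> c}" for d
      using sub[of d] sub[of "a \<otimes> d"] d[OF that] Units_closed[OF a] True by simp
    then show ?thesis by blast
  next
    case False
    then show ?thesis using sub[of a] a by auto
  qed
  then show ?thesis unfolding rich_units_def using bc by blast
qed

text \<open>In a field \<open>1 - a\<close> is a unit unless \<open>a = 1\<close>, so no assumption on the cardinality is needed.\<close>

lemma local_ring_rich_units:
  fixes A :: "('a, 'm) ring_scheme" (structure)
  assumes loc: "local_ring A"
    and card: "\<not> field A \<Longrightarrow>
      infinite (carrier (residue_field A)) \<or> card (carrier (residue_field A)) \<ge> 4"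
  shows "rich_units A"
proof (cases "field A")
  case True
  then interpret field A .
  have "\<one> \<ominus> a \<in> Units A" if "a \<in> Units A" "a \<noteq> \<one>" for a
  proof -
    have "\<one> \<ominus> a \<noteq> \<zero>" using that r_right_minus_eq[of \<one> a] by auto
    then show ?thesis using that by (simp add: field_Units)
  qed
  then show ?thesis unfolding rich_units_def by blast
next
  case False
  interpret cring A using loc by (simp add: local_ring_def)
  define M where "M = (THE M. maximalideal M A)"
  have max: "maximalideal M A" and uniq: "maximalideal N A \<Longrightarrow> N = M" for N
    using loc theI'[of "\<lambda>M. maximalideal M A"] unfolding local_ring_def M_def by auto
  interpret M: maximalideal M A by (rule max)
  let ?k = "A Quot M" and ?p = "(+>) M"
  interpret k: field ?k using M.quotient_is_field[OF cring_axioms] .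
  interpret p: ring_hom_ring A ?k ?p by (rule M.rcos_ring_hom_ring)
  have card: "infinite (carrier ?k) \<or> card (carrier ?k) \<ge> 4"
    using card[OF False] by (simp add: residue_field_def M_def)
  have p_zero: "?p x = \<zero>\<^bsub>?k\<^esub> \<longleftrightarrow> x \<in> M" if "x \<in> carrier A" for x
  proof
    assume "?p x = \<zero>\<^bsub>?k\<^esub>"
    then show "x \<in> M" using M.a_rcos_self[OF that] unfolding FactRing_zero by (rule subst)
  next
    assume "x \<in> M"
    then show "?p x = \<zero>\<^bsub>?k\<^esub>" unfolding FactRing_zero by (rule M.a_rcos_const)
  qed
  have unit: "x \<in> Units A" if x: "x \<in> carrier A" "?p x \<noteq> \<zero>\<^bsub>?k\<^esub>" for x
  proof (rule ccontr)
    assume "x \<notin> Units A"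
    from nonunit_in_maximalideal[OF x(1) this]
    obtain N where N: "maximalideal N A" "x \<in> N" by blast
    from N(2) have "x \<in> M" unfolding uniq[OF N(1)] .
    then show False using x(2) p_zero[OF x(1)] by blast
  qed
  show ?thesis
  proof (rule rich_units_residue)
    show "?p ` carrier A = carrier ?k" unfolding FactRing_carrier ..
  qed (fact cring_axioms k.field_axioms p.ring_hom_ring_axioms unit card)+
qed

lemma a_kernel_iff: "x \<in> a_kernel R S h \<longleftrightarrow> x \<in> carrier R \<and> h x = \<zero>\<^bsub>S\<^esub>"
  unfolding a_kernel_def' by blast

section \<open>Quotients by generated ideals\<close>

context ring
begin

lemma Idl_coset_zero:
  assumes "B \<subseteq> carrier R" "b \<in> B"
  shows "Idl B +> b = \<zero>\<^bsub>R Quot Idl B\<^esub>"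
proof -
  interpret I: ideal "Idl B" R using genideal_ideal[OF assms(1)] .
  show ?thesis
    unfolding FactRing_zero using genideal_self[OF assms(1)] assms(2) by (intro I.a_rcos_const) blast
qed

lemma Idl_coset_eq:
  assumes "B \<subseteq> carrier R" "x \<ominus> y \<in> B" "x \<in> carrier R" "y \<in> carrier R"
  shows "Idl B +> x = Idl B +> y"
proof -
  interpret I: ideal "Idl B" R using genideal_ideal[OF assms(1)] .
  interpret q: ring_hom_ring R "R Quot Idl B" "(+>) (Idl B)" by (rule I.rcos_ring_hom_ring)
  have x: "x = (x \<ominus> y) \<oplus> y" using assms(3,4) by (simp add: minus_eq a_assoc l_neg)
  have "Idl B +> x = (Idl B +> (x \<ominus> y)) \<oplus>\<^bsub>R Quot Idl B\<^esub> (Idl B +> y)"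
    by (subst x) (use assms(3,4) in simp)
  then show ?thesis
    using Idl_coset_zero[OF assms(1,2)] assms(4) by simp
qed

lemma Idl_quotient_lift:
  fixes S :: "('s, 'k) ring_scheme"
  assumes B: "B \<subseteq> carrier R" and h: "ring_hom_ring R S h"
    and zero: "\<And>b. b \<in> B \<Longrightarrow> h b = \<zero>\<^bsub>S\<^esub>"
  obtains k where "k \<in> ring_hom (R Quot Idl B) S" "\<And>x. x \<in> carrier R \<Longrightarrow> k (Idl B +> x) = h x"
proof -
  interpret I: ideal "Idl B" R using genideal_ideal[OF B] .
  interpret h: ring_hom_ring R S h by fact
  interpret q: ring_hom_ring R "R Quot Idl B" "(+>) (Idl B)" by (rule I.rcos_ring_hom_ring)
  have "B \<subseteq> a_kernel R S h"
    unfolding a_kernel_def' using B zero by fast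
  then have sub: "Idl B \<subseteq> a_kernel R S h"
    by (rule genideal_minimal[OF h.kernel_is_ideal])
  have ker: "h i = \<zero>\<^bsub>S\<^esub>" if "i \<in> Idl B" for i
    using subsetD[OF sub that] unfolding a_kernel_iff by (rule conjunct2)
  define k where "k X = h (SOME y. y \<in> carrier R \<and> Idl B +> y = X)" for X
  have k: "k (Idl B +> x) = h x" if x: "x \<in> carrier R" for x
  proof -
    let ?y = "SOME y. y \<in> carrier R \<and> Idl B +> y = Idl B +> x"
    have y: "?y \<in> carrier R" "Idl B +> ?y = Idl B +> x"
      using someI_ex[of "\<lambda>y. y \<in> carrier R \<and> Idl B +> y = Idl B +> x"] x by blast+
    then have "?y \<in> Idl B +> x" using I.a_rcos_self by metis
    then obtain i where i: "i \<in> Idl B" "?y = i \<oplus> x" unfolding a_r_coset_def' by blast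
    have "h ?y = h i \<oplus>\<^bsub>S\<^esub> h x" using i x I.a_subset by (metis h.hom_add subsetD)
    then show ?thesis unfolding k_def using ker[OF i(1)] x by simp
  qed
  have surj: "\<exists>x\<in>carrier R. X = Idl B +> x" if "X \<in> carrier (R Quot Idl B)" for X
    using that unfolding FactRing_carrier by blast
  have "k \<in> ring_hom (R Quot Idl B) S"
  proof (rule ring_hom_memI)
    fix X Y assume "X \<in> carrier (R Quot Idl B)" "Y \<in> carrier (R Quot Idl B)"
    then obtain x y where x: "x \<in> carrier R" "X = Idl B +> x" and y: "y \<in> carrier R" "Y = Idl B +> y"
      using surj by meson
    show "k X \<in> carrier S" using x k by simp
    show "k (X \<otimes>\<^bsub>R Quot Idl B\<^esub> Y) = k X \<otimes>\<^bsub>S\<^esub> k Y"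
      using k[of "x \<otimes> y"] k x y by simp
    show "k (X \<oplus>\<^bsub>R Quot Idl B\<^esub> Y) = k X \<oplus>\<^bsub>S\<^esub> k Y"
      using k[of "x \<oplus> y"] k x y by simp
  next
    show "k \<one>\<^bsub>R Quot Idl B\<^esub> = \<one>\<^bsub>S\<^esub>" using k[of \<one>] by simp
  qed
  with k show thesis using that by blast
qed

end

section \<open>Integral monoid rings\<close>

lemma int_ring: "ring \<Z>"
  using int_is_cring by (rule cring.axioms)

locale integral_monoid_ring = monoid_algebra \<Z> G for G :: "('g, 'n) monoid_scheme"
begin

text \<open>The \<open>\<int>\<close>-linear extension of a map defined on the monoid.\<close>

definition integral_ext :: "('s, 'k) ring_scheme \<Rightarrow> ('g \<Rightarrow> 's) \<Rightarrow> ('g \<Rightarrow> int) \<Rightarrow> 's" where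
  "integral_ext S v = additive_ext S (\<lambda>x n. [n] \<cdot>\<^bsub>S\<^esub> v x)"

context
  fixes S :: "('s, 'k) ring_scheme" and v :: "'g \<Rightarrow> 's"
  assumes S: "ring S" and v: "\<And>x. x \<in> carrier G \<Longrightarrow> v x \<in> carrier S"
begin

interpretation S: ring S by (rule S)

lemma integral_ext_closed: "f \<in> carrier MR \<Longrightarrow> integral_ext S v f \<in> carrier S"
  unfolding integral_ext_def by (rule additive_ext_closed[OF S]) (auto simp: v S.add.int_pow_mult)

lemma integral_ext_add: "f \<in> carrier MR \<Longrightarrow> g \<in> carrier MR \<Longrightarrow>
    integral_ext S v (f \<oplus>\<^bsub>MR\<^esub> g) = integral_ext S v f \<oplus>\<^bsub>S\<^esub> integral_ext S v g"
  unfolding integral_ext_def by (rule additive_ext_add[OF S]) (auto simp: v S.add.int_pow_mult)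

lemma integral_ext_single: "x \<in> carrier G \<Longrightarrow> integral_ext S v (single \<Z> x n) = [n] \<cdot>\<^bsub>S\<^esub> v x"
  unfolding integral_ext_def by (rule additive_ext_single[OF S]) (auto simp: v S.add.int_pow_mult)

lemma integral_ext_single_one: "x \<in> carrier G \<Longrightarrow> integral_ext S v (single \<Z> x 1) = v x"
  by (simp add: integral_ext_single v)

lemma integral_ext_hom: "abelian_group_hom MR S (integral_ext S v)"
proof (rule abelian_group_homI[OF MR.abelian_group_axioms S.abelian_group_axioms])
  show "group_hom (add_monoid MR) (add_monoid S) (integral_ext S v)"
    by (intro group_hom.intro group_hom_axioms.intro MR.a_group S.a_group)
      (simp add: hom_def integral_ext_closed integral_ext_add)
qed

lemma integral_ext_ring_hom:
  assumes "\<And>x y. x \<in> carrier G \<Longrightarrow> y \<in> carrier G \<Longrightarrow> v (x \<otimes>\<^bsub>G\<^esub> y) = v x \<otimes>\<^bsub>S\<^esub> v y"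
    and "v \<one>\<^bsub>G\<^esub> = \<one>\<^bsub>S\<^esub>"
  shows "integral_ext S v \<in> ring_hom MR S"
  unfolding integral_ext_def
proof (rule additive_ext_ring_hom[OF S])
  fix x y r s assume "x \<in> carrier G" "y \<in> carrier G"
  then show "[(r \<otimes>\<^bsub>\<Z>\<^esub> s)] \<cdot>\<^bsub>S\<^esub> (v (x \<otimes>\<^bsub>G\<^esub> y)) = ([r] \<cdot>\<^bsub>S\<^esub> (v x)) \<otimes>\<^bsub>S\<^esub> ([s] \<cdot>\<^bsub>S\<^esub> (v y))"
    by (simp add: assms v S.add_pow_ldistr_int S.add_pow_rdistr_int S.add.int_pow_pow mult.commute)
qed (auto simp: v assms S.add.int_pow_mult)

end

text \<open>Elements supported in \<open>X\<close> are additively generated by the elements of \<open>X\<close>.\<close>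

lemma integral_supported_induct [consumes 1, case_names zero single add minus]:
  assumes f: "f \<in> supported X"
    and zero: "P \<zero>\<^bsub>MR\<^esub>" and single: "\<And>x. x \<in> carrier G \<Longrightarrow> x \<in> X \<Longrightarrow> P (single \<Z> x 1)"
    and add: "\<And>f g. f \<in> supported X \<Longrightarrow> g \<in> supported X \<Longrightarrow> P f \<Longrightarrow> P g \<Longrightarrow> P (f \<oplus>\<^bsub>MR\<^esub> g)"
    and minus: "\<And>f. f \<in> supported X \<Longrightarrow> P f \<Longrightarrow> P (\<ominus>\<^bsub>MR\<^esub> f)"
  shows "P f"
proof -
  have s: "P (single \<Z> x n)" if x: "x \<in> carrier G" "x \<in> X" for x n
  proof (induction n rule: int_induct[where k = 0])
    case base
    then show ?case using zero single_zero[of x] by simp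
  next
    case (step1 i)
    have "single \<Z> x (i + 1) = single \<Z> x i \<oplus>\<^bsub>MR\<^esub> single \<Z> x 1"
      using single_add[of i 1 x] by simp
    then show ?case using step1 single[OF x] x by (auto intro: add supported_single)
  next
    case (step2 i)
    have "single \<Z> x (i - 1) = single \<Z> x i \<oplus>\<^bsub>MR\<^esub> \<ominus>\<^bsub>MR\<^esub> single \<Z> x 1"
      using single_add[of i "-1" x] single_minus[OF x(1), of 1] by (simp add: int_a_inv_eq)
    then show ?case using step2 single[OF x] x
      by (auto intro!: add minus supported_single supported_minus)
  qed
  show ?thesis using f by (induction rule: supported_induct) (auto intro: zero add s supported_single)
qed

lemma integral_induct [consumes 1, case_names zero single add minus]:
  assumes f: "f \<in> carrier MR"
    and zero: "P \<zero>\<^bsub>MR\<^esub>" and single: "\<And>x. x \<in> carrier G \<Longrightarrow> P (single \<Z> x 1)"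
    and add: "\<And>f g. f \<in> carrier MR \<Longrightarrow> g \<in> carrier MR \<Longrightarrow> P f \<Longrightarrow> P g \<Longrightarrow> P (f \<oplus>\<^bsub>MR\<^esub> g)"
    and minus: "\<And>f. f \<in> carrier MR \<Longrightarrow> P f \<Longrightarrow> P (\<ominus>\<^bsub>MR\<^esub> f)"
  shows "P f"
proof -
  have "f \<in> supported UNIV" using f by (simp add: supported_def)
  then show ?thesis
    by (induction rule: integral_supported_induct) (auto intro: zero single add minus supported_carrier)
qed

text \<open>An additive map vanishes on a two-sided ideal as soon as it vanishes on the generators multiplied
  by monoid elements on both sides. The map need not be multiplicative.\<close>

lemma vanish_on_ideal:
  assumes S: "abelian_group_hom MR S t" and B: "B \<subseteq> carrier MR"
    and van: "\<And>b u v. b \<in> B \<Longrightarrow> u \<in> carrier G \<Longrightarrow> v \<in> carrier G \<Longrightarrow>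
      t (single \<Z> u 1 \<otimes>\<^bsub>MR\<^esub> b \<otimes>\<^bsub>MR\<^esub> single \<Z> v 1) = \<zero>\<^bsub>S\<^esub>"
    and f: "f \<in> Idl\<^bsub>MR\<^esub> B"
  shows "t f = \<zero>\<^bsub>S\<^esub>"
proof -
  interpret t: abelian_group_hom MR S t by (rule S)
  let ?w = "\<lambda>u. single \<Z> u 1"
  note [simp] = MR.m_assoc single_mult MR.l_distr MR.r_distr MR.l_minus MR.r_minus
  \<comment> \<open>The elements with the required vanishing property form an ideal.\<close>
  define N where "N = {f \<in> carrier MR. \<forall>u\<in>carrier G. \<forall>v\<in>carrier G.
    t (?w u \<otimes>\<^bsub>MR\<^esub> (f \<otimes>\<^bsub>MR\<^esub> ?w v)) = \<zero>\<^bsub>S\<^esub>}"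
  have "ideal N MR"
  proof (rule idealI[OF MR_ring])
    show "subgroup N (add_monoid MR)"
    proof (rule MR.add.subgroupI)
      show "N \<noteq> {}" using MR.zero_closed by (auto simp: N_def intro!: exI[of _ "\<zero>\<^bsub>MR\<^esub>"])
    qed (auto simp: N_def a_inv_def[symmetric])
  next
    fix f g assume f: "f \<in> N" and g: "g \<in> carrier MR"
    have fc: "f \<in> carrier MR" using f by (simp add: N_def)
    have "t (?w u \<otimes>\<^bsub>MR\<^esub> (g \<otimes>\<^bsub>MR\<^esub> (f \<otimes>\<^bsub>MR\<^esub> ?w v))) = \<zero>\<^bsub>S\<^esub>"
      if u: "u \<in> carrier G" and v: "v \<in> carrier G" for u v
      using g
    proof (induction rule: integral_induct)
      case (single x)
      have "?w u \<otimes>\<^bsub>MR\<^esub> (?w x \<otimes>\<^bsub>MR\<^esub> (f \<otimes>\<^bsub>MR\<^esub> ?w v)) = ?w (u \<otimes>\<^bsub>G\<^esub> x) \<otimes>\<^bsub>MR\<^esub> (f \<otimes>\<^bsub>MR\<^esub> ?w v)"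
        using u v fc single MR.m_assoc[of "?w u" "?w x" "f \<otimes>\<^bsub>MR\<^esub> ?w v", symmetric] by (simp del: MR.m_assoc)
      then show ?case using f u v single by (simp add: N_def)
    qed (use u v fc in auto)
    then show "g \<otimes>\<^bsub>MR\<^esub> f \<in> N" using fc g by (simp add: N_def)
    have "t (?w u \<otimes>\<^bsub>MR\<^esub> (f \<otimes>\<^bsub>MR\<^esub> (g \<otimes>\<^bsub>MR\<^esub> ?w v))) = \<zero>\<^bsub>S\<^esub>"
      if u: "u \<in> carrier G" and v: "v \<in> carrier G" for u v
      using g
    proof (induction rule: integral_induct)
      case (single x)
      then show ?case using f u v by (simp add: N_def)
    qed (use u v fc in auto)
    then show "f \<otimes>\<^bsub>MR\<^esub> g \<in> N" using fc g by (simp add: N_def)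
  qed
  moreover have "B \<subseteq> N"
  proof
    fix b assume "b \<in> B"
    then show "b \<in> N" using B van[of b] by (auto simp: N_def)
  qed
  ultimately have "Idl\<^bsub>MR\<^esub> B \<subseteq> N" by (rule MR.genideal_minimal)
  then have "t (?w \<one>\<^bsub>G\<^esub> \<otimes>\<^bsub>MR\<^esub> (f \<otimes>\<^bsub>MR\<^esub> ?w \<one>\<^bsub>G\<^esub>)) = \<zero>\<^bsub>S\<^esub>" and "f \<in> carrier MR"
    using f by (auto simp: N_def)
  moreover have "?w \<one>\<^bsub>G\<^esub> = \<one>\<^bsub>MR\<^esub>" using MR_one by simp
  ultimately show ?thesis by simp
qed

end

section \<open>The augmentation ideal\<close>

text \<open>The context for the group ring of the units of a commutative ring, its augmentation ideal, and the
  two rings of the theorem.\<close>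

locale units_ring = cring A for A :: "('a, 'm) ring_scheme" (structure)
begin

interpretation U: comm_group "units_of A" by (rule units_comm_group)

sublocale ZA: integral_monoid_ring "units_of A"
  by (intro integral_monoid_ring.intro monoid_algebra.intro int_ring U.monoid_axioms)

abbreviation Z where "Z \<equiv> unit_group_ring A"

lemma ZA_eq: "ZA.MR = Z" by (simp add: unit_group_ring_def)

lemma Z_ring: "ring Z" using ZA.MR_ring by (simp add: ZA_eq)

sublocale Z: ring Z by (rule Z_ring)

lemma angle_closed [simp]: "a \<in> Units A \<Longrightarrow> angle a \<in> carrier Z"
  using ZA.single_closed[of a 1] by (simp add: angle_def ZA_eq units_of_carrier)

lemma angle_mult: "a \<in> Units A \<Longrightarrow> b \<in> Units A \<Longrightarrow> angle a \<otimes>\<^bsub>Z\<^esub> angle b = angle (a \<otimes> b)"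
  using ZA.single_mult[of a b 1 1] by (simp add: angle_def ZA_eq units_of_carrier units_of_mult)

lemma angle_one: "angle \<one> = \<one>\<^bsub>Z\<^esub>"
  using ZA.MR_one by (simp add: angle_def ZA_eq units_of_one)

lemma augmentation_ring_hom: "ring_hom_ring Z \<Z> augmentation"
proof -
  have eq: "augmentation = ZA.additive_ext \<Z> (\<lambda>x n. n)"
    by (rule ext) (simp add: augmentation_def ZA.additive_ext_def int_finsum_eq)
  have "augmentation \<in> ring_hom ZA.MR \<Z>"
    unfolding eq by (rule ZA.additive_ext_ring_hom) (auto intro: int_ring)
  then show ?thesis by (intro ring_hom_ringI2 Z_ring int_ring) (simp add: ZA_eq)
qed

interpretation aug: ring_hom_ring Z \<Z> augmentation by (rule augmentation_ring_hom)

lemma augmentation_angle: "augmentation (angle a) = 1"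
  by (simp add: augmentation_def angle_def supp_def single_def)

lemma aug_ideal_iff: "f \<in> aug_ideal A \<longleftrightarrow> f \<in> carrier Z \<and> augmentation f = 0"
  unfolding aug_ideal_def a_kernel_iff by simp

lemma aug_ideal_ideal: "ideal (aug_ideal A) Z"
  unfolding aug_ideal_def by (rule aug.kernel_is_ideal)

sublocale I: ideal "aug_ideal A" Z by (rule aug_ideal_ideal)

lemma bracket_in [simp]: "a \<in> Units A \<Longrightarrow> bracket A a \<in> aug_ideal A"
  unfolding aug_ideal_iff bracket_def Z.minus_eq
  using augmentation_angle[of a] augmentation_angle[of \<one>] by (simp add: int_a_inv_eq)

text \<open>The augmentation ideal is additively generated by the elements \<open>[a]\<close>.\<close>

lemma aug_induct [consumes 1, case_names zero bracket add minus]: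
  assumes m: "m \<in> aug_ideal A"
    and zero: "P \<zero>\<^bsub>Z\<^esub>" and br: "\<And>a. a \<in> Units A \<Longrightarrow> P (bracket A a)"
    and add: "\<And>f g. f \<in> aug_ideal A \<Longrightarrow> g \<in> aug_ideal A \<Longrightarrow> P f \<Longrightarrow> P g \<Longrightarrow> P (f \<oplus>\<^bsub>Z\<^esub> g)"
    and minus: "\<And>f. f \<in> aug_ideal A \<Longrightarrow> P f \<Longrightarrow> P (\<ominus>\<^bsub>Z\<^esub> f)"
  shows "P m"
proof -
  \<comment> \<open>The projection of \<open>f\<close> onto the augmentation ideal is \<open>f - c (augmentation f)\<close>.\<close>
  define c where "c n = single \<Z> \<one> n" for n :: int
  have c: "c n \<in> carrier Z" "augmentation (c n) = n" for n
    using ZA.single_closed[of \<one> n]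
    by (cases "n = 0"; simp add: c_def ZA_eq units_of_carrier augmentation_def supp_def single_def)+
  have c_add: "c (n + k) = c n \<oplus>\<^bsub>Z\<^esub> c k" for n k
    using ZA.single_add[of n k \<one>] by (simp add: c_def ZA_eq)
  have c_minus: "c (- n) = \<ominus>\<^bsub>Z\<^esub> c n" for n
    using ZA.single_minus[of \<one> n] by (simp add: c_def ZA_eq units_of_carrier int_a_inv_eq)
  have c0: "c 0 = \<zero>\<^bsub>Z\<^esub>"
    using ZA.single_zero[of \<one>] by (simp add: c_def ZA_eq)
  have c1: "c 1 = \<one>\<^bsub>Z\<^esub>"
    using ZA.MR_one by (simp add: c_def ZA_eq units_of_one)
  define Q where "Q f \<longleftrightarrow> P (f \<ominus>\<^bsub>Z\<^esub> c (augmentation f))" for f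
  have in_I: "f \<ominus>\<^bsub>Z\<^esub> c (augmentation f) \<in> aug_ideal A" if "f \<in> carrier Z" for f
    using that c unfolding aug_ideal_iff Z.minus_eq by (simp add: int_a_inv_eq)
  have "Q f" if "f \<in> carrier ZA.MR" for f
    using that
  proof (induction rule: ZA.integral_induct)
    case zero
    then show ?case using assms(2) aug.hom_zero by (simp add: Q_def ZA_eq c0 Z.minus_eq)
  next
    case (single x)
    then show ?case using br[of x] augmentation_angle[of x]
      by (simp add: Q_def bracket_def angle_def c1 units_of_carrier)
  next
    case (add f g)
    then have fg: "f \<in> carrier Z" "g \<in> carrier Z" by (simp_all add: ZA_eq)
    let ?f = "f \<ominus>\<^bsub>Z\<^esub> c (augmentation f)" and ?g = "g \<ominus>\<^bsub>Z\<^esub> c (augmentation g)"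
    have "f \<oplus>\<^bsub>Z\<^esub> g \<ominus>\<^bsub>Z\<^esub> c (augmentation (f \<oplus>\<^bsub>Z\<^esub> g)) = ?f \<oplus>\<^bsub>Z\<^esub> ?g"
      using fg c by (simp add: c_add Z.minus_eq Z.minus_add Z.a_ac)
    then show ?case using add in_I[OF fg(1)] in_I[OF fg(2)] assms(4)[of ?f ?g]
      by (simp add: Q_def ZA_eq)
  next
    case (minus f)
    then have f: "f \<in> carrier Z" by (simp add: ZA_eq)
    let ?f = "f \<ominus>\<^bsub>Z\<^esub> c (augmentation f)"
    have "\<ominus>\<^bsub>Z\<^esub> f \<ominus>\<^bsub>Z\<^esub> c (augmentation (\<ominus>\<^bsub>Z\<^esub> f)) = \<ominus>\<^bsub>Z\<^esub> ?f"
      using f c by (simp add: int_a_inv_eq c_minus Z.minus_eq Z.minus_add)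
    then show ?case using minus in_I[OF f] assms(5)[of ?f] by (simp add: Q_def ZA_eq)
  qed
  then have "Q m" using m by (simp add: aug_ideal_iff ZA_eq)
  moreover have "m \<ominus>\<^bsub>Z\<^esub> c (augmentation m) = m"
    using m by (simp add: aug_ideal_iff c0 Z.minus_eq)
  ultimately show ?thesis by (simp add: Q_def)
qed

lemma bracket_mult:
  assumes "a \<in> Units A" "b \<in> Units A"
  shows "bracket A (a \<otimes> b) = bracket A a \<oplus>\<^bsub>Z\<^esub> angle a \<otimes>\<^bsub>Z\<^esub> bracket A b"
  using assms by (simp add: bracket_def Z.minus_eq Z.r_distr Z.r_minus angle_mult[symmetric]
    Z.a_ac Z.r_neg1 Z.r_neg2)
   
end

section \<open>Milnor-Witt K-theory\<close>

context units_ring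
begin

abbreviation Words where "Words \<equiv> free_monoid (mw_gens A)"

sublocale F: integral_monoid_ring Words
  by (intro integral_monoid_ring.intro monoid_algebra.intro int_ring free_monoid_monoid)

lemma F_eq: "F.MR = free_algebra \<Z> (mw_gens A)" by (simp add: free_algebra_def)

abbreviation FK where "FK \<equiv> free_algebra \<Z> (mw_gens A)"

lemma FK_ring: "ring FK" using F.MR_ring by (simp add: F_eq)

sublocale FK: ring FK by (rule FK_ring)

abbreviation word :: "'a mw_gen list \<Rightarrow> 'a mw_gen list \<Rightarrow> int" where "word w \<equiv> single \<Z> w 1"

lemma Words_carrier: "carrier Words = lists (mw_gens A)" and Words_mult: "u \<otimes>\<^bsub>Words\<^esub> v = u @ v"
  and Words_one: "\<one>\<^bsub>Words\<^esub> = []"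
  by (simp_all add: free_monoid_def)

lemma gens [simp]: "Eta \<in> mw_gens A" "Sym a \<in> mw_gens A \<longleftrightarrow> a \<in> Units A"
  by (auto simp: mw_gens_def)

lemma word_closed [simp]: "w \<in> lists (mw_gens A) \<Longrightarrow> word w \<in> carrier FK"
  using F.single_closed[of w 1] by (simp add: F_eq Words_carrier)

lemma word_mult [simp]: "u \<in> lists (mw_gens A) \<Longrightarrow> v \<in> lists (mw_gens A) \<Longrightarrow>
    word u \<otimes>\<^bsub>FK\<^esub> word v = word (u @ v)"
  using F.single_mult[of u v 1 1] by (simp add: F_eq Words_carrier Words_mult)

lemma word_Nil: "word [] = \<one>\<^bsub>FK\<^esub>"
  using F.MR_one by (simp add: F_eq Words_one)

text \<open>The defining relations of Milnor-Witt K-theory, with products of generators written as words.\<close>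

definition KMW_rels :: "('a mw_gen list \<Rightarrow> int) set" where
  "KMW_rels =
    {word [Sym a, Sym (\<one> \<ominus> a)] | a. a \<in> Units A \<and> \<one> \<ominus> a \<in> Units A} \<union>
    {word [Sym (a \<otimes> b)] \<ominus>\<^bsub>FK\<^esub> (word [Sym a] \<oplus>\<^bsub>FK\<^esub> word [Sym b] \<oplus>\<^bsub>FK\<^esub> word [Eta, Sym a, Sym b]) | a b.
      a \<in> Units A \<and> b \<in> Units A} \<union>
    {word [Eta, Sym a] \<ominus>\<^bsub>FK\<^esub> word [Sym a, Eta] | a. a \<in> Units A} \<union>
    {word [Eta, Eta, Sym (\<ominus> \<one>)] \<oplus>\<^bsub>FK\<^esub> (word [Eta] \<oplus>\<^bsub>FK\<^esub> word [Eta])}"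

lemma minus_one_unit [simp]: "\<ominus> \<one> \<in> Units A"
proof -
  have "(\<ominus> \<one>) \<otimes> (\<ominus> \<one>) = \<one>" by (simp add: l_minus)
  then show ?thesis unfolding Units_def by auto
qed

lemma KMW_ideal_eq: "KMW_ideal A = Idl\<^bsub>FK\<^esub> KMW_rels"
proof -
  have "{word [Sym a] \<otimes>\<^bsub>FK\<^esub> word [Sym (\<one> \<ominus> a)] | a. a \<in> Units A \<and> \<one> \<ominus> a \<in> Units A} =
      {word [Sym a, Sym (\<one> \<ominus> a)] | a. a \<in> Units A \<and> \<one> \<ominus> a \<in> Units A}"
    by (rule Collect_cong, rule ex_cong1) auto
  moreover have "{word [Sym (a \<otimes> b)] \<ominus>\<^bsub>FK\<^esub> (word [Sym a] \<oplus>\<^bsub>FK\<^esub> word [Sym b] \<oplus>\<^bsub>FK\<^esub>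
        word [Eta] \<otimes>\<^bsub>FK\<^esub> word [Sym a] \<otimes>\<^bsub>FK\<^esub> word [Sym b]) | a b. a \<in> Units A \<and> b \<in> Units A} =
      {word [Sym (a \<otimes> b)] \<ominus>\<^bsub>FK\<^esub> (word [Sym a] \<oplus>\<^bsub>FK\<^esub> word [Sym b] \<oplus>\<^bsub>FK\<^esub> word [Eta, Sym a, Sym b]) | a b.
        a \<in> Units A \<and> b \<in> Units A}"
    by (rule Collect_cong, intro ex_cong1) auto
  moreover have "{word [Eta] \<otimes>\<^bsub>FK\<^esub> word [Sym a] \<ominus>\<^bsub>FK\<^esub> word [Sym a] \<otimes>\<^bsub>FK\<^esub> word [Eta] | a. a \<in> Units A} =
      {word [Eta, Sym a] \<ominus>\<^bsub>FK\<^esub> word [Sym a, Eta] | a. a \<in> Units A}"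
    by (rule Collect_cong, rule ex_cong1) auto
  moreover have "word [Eta] \<otimes>\<^bsub>FK\<^esub> word [Eta] \<otimes>\<^bsub>FK\<^esub> word [Sym (\<ominus> \<one>)] = word [Eta, Eta, Sym (\<ominus> \<one>)]"
    by simp
  ultimately show ?thesis unfolding KMW_ideal_def KMW_rels_def Let_def by simp
qed

lemma KMW_rels_closed: "KMW_rels \<subseteq> carrier FK"
  unfolding KMW_rels_def by auto

lemma KMW_eq: "KMW A = FK Quot Idl\<^bsub>FK\<^esub> KMW_rels"
  by (simp add: KMW_def KMW_ideal_eq)

lemma KMW_class_eq: "KMW_class A f = Idl\<^bsub>FK\<^esub> KMW_rels +>\<^bsub>FK\<^esub> f"
  by (simp add: KMW_class_def KMW_ideal_eq)

lemma KMW_ring: "ring (KMW A)"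
  unfolding KMW_eq by (rule ideal.quotient_is_ring[OF FK.genideal_ideal[OF KMW_rels_closed]])

sublocale KM: ring "KMW A" by (rule KMW_ring)

lemma KMW_class_hom: "ring_hom_ring FK (KMW A) (KMW_class A)"
  unfolding KMW_eq KMW_class_eq[abs_def]
  by (rule ideal.rcos_ring_hom_ring[OF FK.genideal_ideal[OF KMW_rels_closed]])

sublocale cl: ring_hom_ring FK "KMW A" "KMW_class A" by (rule KMW_class_hom)

lemma KMW_class_eqD:
  assumes "f \<in> carrier FK" "g \<in> carrier FK" "KMW_class A f = KMW_class A g"
  shows "f \<ominus>\<^bsub>FK\<^esub> g \<in> Idl\<^bsub>FK\<^esub> KMW_rels"
proof -
  interpret J: ideal "Idl\<^bsub>FK\<^esub> KMW_rels" FK by (rule FK.genideal_ideal[OF KMW_rels_closed])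
  have "f \<in> Idl\<^bsub>FK\<^esub> KMW_rels +>\<^bsub>FK\<^esub> g"
    using assms J.a_rcos_self[OF assms(1)] by (simp add: KMW_class_eq)
  then show ?thesis using J.a_rcos_module_minus[OF FK_ring assms(2,1)] by simp
qed

text \<open>The class of a word in the generators.\<close>

abbreviation cw where "cw w \<equiv> KMW_class A (word w)"

lemma cw_mult: "u \<in> lists (mw_gens A) \<Longrightarrow> v \<in> lists (mw_gens A) \<Longrightarrow>
    cw (u @ v) = cw u \<otimes>\<^bsub>KMW A\<^esub> cw v"
  by (simp flip: word_mult)

lemma cw_Cons: "x \<in> mw_gens A \<Longrightarrow> w \<in> lists (mw_gens A) \<Longrightarrow>
    cw (x # w) = cw [x] \<otimes>\<^bsub>KMW A\<^esub> cw w"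
  using cw_mult[of "[x]" w] by simp

abbreviation s where "s \<equiv> KMW_bracket A"
abbreviation e where "e \<equiv> KMW_eta A"

lemma cw_gen: "cw [Sym a] = s a" "cw [Eta] = e"
  by (simp_all add: KMW_bracket_def KMW_eta_def)

lemma s_closed [simp]: "a \<in> Units A \<Longrightarrow> s a \<in> carrier (KMW A)"
  and e_closed [simp]: "e \<in> carrier (KMW A)"
  by (simp_all flip: cw_gen)

lemma s_steinberg:
  assumes "a \<in> Units A" "\<one> \<ominus> a \<in> Units A"
  shows "s a \<otimes>\<^bsub>KMW A\<^esub> s (\<one> \<ominus> a) = \<zero>\<^bsub>KMW A\<^esub>"
proof -
  have "cw [Sym a, Sym (\<one> \<ominus> a)] = \<zero>\<^bsub>KMW A\<^esub>"
    unfolding KMW_class_eq KMW_eq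
    by (rule FK.Idl_coset_zero[OF KMW_rels_closed]) (use assms in \<open>auto simp: KMW_rels_def\<close>)
  then show ?thesis using assms by (simp add: cw_Cons[of _ "[_]"] cw_gen)
qed

lemma s_mult:
  assumes "a \<in> Units A" "b \<in> Units A"
  shows "s (a \<otimes> b) = s a \<oplus>\<^bsub>KMW A\<^esub> s b \<oplus>\<^bsub>KMW A\<^esub> e \<otimes>\<^bsub>KMW A\<^esub> (s a \<otimes>\<^bsub>KMW A\<^esub> s b)"
proof -
  have "cw [Sym (a \<otimes> b)] =
      KMW_class A (word [Sym a] \<oplus>\<^bsub>FK\<^esub> word [Sym b] \<oplus>\<^bsub>FK\<^esub> word [Eta, Sym a, Sym b])"
    unfolding KMW_class_eq
    by (rule FK.Idl_coset_eq[OF KMW_rels_closed]) (use assms in \<open>auto simp: KMW_rels_def\<close>)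
  then show ?thesis using assms by (simp add: cw_Cons[of _ "_ # _"] cw_gen)
qed

lemma e_s_comm:
  assumes "a \<in> Units A"
  shows "s a \<otimes>\<^bsub>KMW A\<^esub> e = e \<otimes>\<^bsub>KMW A\<^esub> s a"
proof -
  have "cw [Eta, Sym a] = cw [Sym a, Eta]"
    unfolding KMW_class_eq
    by (rule FK.Idl_coset_eq[OF KMW_rels_closed]) (use assms in \<open>auto simp: KMW_rels_def\<close>)
  then show ?thesis using assms by (simp add: cw_Cons[of _ "[_]"] cw_gen)
qed

lemma e_hyperbolic:
  "e \<otimes>\<^bsub>KMW A\<^esub> (e \<otimes>\<^bsub>KMW A\<^esub> s (\<ominus> \<one>)) \<oplus>\<^bsub>KMW A\<^esub> (e \<oplus>\<^bsub>KMW A\<^esub> e) = \<zero>\<^bsub>KMW A\<^esub>"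
proof -
  have "KMW_class A (word [Eta, Eta, Sym (\<ominus> \<one>)] \<oplus>\<^bsub>FK\<^esub> (word [Eta] \<oplus>\<^bsub>FK\<^esub> word [Eta])) = \<zero>\<^bsub>KMW A\<^esub>"
    unfolding KMW_class_eq KMW_eq
    by (rule FK.Idl_coset_zero[OF KMW_rels_closed]) (auto simp: KMW_rels_def)
  then show ?thesis by (simp add: cw_Cons[of _ "_ # _"] cw_gen)
qed

text \<open>The element \<open>\<langle>a\<rangle> = 1 + \<eta>[a]\<close> of Milnor-Witt K-theory.\<close>

definition ang :: "'a \<Rightarrow> ('a mw_gen list \<Rightarrow> int) set" where
  "ang a = \<one>\<^bsub>KMW A\<^esub> \<oplus>\<^bsub>KMW A\<^esub> e \<otimes>\<^bsub>KMW A\<^esub> s a"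

lemma ang_closed [simp]: "a \<in> Units A \<Longrightarrow> ang a \<in> carrier (KMW A)"
  by (simp add: ang_def)

lemma s_e_left:
  assumes "a \<in> Units A" "x \<in> carrier (KMW A)"
  shows "s a \<otimes>\<^bsub>KMW A\<^esub> (e \<otimes>\<^bsub>KMW A\<^esub> x) = e \<otimes>\<^bsub>KMW A\<^esub> (s a \<otimes>\<^bsub>KMW A\<^esub> x)"
  using assms by (simp add: e_s_comm flip: KM.m_assoc)

lemma ang_mult:
  assumes "a \<in> Units A" "b \<in> Units A"
  shows "ang (a \<otimes> b) = ang a \<otimes>\<^bsub>KMW A\<^esub> ang b"
  using assms by (simp add: ang_def s_mult KM.l_distr KM.r_distr KM.a_ac KM.m_assoc s_e_left)

text \<open>The relation \<open>\<langle>1\<rangle> = 1\<close> is not among the defining ones. Multiplicativity gives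
  \<open>(\<langle>1\<rangle> - 1)\<langle>-1\<rangle> = 0\<close>, and the relation \<open>\<eta>(1 + \<langle>-1\<rangle>) = 0\<close> multiplied by \<open>[1]\<close> then gives
  \<open>\<langle>1\<rangle> - 1 = 0\<close>.\<close>

lemma ang_one: "ang \<one> = \<one>\<^bsub>KMW A\<^esub>"
proof -
  let ?p = "e \<otimes>\<^bsub>KMW A\<^esub> s \<one>" and ?m = "e \<otimes>\<^bsub>KMW A\<^esub> s (\<ominus> \<one>)"
  have p: "?p \<in> carrier (KMW A)" "?m \<in> carrier (KMW A)" by simp_all
  have "ang \<one> \<otimes>\<^bsub>KMW A\<^esub> ang (\<ominus> \<one>) = ang (\<ominus> \<one>)"
    using ang_mult[of \<one> "\<ominus> \<one>"] by simp
  then have "ang (\<ominus> \<one>) \<oplus>\<^bsub>KMW A\<^esub> ?p \<otimes>\<^bsub>KMW A\<^esub> ang (\<ominus> \<one>) = ang (\<ominus> \<one>)"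
    by (simp add: ang_def[of \<one>] KM.l_distr)
  then have 1: "?p \<otimes>\<^bsub>KMW A\<^esub> ang (\<ominus> \<one>) = \<zero>\<^bsub>KMW A\<^esub>"
    using KM.add.r_cancel_one[of "ang (\<ominus> \<one>)" "?p \<otimes>\<^bsub>KMW A\<^esub> ang (\<ominus> \<one>)"] by simp
  have "s \<one> \<otimes>\<^bsub>KMW A\<^esub> (e \<otimes>\<^bsub>KMW A\<^esub> ?m \<oplus>\<^bsub>KMW A\<^esub> (e \<oplus>\<^bsub>KMW A\<^esub> e)) = \<zero>\<^bsub>KMW A\<^esub>"
    by (simp add: e_hyperbolic)
  then have "?p \<otimes>\<^bsub>KMW A\<^esub> ang (\<ominus> \<one>) \<oplus>\<^bsub>KMW A\<^esub> ?p = \<zero>\<^bsub>KMW A\<^esub>"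
    by (simp add: ang_def KM.r_distr s_e_left e_s_comm KM.m_assoc KM.a_ac)
  then have "?p = \<zero>\<^bsub>KMW A\<^esub>" using 1 by simp
  then show ?thesis by (simp add: ang_def)
qed

lemma s_ang:
  assumes "a \<in> Units A" "b \<in> Units A"
  shows "s b \<otimes>\<^bsub>KMW A\<^esub> ang a = ang a \<otimes>\<^bsub>KMW A\<^esub> s b"
proof -
  have "s a \<oplus>\<^bsub>KMW A\<^esub> s b \<oplus>\<^bsub>KMW A\<^esub> e \<otimes>\<^bsub>KMW A\<^esub> (s a \<otimes>\<^bsub>KMW A\<^esub> s b) =
    s a \<oplus>\<^bsub>KMW A\<^esub> s b \<oplus>\<^bsub>KMW A\<^esub> e \<otimes>\<^bsub>KMW A\<^esub> (s b \<otimes>\<^bsub>KMW A\<^esub> s a)"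
    using s_mult[OF assms] s_mult[OF assms(2,1)] assms by (simp add: m_comm Units_closed KM.a_comm)
  then have "e \<otimes>\<^bsub>KMW A\<^esub> (s a \<otimes>\<^bsub>KMW A\<^esub> s b) = e \<otimes>\<^bsub>KMW A\<^esub> (s b \<otimes>\<^bsub>KMW A\<^esub> s a)"
    by (rule KM.add.l_cancel) (use assms in auto)
  then show ?thesis using assms by (simp add: ang_def KM.l_distr KM.r_distr s_e_left KM.m_assoc)
qed

lemma KMW_symbols: "mw_symbols (KMW A) A ang s"
proof (intro mw_symbols.intro mw_symbols_axioms.intro KMW_ring is_cring)
  show "s (a \<otimes> b) = s a \<oplus>\<^bsub>KMW A\<^esub> ang a \<otimes>\<^bsub>KMW A\<^esub> s b" if "a \<in> Units A" "b \<in> Units A" for a b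
    using that by (simp add: s_mult ang_def KM.l_distr KM.m_assoc KM.a_assoc)
qed (auto simp: ang_mult ang_one s_ang s_steinberg)

sublocale KM: mw_symbols "KMW A" A ang s by (rule KMW_symbols)

lemma KM_D: "a \<in> Units A \<Longrightarrow> KM.D a = e \<otimes>\<^bsub>KMW A\<^esub> s a"
  by (simp add: KM.D_def ang_def KM.minus_eq KM.a_ac KM.r_neg1 KM.r_neg2)

end

section \<open>The algebra K-hat\<close>

context units_ring
begin

abbreviation V where "V \<equiv> free_monoid (aug_ideal A)"

sublocale FM: monoid_algebra Z V
  by (intro monoid_algebra.intro Z_ring free_monoid_monoid)

abbreviation FA where "FA \<equiv> free_algebra Z (aug_ideal A)"

lemma FA_eq: "FM.MR = FA" by (simp add: free_algebra_def)

lemma FA_ring: "ring FA" using FM.MR_ring by (simp add: FA_eq)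

sublocale FA: ring FA by (rule FA_ring)

lemma V_carrier: "carrier V = lists (aug_ideal A)" and V_mult: "u \<otimes>\<^bsub>V\<^esub> v = u @ v"
  and V_one: "\<one>\<^bsub>V\<^esub> = []"
  by (simp_all add: free_monoid_def)

lemma aug_module_simps [simp]: "carrier (aug_module A) = aug_ideal A"
  "m \<oplus>\<^bsub>aug_module A\<^esub> m' = m \<oplus>\<^bsub>Z\<^esub> m'" "r \<odot>\<^bsub>aug_module A\<^esub> m = r \<otimes>\<^bsub>Z\<^esub> m"
  by (simp_all add: aug_module_def Let_def)

text \<open>An element of the augmentation ideal in tensor degree one, and a scalar in degree zero.\<close>

abbreviation vec :: "('a \<Rightarrow> int) \<Rightarrow> ('a \<Rightarrow> int) list \<Rightarrow> 'a \<Rightarrow> int" where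
  "vec m \<equiv> single Z [m] \<one>\<^bsub>Z\<^esub>"

abbreviation sc :: "('a \<Rightarrow> int) \<Rightarrow> ('a \<Rightarrow> int) list \<Rightarrow> 'a \<Rightarrow> int" where
  "sc r \<equiv> single Z [] r"

lemma FA_single_closed [simp]: "w \<in> lists (aug_ideal A) \<Longrightarrow> r \<in> carrier Z \<Longrightarrow> single Z w r \<in> carrier FA"
  using FM.single_closed[of w r] by (simp add: FA_eq V_carrier)

lemma FA_single_mult: "u \<in> lists (aug_ideal A) \<Longrightarrow> v \<in> lists (aug_ideal A) \<Longrightarrow> r \<in> carrier Z \<Longrightarrow>
    t \<in> carrier Z \<Longrightarrow> single Z u r \<otimes>\<^bsub>FA\<^esub> single Z v t = single Z (u @ v) (r \<otimes>\<^bsub>Z\<^esub> t)"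
  using FM.single_mult[of u v r t] by (simp add: FA_eq V_carrier V_mult)

text \<open>The bilinearity relations that present the tensor algebra of the augmentation ideal.\<close>

definition tensor_rels :: "(('a \<Rightarrow> int) list \<Rightarrow> 'a \<Rightarrow> int) set" where
  "tensor_rels =
    {vec (m \<oplus>\<^bsub>Z\<^esub> m') \<ominus>\<^bsub>FA\<^esub> (vec m \<oplus>\<^bsub>FA\<^esub> vec m') | m m'. m \<in> aug_ideal A \<and> m' \<in> aug_ideal A} \<union>
    {vec (r \<otimes>\<^bsub>Z\<^esub> m) \<ominus>\<^bsub>FA\<^esub> sc r \<otimes>\<^bsub>FA\<^esub> vec m | r m. r \<in> carrier Z \<and> m \<in> aug_ideal A}"

lemma tensor_rels_closed: "tensor_rels \<subseteq> carrier FA"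
  unfolding tensor_rels_def by (auto simp: I.I_l_closed)

lemma tensor_ideal_eq: "tensor_ideal Z (aug_module A) = Idl\<^bsub>FA\<^esub> tensor_rels"
  by (simp add: tensor_ideal_def tensor_rels_def Let_def)

abbreviation T where "T \<equiv> aug_tensor_algebra A"

lemma T_eq: "T = FA Quot Idl\<^bsub>FA\<^esub> tensor_rels"
  by (simp add: tensor_algebra_def tensor_ideal_eq)

abbreviation tcl where "tcl \<equiv> tensor_class Z (aug_module A)"

lemma tcl_eq: "tcl f = Idl\<^bsub>FA\<^esub> tensor_rels +>\<^bsub>FA\<^esub> f"
  by (simp add: tensor_class_def tensor_ideal_eq)

lemma T_ring: "ring T"
  unfolding T_eq by (rule ideal.quotient_is_ring[OF FA.genideal_ideal[OF tensor_rels_closed]])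

sublocale T: ring T by (rule T_ring)

lemma tcl_hom: "ring_hom_ring FA T tcl"
  unfolding T_eq tcl_eq[abs_def]
  by (rule ideal.rcos_ring_hom_ring[OF FA.genideal_ideal[OF tensor_rels_closed]])

sublocale tcl: ring_hom_ring FA T tcl by (rule tcl_hom)

text \<open>The Steinberg relations in the tensor algebra.\<close>

definition Khat_rels :: "(('a \<Rightarrow> int) list \<Rightarrow> 'a \<Rightarrow> int) set set" where
  "Khat_rels = {tcl (vec (bracket A a)) \<otimes>\<^bsub>T\<^esub> tcl (vec (bracket A (\<one> \<ominus> a))) | a.
    a \<in> Units A \<and> \<one> \<ominus> a \<in> Units A}"

lemma Khat_rels_closed: "Khat_rels \<subseteq> carrier T"
  unfolding Khat_rels_def by auto

lemma Khat_ideal_eq: "Khat_ideal A = Idl\<^bsub>T\<^esub> Khat_rels"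
  by (simp add: Khat_ideal_def Khat_rels_def Let_def tensor_incl_def)

lemma Khat_eq: "Khat A = T Quot Idl\<^bsub>T\<^esub> Khat_rels"
  by (simp add: Khat_def Khat_ideal_eq)

lemma Khat_class_eq: "Khat_class A t = Idl\<^bsub>T\<^esub> Khat_rels +>\<^bsub>T\<^esub> t"
  by (simp add: Khat_class_def Khat_ideal_eq)

lemma Khat_ring: "ring (Khat A)"
  unfolding Khat_eq by (rule ideal.quotient_is_ring[OF T.genideal_ideal[OF Khat_rels_closed]])

sublocale KH: ring "Khat A" by (rule Khat_ring)

lemma Khat_class_hom: "ring_hom_ring T (Khat A) (Khat_class A)"
  unfolding Khat_eq Khat_class_eq[abs_def]
  by (rule ideal.rcos_ring_hom_ring[OF T.genideal_ideal[OF Khat_rels_closed]])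

sublocale kcl: ring_hom_ring T "Khat A" "Khat_class A" by (rule Khat_class_hom)

text \<open>The canonical surjection from the free algebra over the group ring on the augmentation ideal onto
  \<open>K\<close>-hat. It composes the two quotient maps, so \<open>K\<close>-hat can be treated as one quotient of the free
  algebra.\<close>

definition khat_of where "khat_of f = Khat_class A (tcl f)"

lemma khat_of_hom: "ring_hom_ring FA (Khat A) khat_of"
  by (rule ring_hom_ringI[OF FA_ring Khat_ring]) (simp_all add: khat_of_def)

sublocale khat_of: ring_hom_ring FA "Khat A" khat_of by (rule khat_of_hom)

lemma Khat_carrier: "carrier (Khat A) = khat_of ` carrier FA"
  unfolding khat_of_def Khat_eq FactRing_carrier Khat_class_eq[abs_def] T_eq tcl_eq[abs_def] image_image ..

text \<open>The universal property of \<open>K\<close>-hat.\<close>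

lemma Khat_lift:
  fixes S :: "('s, 'k) ring_scheme"
  assumes h: "ring_hom_ring FA S h"
    and add: "\<And>m m'. m \<in> aug_ideal A \<Longrightarrow> m' \<in> aug_ideal A \<Longrightarrow>
      h (vec (m \<oplus>\<^bsub>Z\<^esub> m')) = h (vec m) \<oplus>\<^bsub>S\<^esub> h (vec m')"
    and smult: "\<And>r m. r \<in> carrier Z \<Longrightarrow> m \<in> aug_ideal A \<Longrightarrow>
      h (vec (r \<otimes>\<^bsub>Z\<^esub> m)) = h (sc r) \<otimes>\<^bsub>S\<^esub> h (vec m)"
    and st: "\<And>a. a \<in> Units A \<Longrightarrow> \<one> \<ominus> a \<in> Units A \<Longrightarrow>
      h (vec (bracket A a)) \<otimes>\<^bsub>S\<^esub> h (vec (bracket A (\<one> \<ominus> a))) = \<zero>\<^bsub>S\<^esub>"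
  obtains k where "k \<in> ring_hom (Khat A) S" "\<And>f. f \<in> carrier FA \<Longrightarrow> k (khat_of f) = h f"
proof -
  interpret h: ring_hom_ring FA S h by (rule h)
  have "h b = \<zero>\<^bsub>S\<^esub>" if "b \<in> tensor_rels" for b
    using that unfolding tensor_rels_def
    by (auto simp: FA.minus_eq add smult h.S.r_neg I.I_l_closed)
  from FA.Idl_quotient_lift[OF tensor_rels_closed h this]
  obtain k1 where k1: "k1 \<in> ring_hom T S" "\<And>x. x \<in> carrier FA \<Longrightarrow> k1 (tcl x) = h x"
    unfolding T_eq[symmetric] tcl_eq[symmetric] by blast
  have k1_hom: "ring_hom_ring T S k1"
    by (rule ring_hom_ringI2[OF T_ring h.S.ring_axioms k1(1)])
  interpret k1: ring_hom_ring T S k1 by (rule k1_hom)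
  have "k1 b = \<zero>\<^bsub>S\<^esub>" if "b \<in> Khat_rels" for b
    using that unfolding Khat_rels_def by (auto simp: k1(2) st)
  from T.Idl_quotient_lift[OF Khat_rels_closed k1_hom this]
  obtain k where k: "k \<in> ring_hom (Khat A) S" "\<And>x. x \<in> carrier T \<Longrightarrow> k (Khat_class A x) = k1 x"
    unfolding Khat_eq[symmetric] Khat_class_eq[symmetric] by blast
  have "k (khat_of f) = h f" if "f \<in> carrier FA" for f
    using that by (simp add: khat_of_def k(2) k1(2))
  with k(1) show thesis using that by blast
qed

lemma khat_of_vec_add:
  assumes "m \<in> aug_ideal A" "m' \<in> aug_ideal A"
  shows "khat_of (vec (m \<oplus>\<^bsub>Z\<^esub> m')) = khat_of (vec m) \<oplus>\<^bsub>Khat A\<^esub> khat_of (vec m')"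
proof -
  have "tcl (vec (m \<oplus>\<^bsub>Z\<^esub> m')) = tcl (vec m \<oplus>\<^bsub>FA\<^esub> vec m')"
    unfolding tcl_eq by (rule FA.Idl_coset_eq[OF tensor_rels_closed])
      (use assms in \<open>auto simp: tensor_rels_def\<close>)
  then show ?thesis using assms by (simp add: khat_of_def)
qed

lemma khat_of_vec_smult:
  assumes "r \<in> carrier Z" "m \<in> aug_ideal A"
  shows "khat_of (vec (r \<otimes>\<^bsub>Z\<^esub> m)) = khat_of (sc r) \<otimes>\<^bsub>Khat A\<^esub> khat_of (vec m)"
proof -
  have "tcl (vec (r \<otimes>\<^bsub>Z\<^esub> m)) = tcl (sc r \<otimes>\<^bsub>FA\<^esub> vec m)"
    unfolding tcl_eq by (rule FA.Idl_coset_eq[OF tensor_rels_closed])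
      (use assms in \<open>auto simp: tensor_rels_def I.I_l_closed\<close>)
  then show ?thesis using assms by (simp add: khat_of_def)
qed

lemma khat_of_steinberg:
  assumes "a \<in> Units A" "\<one> \<ominus> a \<in> Units A"
  shows "khat_of (vec (bracket A a)) \<otimes>\<^bsub>Khat A\<^esub> khat_of (vec (bracket A (\<one> \<ominus> a))) = \<zero>\<^bsub>Khat A\<^esub>"
proof -
  have "Khat_class A (tcl (vec (bracket A a)) \<otimes>\<^bsub>T\<^esub> tcl (vec (bracket A (\<one> \<ominus> a)))) = \<zero>\<^bsub>Khat A\<^esub>"
    unfolding Khat_class_eq Khat_eq
    by (rule T.Idl_coset_zero[OF Khat_rels_closed]) (use assms in \<open>auto simp: Khat_rels_def\<close>)
  then show ?thesis using assms by (simp add: khat_of_def)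
qed

lemma khat_of_vec_zero: "khat_of (vec \<zero>\<^bsub>Z\<^esub>) = \<zero>\<^bsub>Khat A\<^esub>"
proof -
  have "khat_of (vec \<zero>\<^bsub>Z\<^esub>) \<oplus>\<^bsub>Khat A\<^esub> khat_of (vec \<zero>\<^bsub>Z\<^esub>) = khat_of (vec \<zero>\<^bsub>Z\<^esub>)"
    using khat_of_vec_add[of "\<zero>\<^bsub>Z\<^esub>" "\<zero>\<^bsub>Z\<^esub>"] by simp
  then show ?thesis
    using KH.add.r_cancel_one[of "khat_of (vec \<zero>\<^bsub>Z\<^esub>)" "khat_of (vec \<zero>\<^bsub>Z\<^esub>)"] by simp
qed

lemma khat_of_vec_minus:
  assumes "m \<in> aug_ideal A"
  shows "khat_of (vec (\<ominus>\<^bsub>Z\<^esub> m)) = \<ominus>\<^bsub>Khat A\<^esub> khat_of (vec m)"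
proof -
  have "khat_of (vec (\<ominus>\<^bsub>Z\<^esub> m)) \<oplus>\<^bsub>Khat A\<^esub> khat_of (vec m) = \<zero>\<^bsub>Khat A\<^esub>"
    using khat_of_vec_add[of "\<ominus>\<^bsub>Z\<^esub> m" m] assms by (simp add: Z.l_neg khat_of_vec_zero I.a_Hcarr)
  then show ?thesis using assms by (simp add: KH.minus_equality)
qed

abbreviation kang where "kang \<equiv> Khat_angle A"
abbreviation kbr where "kbr \<equiv> Khat_bracket A"

lemma kang_eq: "kang a = khat_of (sc (angle a))" and kbr_eq: "kbr a = khat_of (vec (bracket A a))"
  by (simp_all add: Khat_angle_def Khat_bracket_def tensor_scalar_def tensor_incl_def khat_of_def)

lemma sc_mult: "r \<in> carrier Z \<Longrightarrow> t \<in> carrier Z \<Longrightarrow> sc (r \<otimes>\<^bsub>Z\<^esub> t) = sc r \<otimes>\<^bsub>FA\<^esub> sc t"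
  by (simp add: FA_single_mult)

lemma sc_add: "r \<in> carrier Z \<Longrightarrow> t \<in> carrier Z \<Longrightarrow> sc (r \<oplus>\<^bsub>Z\<^esub> t) = sc r \<oplus>\<^bsub>FA\<^esub> sc t"
  using FM.single_add[of r t "[]"] by (simp add: FA_eq)

lemma sc_one: "sc \<one>\<^bsub>Z\<^esub> = \<one>\<^bsub>FA\<^esub>"
  using FM.MR_one by (simp add: FA_eq V_one)

lemma Khat_symbols: "mw_symbols (Khat A) A kang kbr"
proof (intro mw_symbols.intro mw_symbols_axioms.intro Khat_ring is_cring)
  fix a b assume a: "a \<in> Units A" and b: "b \<in> Units A"
  show "kang (a \<otimes> b) = kang a \<otimes>\<^bsub>Khat A\<^esub> kang b"
    using a b by (simp add: kang_eq angle_mult[symmetric] sc_mult)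
  have "sc (angle a) \<otimes>\<^bsub>FA\<^esub> vec (bracket A b) = vec (bracket A b) \<otimes>\<^bsub>FA\<^esub> sc (angle a)"
    using a b by (simp add: FA_single_mult)
  then show "kbr b \<otimes>\<^bsub>Khat A\<^esub> kang a = kang a \<otimes>\<^bsub>Khat A\<^esub> kbr b"
    unfolding kang_eq kbr_eq using a b by (simp flip: khat_of.hom_mult)
  show "kbr (a \<otimes> b) = kbr a \<oplus>\<^bsub>Khat A\<^esub> kang a \<otimes>\<^bsub>Khat A\<^esub> kbr b"
    using a b by (simp add: kang_eq kbr_eq bracket_mult khat_of_vec_add khat_of_vec_smult I.I_l_closed)
qed (simp_all add: kang_eq kbr_eq angle_one sc_one khat_of_steinberg)

sublocale KH: mw_symbols "Khat A" A kang kbr by (rule Khat_symbols)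

subsection \<open>Additive generators\<close>

lemma khat_of_single_Cons:
  assumes "m \<in> aug_ideal A" "w \<in> lists (aug_ideal A)" "r \<in> carrier Z"
  shows "khat_of (single Z (m # w) r) = khat_of (vec (r \<otimes>\<^bsub>Z\<^esub> m)) \<otimes>\<^bsub>Khat A\<^esub> khat_of (single Z w \<one>\<^bsub>Z\<^esub>)"
proof -
  have "single Z (m # w) r = sc r \<otimes>\<^bsub>FA\<^esub> vec m \<otimes>\<^bsub>FA\<^esub> single Z w \<one>\<^bsub>Z\<^esub>"
    using assms by (simp add: FA_single_mult)
  then show ?thesis using assms by (simp add: khat_of_vec_smult)
qed

text \<open>The additive subgroup generated by the products \<open>[a\<^sub>1] \<dots> [a\<^sub>n]\<close> of exactly \<open>n\<close> symbols.\<close>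

inductive_set Kspan :: "nat \<Rightarrow> 'a khat set" for n where
  zero: "\<zero>\<^bsub>Khat A\<^esub> \<in> Kspan n"
| gen: "set as \<subseteq> Units A \<Longrightarrow> length as = n \<Longrightarrow> KH.K 0 as \<in> Kspan n"
| add: "x \<in> Kspan n \<Longrightarrow> y \<in> Kspan n \<Longrightarrow> x \<oplus>\<^bsub>Khat A\<^esub> y \<in> Kspan n"
| minus: "x \<in> Kspan n \<Longrightarrow> \<ominus>\<^bsub>Khat A\<^esub> x \<in> Kspan n"

lemma Kspan_closed: "x \<in> Kspan n \<Longrightarrow> x \<in> carrier (Khat A)"
  by (induction rule: Kspan.induct) auto

lemma Kspan_Cons:
  assumes m: "m \<in> aug_ideal A" and x: "x \<in> Kspan n"
  shows "khat_of (vec m) \<otimes>\<^bsub>Khat A\<^esub> x \<in> Kspan (Suc n)"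
  using m
proof (induction rule: aug_induct)
  case (bracket a)
  show ?case using x
  proof (induction rule: Kspan.induct)
    case (gen as)
    then show ?case using bracket Kspan.gen[of "a # as" "Suc n"] by (simp add: kbr_eq)
  qed (use bracket Kspan_closed in \<open>auto simp: KH.r_distr KH.r_minus intro: Kspan.intros\<close>)
next
  case zero
  then show ?case using Kspan_closed[OF x] by (simp add: khat_of_vec_zero Kspan.zero)
next
  case (add f g)
  then show ?case using Kspan_closed[OF x] by (simp add: khat_of_vec_add KH.l_distr Kspan.add)
next
  case (minus f)
  then show ?case using Kspan_closed[OF x] by (simp add: khat_of_vec_minus KH.l_minus Kspan.minus)
qed

lemma Kspan_word:
  "w \<in> lists (aug_ideal A) \<Longrightarrow> khat_of (single Z w \<one>\<^bsub>Z\<^esub>) \<in> Kspan (length w)"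
proof (induction w)
  case Nil
  then show ?case using Kspan.gen[of "[]" 0] by (simp add: sc_one)
next
  case (Cons m w)
  then show ?case using khat_of_single_Cons[of m w "\<one>\<^bsub>Z\<^esub>"] Kspan_Cons[of m] by (simp add: I.a_Hcarr)
qed

end

section \<open>The natural map\<close>

context units_ring
begin

lemma KMW_deg_eq: "KMW_deg A n = KMW_class A ` F.supported {w. word_degree w = n}"
  by (simp add: KMW_deg_def homogeneous_def F.supported_def F_eq subset_iff Ball_def)

lemma Khat_deg_eq: "Khat_deg A n = khat_of ` FM.supported {w. length w = n}"
  by (simp add: Khat_deg_def tensor_power_def image_image khat_of_def homogeneous_def FM.supported_def FA_eq subset_iff Ball_def)

lemma F_supported_closed: "f \<in> F.supported X \<Longrightarrow> f \<in> carrier FK"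
  using F.supported_carrier by (simp add: F_eq)

lemma FM_supported_closed: "f \<in> FM.supported X \<Longrightarrow> f \<in> carrier FA"
  using FM.supported_carrier by (simp add: FA_eq)

text \<open>In positive degree no coefficients from the group ring are needed: they are absorbed by the first
  tensor factor, which is an arbitrary element of the augmentation ideal.\<close>

lemma Khat_deg_Kspan:
  assumes "x \<in> Khat_deg A n" "n \<ge> 1"
  shows "x \<in> Kspan n"
proof -
  obtain f where f: "f \<in> FM.supported {w. length w = n}" and x: "x = khat_of f"
    using assms unfolding Khat_deg_eq by blast
  have "khat_of f \<in> Kspan n" using f
  proof (induction rule: FM.supported_induct)
    case zero
    then show ?case by (simp add: FA_eq Kspan.zero)
  next
    case (add f w r)
    then have w: "w \<in> lists (aug_ideal A)" "length w = n" by (auto simp: V_carrier)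
    then obtain m v where mv: "w = m # v" "m \<in> aug_ideal A" "v \<in> lists (aug_ideal A)"
      using assms(2) by (cases w) auto
    have "khat_of (single Z w r) \<in> Kspan (Suc (length v))"
      using khat_of_single_Cons[of m v r] Kspan_Cons[OF I.I_l_closed[OF mv(2) add(4)] Kspan_word[OF mv(3)]]
        mv add by simp
    then show ?case using add w mv by (simp add: FA_eq Kspan.add FM_supported_closed)
  qed
  then show ?thesis by (simp add: x)
qed

lemma word_degree_append: "word_degree (u @ v) = word_degree u + word_degree v"
  by (simp add: word_degree_def)

lemma KMW_deg_zero: "\<zero>\<^bsub>KMW A\<^esub> \<in> KMW_deg A n"
  unfolding KMW_deg_eq by (rule image_eqI[of _ _ "\<zero>\<^bsub>FK\<^esub>"]) (use F.supported_zero in \<open>auto simp: F_eq\<close>)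

lemma KMW_deg_add:
  assumes "x \<in> KMW_deg A n" "y \<in> KMW_deg A n"
  shows "x \<oplus>\<^bsub>KMW A\<^esub> y \<in> KMW_deg A n"
proof -
  obtain f g where fg: "f \<in> F.supported {w. word_degree w = n}" "x = KMW_class A f"
    "g \<in> F.supported {w. word_degree w = n}" "y = KMW_class A g"
    using assms unfolding KMW_deg_eq by blast
  then have "x \<oplus>\<^bsub>KMW A\<^esub> y = KMW_class A (f \<oplus>\<^bsub>FK\<^esub> g)" by (simp add: F_supported_closed)
  then show ?thesis unfolding KMW_deg_eq
    using F.supported_add[OF fg(1,3)] by (simp add: F_eq)
qed

lemma KMW_deg_minus:
  assumes "x \<in> KMW_deg A n"
  shows "\<ominus>\<^bsub>KMW A\<^esub> x \<in> KMW_deg A n"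
proof -
  obtain f where f: "f \<in> F.supported {w. word_degree w = n}" "x = KMW_class A f"
    using assms unfolding KMW_deg_eq by blast
  then have "\<ominus>\<^bsub>KMW A\<^esub> x = KMW_class A (\<ominus>\<^bsub>FK\<^esub> f)" by (simp add: F_supported_closed)
  then show ?thesis unfolding KMW_deg_eq
    using F.supported_minus[OF f(1)] by (simp add: F_eq)
qed

lemma KMW_deg_mult:
  assumes "x \<in> KMW_deg A n" "y \<in> KMW_deg A k"
  shows "x \<otimes>\<^bsub>KMW A\<^esub> y \<in> KMW_deg A (n + k)"
proof -
  obtain f g where fg: "f \<in> F.supported {w. word_degree w = n}" "x = KMW_class A f"
    "g \<in> F.supported {w. word_degree w = k}" "y = KMW_class A g"
    using assms unfolding KMW_deg_eq by blast
  then have "x \<otimes>\<^bsub>KMW A\<^esub> y = KMW_class A (f \<otimes>\<^bsub>FK\<^esub> g)" by (simp add: F_supported_closed)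
  moreover have "f \<otimes>\<^bsub>F.MR\<^esub> g \<in> F.supported {w. word_degree w = n + k}"
    by (rule F.supported_mult[OF _ fg(1,3)]) (simp add: Words_mult word_degree_append)
  ultimately show ?thesis unfolding KMW_deg_eq by (simp add: F_eq)
qed

lemma cw_deg: "w \<in> lists (mw_gens A) \<Longrightarrow> cw w \<in> KMW_deg A (word_degree w)"
  unfolding KMW_deg_eq by (rule imageI, rule F.supported_single) (auto simp: Words_carrier)

lemma s_deg: "a \<in> Units A \<Longrightarrow> s a \<in> KMW_deg A 1"
  using cw_deg[of "[Sym a]"] by (simp add: cw_gen word_degree_def)

lemma one_deg: "\<one>\<^bsub>KMW A\<^esub> \<in> KMW_deg A 0"
  using cw_deg[of "[]"] by (simp add: word_Nil word_degree_def)

lemma ang_deg: "a \<in> Units A \<Longrightarrow> ang a \<in> KMW_deg A 0"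
  using cw_deg[of "[Eta]"] KMW_deg_mult[of e "-1" "s a" 1]
  by (simp add: cw_gen word_degree_def ang_def KMW_deg_add one_deg s_deg)

text \<open>The ring homomorphism on the group ring given by \<open>\<langle>a\<rangle> \<mapsto> 1 + \<eta>[a]\<close>.\<close>

definition scalar_map :: "('a \<Rightarrow> int) \<Rightarrow> ('a mw_gen list \<Rightarrow> int) set" where
  "scalar_map = ZA.integral_ext (KMW A) ang"

text \<open>The additive map on the group ring given by \<open>\<langle>a\<rangle> \<mapsto> [a]\<close>. On the augmentation ideal it sends
  \<open>\<langle>a\<rangle> - 1\<close> to \<open>[a]\<close>, because \<open>[1] = 0\<close>, and it is semilinear over the preceding homomorphism.\<close>

definition aug_map :: "('a \<Rightarrow> int) \<Rightarrow> ('a mw_gen list \<Rightarrow> int) set" where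
  "aug_map = ZA.integral_ext (KMW A) s"

lemma scalar_map_hom: "ring_hom_ring Z (KMW A) scalar_map"
proof (rule ring_hom_ringI2[OF Z_ring KMW_ring])
  have "scalar_map \<in> ring_hom ZA.MR (KMW A)"
    unfolding scalar_map_def by (rule ZA.integral_ext_ring_hom[OF KMW_ring])
      (auto simp: units_of_carrier units_of_mult units_of_one ang_mult ang_one)
  then show "scalar_map \<in> ring_hom Z (KMW A)" by (simp add: ZA_eq)
qed

sublocale scalar_map: ring_hom_ring Z "KMW A" scalar_map by (rule scalar_map_hom)

lemma aug_map_hom: "abelian_group_hom Z (KMW A) aug_map"
  unfolding aug_map_def ZA_eq[symmetric] by (rule ZA.integral_ext_hom[OF KMW_ring]) (simp add: units_of_carrier)

sublocale aug_map: abelian_group_hom Z "KMW A" aug_map by (rule aug_map_hom)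

lemma scalar_map_angle: "a \<in> Units A \<Longrightarrow> scalar_map (angle a) = ang a"
  unfolding scalar_map_def angle_def by (rule ZA.integral_ext_single_one[OF KMW_ring]) (auto simp: units_of_carrier)

lemma aug_map_angle: "a \<in> Units A \<Longrightarrow> aug_map (angle a) = s a"
  unfolding aug_map_def angle_def by (rule ZA.integral_ext_single_one[OF KMW_ring]) (auto simp: units_of_carrier)

lemma aug_map_bracket: "a \<in> Units A \<Longrightarrow> aug_map (bracket A a) = s a"
  using aug_map_angle[of \<one>] by (simp add: bracket_def Z.minus_eq aug_map_angle KM.br_one angle_one)

lemma Z_induct [consumes 1, case_names zero angle add minus]:
  assumes "f \<in> carrier Z" "P \<zero>\<^bsub>Z\<^esub>" "\<And>a. a \<in> Units A \<Longrightarrow> P (angle a)"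
    "\<And>f g. f \<in> carrier Z \<Longrightarrow> g \<in> carrier Z \<Longrightarrow> P f \<Longrightarrow> P g \<Longrightarrow> P (f \<oplus>\<^bsub>Z\<^esub> g)"
    "\<And>f. f \<in> carrier Z \<Longrightarrow> P f \<Longrightarrow> P (\<ominus>\<^bsub>Z\<^esub> f)"
  shows "P f"
  using ZA.integral_induct[of f P] assms by (simp add: ZA_eq units_of_carrier angle_def)

lemma I_carrier [simp]: "m \<in> aug_ideal A \<Longrightarrow> m \<in> carrier Z"
  by (rule I.a_Hcarr)

lemma aug_map_smult:
  assumes r: "r \<in> carrier Z" and m: "m \<in> aug_ideal A"
  shows "aug_map (r \<otimes>\<^bsub>Z\<^esub> m) = scalar_map r \<otimes>\<^bsub>KMW A\<^esub> aug_map m"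
  using r
proof (induction rule: Z_induct)
  case (angle a)
  show ?case using m
  proof (induction rule: aug_induct)
    case (bracket b)
    have "s a \<oplus>\<^bsub>KMW A\<^esub> aug_map (angle a \<otimes>\<^bsub>Z\<^esub> bracket A b) = s a \<oplus>\<^bsub>KMW A\<^esub> ang a \<otimes>\<^bsub>KMW A\<^esub> s b"
      using aug_map_bracket[of "a \<otimes> b"] angle bracket
      by (simp add: bracket_mult aug_map_bracket KM.br_mult)
    then have "aug_map (angle a \<otimes>\<^bsub>Z\<^esub> bracket A b) = ang a \<otimes>\<^bsub>KMW A\<^esub> s b"
      by (rule KM.add.l_cancel) (use angle bracket in auto)
    then show ?case using angle bracket by (simp add: aug_map_bracket scalar_map_angle)
  qed (use angle in \<open>simp_all add: Z.r_distr Z.r_minus KM.r_distr KM.r_minus\<close>)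
qed (use m in \<open>simp_all add: Z.l_distr Z.l_minus KM.l_distr KM.l_minus\<close>)

lemma aug_map_scalar_map_comm:
  assumes r: "r \<in> carrier Z" and m: "m \<in> aug_ideal A"
  shows "aug_map m \<otimes>\<^bsub>KMW A\<^esub> scalar_map r = scalar_map r \<otimes>\<^bsub>KMW A\<^esub> aug_map m"
  using r
proof (induction rule: Z_induct)
  case (angle a)
  show ?case using m
  proof (induction rule: aug_induct)
    case (bracket b)
    then show ?case using angle by (simp add: aug_map_bracket scalar_map_angle s_ang)
  qed (use angle in \<open>simp_all add: KM.r_distr KM.r_minus KM.l_distr KM.l_minus\<close>)
qed (use m in \<open>simp_all add: KM.l_distr KM.l_minus KM.r_distr KM.r_minus\<close>)

lemma scalar_map_deg: "r \<in> carrier Z \<Longrightarrow> scalar_map r \<in> KMW_deg A 0"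
  by (induction rule: Z_induct) (auto simp: scalar_map_angle ang_deg KMW_deg_zero KMW_deg_add KMW_deg_minus)

lemma aug_map_deg: "m \<in> carrier Z \<Longrightarrow> aug_map m \<in> KMW_deg A 1"
  by (induction rule: Z_induct) (auto simp: aug_map_angle s_deg KMW_deg_zero KMW_deg_add KMW_deg_minus)

text \<open>The extension of the preceding map to words in the augmentation ideal.\<close>

definition aug_map_prod :: "('a \<Rightarrow> int) list \<Rightarrow> ('a mw_gen list \<Rightarrow> int) set" where
  "aug_map_prod w = foldr (\<lambda>m x. aug_map m \<otimes>\<^bsub>KMW A\<^esub> x) w \<one>\<^bsub>KMW A\<^esub>"

lemma aug_map_prod_simps [simp]: "aug_map_prod [] = \<one>\<^bsub>KMW A\<^esub>" "aug_map_prod (m # w) = aug_map m \<otimes>\<^bsub>KMW A\<^esub> aug_map_prod w"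
  by (simp_all add: aug_map_prod_def)

lemma aug_map_prod_closed [simp]: "w \<in> lists (aug_ideal A) \<Longrightarrow> aug_map_prod w \<in> carrier (KMW A)"
  by (induction w) auto

lemma aug_map_prod_append: "u \<in> lists (aug_ideal A) \<Longrightarrow> v \<in> lists (aug_ideal A) \<Longrightarrow>
    aug_map_prod (u @ v) = aug_map_prod u \<otimes>\<^bsub>KMW A\<^esub> aug_map_prod v"
  by (induction u) (auto simp: KM.m_assoc)

lemma aug_map_prod_scalar_map_comm:
  assumes "r \<in> carrier Z" "w \<in> lists (aug_ideal A)"
  shows "aug_map_prod w \<otimes>\<^bsub>KMW A\<^esub> scalar_map r = scalar_map r \<otimes>\<^bsub>KMW A\<^esub> aug_map_prod w"
  using assms(2)
proof (induction w)
  case (Cons m w)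
  then have "aug_map_prod (m # w) \<otimes>\<^bsub>KMW A\<^esub> scalar_map r = (aug_map m \<otimes>\<^bsub>KMW A\<^esub> scalar_map r) \<otimes>\<^bsub>KMW A\<^esub> aug_map_prod w"
    using assms(1) by (simp add: KM.m_assoc)
  then show ?case using Cons assms(1) by (simp add: aug_map_scalar_map_comm KM.m_assoc)
qed (use assms(1) in simp)

lemma aug_map_prod_deg: "w \<in> lists (aug_ideal A) \<Longrightarrow> aug_map_prod w \<in> KMW_deg A (int (length w))"
proof (induction w)
  case (Cons m w)
  then show ?case using KMW_deg_mult[of "aug_map m" 1 "aug_map_prod w" "int (length w)"] by (simp add: aug_map_deg)
qed (simp add: one_deg)

text \<open>The homomorphism on the free algebra from which the natural map is obtained by passing to the
  quotient.\<close>

definition free_natural :: "(('a \<Rightarrow> int) list \<Rightarrow> 'a \<Rightarrow> int) \<Rightarrow> ('a mw_gen list \<Rightarrow> int) set" where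
  "free_natural = FM.additive_ext (KMW A) (\<lambda>w r. scalar_map r \<otimes>\<^bsub>KMW A\<^esub> aug_map_prod w)"

lemma free_natural_single: "w \<in> lists (aug_ideal A) \<Longrightarrow> r \<in> carrier Z \<Longrightarrow>
    free_natural (single Z w r) = scalar_map r \<otimes>\<^bsub>KMW A\<^esub> aug_map_prod w"
  unfolding free_natural_def by (rule FM.additive_ext_single[OF KMW_ring]) (auto simp: V_carrier KM.l_distr)

lemma free_natural_hom: "ring_hom_ring FA (KMW A) free_natural"
proof (rule ring_hom_ringI2[OF FA_ring KMW_ring])
  have "free_natural \<in> ring_hom FM.MR (KMW A)"
    unfolding free_natural_def
  proof (rule FM.additive_ext_ring_hom[OF KMW_ring])
    fix u v r t assume "u \<in> carrier V" "v \<in> carrier V" and r: "r \<in> carrier Z" "t \<in> carrier Z"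
    then have uv: "u \<in> lists (aug_ideal A)" "v \<in> lists (aug_ideal A)" by (simp_all add: V_carrier)
    have "aug_map_prod u \<otimes>\<^bsub>KMW A\<^esub> (scalar_map t \<otimes>\<^bsub>KMW A\<^esub> aug_map_prod v) = scalar_map t \<otimes>\<^bsub>KMW A\<^esub> (aug_map_prod u \<otimes>\<^bsub>KMW A\<^esub> aug_map_prod v)"
      using uv r aug_map_prod_scalar_map_comm[of t u] by (simp flip: KM.m_assoc)
    then show "scalar_map (r \<otimes>\<^bsub>Z\<^esub> t) \<otimes>\<^bsub>KMW A\<^esub> aug_map_prod (u \<otimes>\<^bsub>V\<^esub> v) =
        scalar_map r \<otimes>\<^bsub>KMW A\<^esub> aug_map_prod u \<otimes>\<^bsub>KMW A\<^esub> (scalar_map t \<otimes>\<^bsub>KMW A\<^esub> aug_map_prod v)"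
      using uv r by (simp add: V_mult aug_map_prod_append KM.m_assoc)
  qed (auto simp: V_carrier KM.l_distr V_one)
  then show "free_natural \<in> ring_hom FA (KMW A)" by (simp add: FA_eq)
qed

sublocale free_natural: ring_hom_ring FA "KMW A" free_natural by (rule free_natural_hom)

lemma free_natural_deg:
  assumes "f \<in> FM.supported {w. length w = n}"
  shows "free_natural f \<in> KMW_deg A (int n)"
  using assms
proof (induction rule: FM.supported_induct)
  case zero
  then show ?case by (simp add: FA_eq KMW_deg_zero)
next
  case (add f w r)
  then have "free_natural (single Z w r) \<in> KMW_deg A (int n)"
    using KMW_deg_mult[OF scalar_map_deg aug_map_prod_deg, of r w] by (simp add: V_carrier free_natural_single)
  then show ?case using add by (simp add: FA_eq V_carrier FM_supported_closed KMW_deg_add)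
qed

lemma natural_map_exists: "\<exists>\<Phi>. natural_map A \<Phi>"
proof -
  have sc: "free_natural (sc r) = scalar_map r" if "r \<in> carrier Z" for r
    using free_natural_single[of "[]" r] that by simp
  have vec: "free_natural (vec m) = aug_map m" if "m \<in> aug_ideal A" for m
    using free_natural_single[of "[m]" "\<one>\<^bsub>Z\<^esub>"] that by simp
  obtain k where k: "k \<in> ring_hom (Khat A) (KMW A)" "\<And>f. f \<in> carrier FA \<Longrightarrow> k (khat_of f) = free_natural f"
  proof (rule Khat_lift[OF free_natural_hom])
    fix a assume "a \<in> Units A" "\<one> \<ominus> a \<in> Units A"
    then show "free_natural (vec (bracket A a)) \<otimes>\<^bsub>KMW A\<^esub> free_natural (vec (bracket A (\<one> \<ominus> a))) = \<zero>\<^bsub>KMW A\<^esub>"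
      by (simp add: vec aug_map_bracket s_steinberg)
  qed (auto simp: sc vec aug_map_smult I.I_l_closed)
  define \<Phi> where "\<Phi> = restrict k (carrier (Khat A))"
  have khat_of: "\<Phi> (khat_of f) = free_natural f" if "f \<in> carrier FA" for f
    using that k(2) by (simp add: \<Phi>_def)
  have "natural_map A \<Phi>"
    unfolding natural_map_def
  proof (intro conjI allI ballI)
    show "\<Phi> \<in> ring_hom (Khat A) (KMW A)"
      unfolding \<Phi>_def using KH.ring_hom_restrict[OF k(1)] by simp
    show "\<Phi> \<in> extensional (carrier (Khat A))" by (simp add: \<Phi>_def)
    show "\<Phi> ` Khat_deg A n \<subseteq> KMW_deg A (int n)" for n
      unfolding Khat_deg_eq using free_natural_deg by (auto simp: khat_of FM_supported_closed)
    fix a assume a: "a \<in> Units A"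
    show "\<Phi> (kbr a) = s a" using a by (simp add: kbr_eq khat_of vec aug_map_bracket)
    show "\<Phi> (kang a) = \<one>\<^bsub>KMW A\<^esub> \<oplus>\<^bsub>KMW A\<^esub> e \<otimes>\<^bsub>KMW A\<^esub> s a"
      using a by (simp add: kang_eq khat_of sc scalar_map_angle ang_def)
  qed
  then show ?thesis by (rule exI[of _ \<Phi>])
qed

lemma natural_map_unique:
  assumes "natural_map A \<Phi>" "natural_map A \<Psi>"
  shows "\<Phi> = \<Psi>"
proof (rule extensionalityI)
  show "\<Phi> \<in> extensional (carrier (Khat A))" "\<Psi> \<in> extensional (carrier (Khat A))"
    using assms by (simp_all add: natural_map_def)
  interpret P: ring_hom_ring "Khat A" "KMW A" \<Phi>
    using assms by (intro ring_hom_ringI2 Khat_ring KMW_ring) (simp add: natural_map_def)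
  interpret Q: ring_hom_ring "Khat A" "KMW A" \<Psi>
    using assms by (intro ring_hom_ringI2 Khat_ring KMW_ring) (simp add: natural_map_def)
  have br: "\<Phi> (kbr a) = \<Psi> (kbr a)" and an: "\<Phi> (kang a) = \<Psi> (kang a)" if "a \<in> Units A" for a
    using assms that by (simp_all add: natural_map_def)
  have sc: "\<Phi> (khat_of (sc r)) = \<Psi> (khat_of (sc r))" if "r \<in> carrier Z" for r
    using that
  proof (induction rule: Z_induct)
    case zero
    have "sc \<zero>\<^bsub>Z\<^esub> = \<zero>\<^bsub>FA\<^esub>" using FM.single_zero[of "[]"] by (simp add: FA_eq)
    then show ?case by simp
  next
    case (minus f)
    have "sc (\<ominus>\<^bsub>Z\<^esub> f) = \<ominus>\<^bsub>FA\<^esub> sc f" using FM.single_minus[of "[]" f] minus by (simp add: FA_eq V_carrier)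
    then show ?case using minus by simp
  qed (simp_all add: an sc_add flip: kang_eq)
  have vec: "\<Phi> (khat_of (vec m)) = \<Psi> (khat_of (vec m))" if "m \<in> aug_ideal A" for m
    using that
    by (induction rule: aug_induct) (simp_all add: br khat_of_vec_zero khat_of_vec_add khat_of_vec_minus flip: kbr_eq)
  have single: "\<Phi> (khat_of (single Z w r)) = \<Psi> (khat_of (single Z w r))"
    if "w \<in> lists (aug_ideal A)" "r \<in> carrier Z" for w r
    using that
  proof (induction w)
    case (Cons m w)
    have "single Z (m # w) r = vec m \<otimes>\<^bsub>FA\<^esub> single Z w r"
      using Cons by (simp add: FA_single_mult)
    then show ?case using Cons vec by simp
  qed (simp add: sc)
  fix x assume "x \<in> carrier (Khat A)"
  then obtain f where f: "f \<in> carrier FM.MR" "x = khat_of f" unfolding Khat_carrier FA_eq by blast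
  have "\<Phi> (khat_of f) = \<Psi> (khat_of f)"
    using f(1) by (induction rule: FM.MR_induct) (simp_all add: FA_eq V_carrier single)
  then show "\<Phi> x = \<Psi> x" by (simp add: f)
qed

end

section \<open>The isomorphism in degrees at least two\<close>

text \<open>The list of the symbols in a word, and the number of occurrences of \<open>\<eta>\<close>.\<close>

fun syms :: "'a mw_gen list \<Rightarrow> 'a list" where
  "syms [] = []"
| "syms (Sym a # w) = a # syms w"
| "syms (Eta # w) = syms w"

fun etas :: "'a mw_gen list \<Rightarrow> nat" where
  "etas [] = 0"
| "etas (Sym a # w) = etas w"
| "etas (Eta # w) = Suc (etas w)"

lemma syms_append [simp]: "syms (u @ v) = syms u @ syms v"
  by (induction u rule: syms.induct) auto

lemma etas_append [simp]: "etas (u @ v) = etas u + etas v"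
  by (induction u rule: etas.induct) auto

lemma word_degree_eq: "word_degree w = int (length (syms w)) - int (etas w)"
  by (induction w rule: syms.induct) (auto simp: word_degree_def)

lemma syms_map_Sym [simp]: "syms (map Sym as) = as" and etas_map_Sym [simp]: "etas (map Sym as) = 0"
  by (induction as) auto

context units_ring
begin

lemma syms_units: "w \<in> lists (mw_gens A) \<Longrightarrow> set (syms w) \<subseteq> Units A"
  by (induction w rule: syms.induct) auto

lemma Khat_deg_mult:
  assumes "x \<in> Khat_deg A n" "y \<in> Khat_deg A k"
  shows "x \<otimes>\<^bsub>Khat A\<^esub> y \<in> Khat_deg A (n + k)"
proof -
  obtain f g where fg: "f \<in> FM.supported {w. length w = n}" "x = khat_of f"
    "g \<in> FM.supported {w. length w = k}" "y = khat_of g"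
    using assms unfolding Khat_deg_eq by blast
  then have "x \<otimes>\<^bsub>Khat A\<^esub> y = khat_of (f \<otimes>\<^bsub>FA\<^esub> g)" by (simp add: FM_supported_closed)
  moreover have "f \<otimes>\<^bsub>FM.MR\<^esub> g \<in> FM.supported {w. length w = n + k}"
    by (rule FM.supported_mult[OF _ fg(1,3)]) (simp add: V_mult)
  ultimately show ?thesis unfolding Khat_deg_eq by (simp add: FA_eq)
qed

lemma Khat_deg_add:
  assumes "x \<in> Khat_deg A n" "y \<in> Khat_deg A n"
  shows "x \<oplus>\<^bsub>Khat A\<^esub> y \<in> Khat_deg A n"
proof -
  obtain f g where fg: "f \<in> FM.supported {w. length w = n}" "x = khat_of f"
    "g \<in> FM.supported {w. length w = n}" "y = khat_of g"
    using assms unfolding Khat_deg_eq by blast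
  then have "x \<oplus>\<^bsub>Khat A\<^esub> y = khat_of (f \<oplus>\<^bsub>FA\<^esub> g)" by (simp add: FM_supported_closed)
  then show ?thesis unfolding Khat_deg_eq
    using FM.supported_add[OF fg(1,3)] by (simp add: FA_eq)
qed

lemma Khat_deg_minus:
  assumes "x \<in> Khat_deg A n"
  shows "\<ominus>\<^bsub>Khat A\<^esub> x \<in> Khat_deg A n"
proof -
  obtain f where f: "f \<in> FM.supported {w. length w = n}" "x = khat_of f"
    using assms unfolding Khat_deg_eq by blast
  then have "\<ominus>\<^bsub>Khat A\<^esub> x = khat_of (\<ominus>\<^bsub>FA\<^esub> f)" by (simp add: FM_supported_closed)
  then show ?thesis unfolding Khat_deg_eq
    using FM.supported_minus[OF f(1)] by (simp add: FA_eq)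
qed

lemma Khat_deg_zero: "\<zero>\<^bsub>Khat A\<^esub> \<in> Khat_deg A n"
  unfolding Khat_deg_eq by (rule image_eqI[of _ _ "\<zero>\<^bsub>FA\<^esub>"]) (use FM.supported_zero in \<open>auto simp: FA_eq\<close>)

lemma Khat_deg_closed: "x \<in> Khat_deg A n \<Longrightarrow> x \<in> carrier (Khat A)"
  by (auto simp: Khat_deg_eq FM_supported_closed)

lemma khat_of_single_deg:
  "w \<in> lists (aug_ideal A) \<Longrightarrow> r \<in> carrier Z \<Longrightarrow> khat_of (single Z w r) \<in> Khat_deg A (length w)"
  unfolding Khat_deg_eq by (rule imageI, rule FM.supported_single) (auto simp: V_carrier)

lemma K_deg:
  "set as \<subseteq> Units A \<Longrightarrow> k \<le> length as \<Longrightarrow> KH.K k as \<in> Khat_deg A (length as - k)"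
proof (induction as arbitrary: k)
  case Nil
  then show ?case using khat_of_single_deg[of "[]" "\<one>\<^bsub>Z\<^esub>"] by (simp add: sc_one)
next
  case (Cons a as)
  show ?case
  proof (cases k)
    case 0
    have "kbr a \<in> Khat_deg A 1" 
      using khat_of_single_deg[of "[bracket A a]" "\<one>\<^bsub>Z\<^esub>"] Cons.prems by (simp add: kbr_eq)
    then show ?thesis using Khat_deg_mult[of "kbr a" 1] Cons.IH[of 0] Cons.prems 0 by simp
  next
    case (Suc j)
    have "KH.D a = khat_of (sc (angle a \<ominus>\<^bsub>Z\<^esub> \<one>\<^bsub>Z\<^esub>))"
    proof -
      have "sc (\<ominus>\<^bsub>Z\<^esub> \<one>\<^bsub>Z\<^esub>) = \<ominus>\<^bsub>FA\<^esub> \<one>\<^bsub>FA\<^esub>"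
        using FM.single_minus[of "[]" "\<one>\<^bsub>Z\<^esub>"] by (simp add: FA_eq V_carrier FM.MR_one[unfolded V_one FA_eq])
      then show ?thesis
        using Cons.prems by (simp add: KH.D_def kang_eq Z.minus_eq KH.minus_eq sc_add)
    qed
    then have "KH.D a \<in> Khat_deg A 0"
      using khat_of_single_deg[of "[]" "angle a \<ominus>\<^bsub>Z\<^esub> \<one>\<^bsub>Z\<^esub>"] Cons.prems by simp
    then show ?thesis using Khat_deg_mult[of "KH.D a" 0] Cons.IH[of j] Cons.prems Suc by simp
  qed
qed

subsection \<open>A left inverse on representatives\<close>

text \<open>The value in \<open>K\<close>-hat of a word of degree at least two: if \<open>\<eta>\<close> occurs \<open>k\<close> times, the first \<open>k\<close> symbols
  \<open>[a]\<close> are replaced by \<open>\<langle>a\<rangle> - 1\<close>. Words of lower degree are sent to \<open>0\<close>, since the argument fails for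
  them; all relations are homogeneous, so this does no harm.\<close>

definition word_val :: "'a mw_gen list \<Rightarrow> 'a khat" where
  "word_val w = (if word_degree w \<ge> 2 then KH.K (etas w) (syms w) else \<zero>\<^bsub>Khat A\<^esub>)"

text \<open>The additive extension to the free ring. It kills the relations of Milnor-Witt K-theory and so
  describes the inverse of the natural map in degrees at least two.\<close>

definition backward :: "('a mw_gen list \<Rightarrow> int) \<Rightarrow> 'a khat" where
  "backward = F.integral_ext (Khat A) word_val"

lemma word_val_closed: "w \<in> lists (mw_gens A) \<Longrightarrow> word_val w \<in> carrier (Khat A)"
  by (simp add: word_val_def syms_units)

lemma backward_word: "w \<in> lists (mw_gens A) \<Longrightarrow> backward (word w) = word_val w"
  unfolding backward_def by (rule F.integral_ext_single_one[OF Khat_ring]) (auto simp: Words_carrier word_val_closed)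

lemma backward_hom: "abelian_group_hom FK (Khat A) backward"
  unfolding backward_def F_eq[symmetric]
  by (rule F.integral_ext_hom[OF Khat_ring]) (simp add: Words_carrier word_val_closed)

sublocale backward: abelian_group_hom FK "Khat A" backward by (rule backward_hom)

lemma backward_rels:
  assumes rich: "rich_units A"
    and b: "b \<in> KMW_rels" and u: "u \<in> lists (mw_gens A)" and v: "v \<in> lists (mw_gens A)"
  shows "backward (word u \<otimes>\<^bsub>FK\<^esub> b \<otimes>\<^bsub>FK\<^esub> word v) = \<zero>\<^bsub>Khat A\<^esub>"
proof -
  interpret KR: mw_symbols_rich "Khat A" A kang kbr
    by (intro mw_symbols_rich.intro mw_symbols_rich_axioms.intro Khat_symbols rich)
  let ?u = "syms u" and ?v = "syms v" and ?k = "etas u + etas v"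
  have uv: "set ?u \<subseteq> Units A" "set ?v \<subseteq> Units A" using u v by (simp_all add: syms_units)
  have wuv: "word u \<in> carrier FK" "word v \<in> carrier FK" using u v by simp_all
  note distr = FK.minus_eq FK.l_distr FK.r_distr FK.l_minus FK.r_minus
  consider
      (1) a where "a \<in> Units A" "\<one> \<ominus> a \<in> Units A" "b = word [Sym a, Sym (\<one> \<ominus> a)]"
    | (2) a c where "a \<in> Units A" "c \<in> Units A" "b = word [Sym (a \<otimes> c)] \<ominus>\<^bsub>FK\<^esub>
        (word [Sym a] \<oplus>\<^bsub>FK\<^esub> word [Sym c] \<oplus>\<^bsub>FK\<^esub> word [Eta, Sym a, Sym c])"
    | (3) a where "a \<in> Units A" "b = word [Eta, Sym a] \<ominus>\<^bsub>FK\<^esub> word [Sym a, Eta]"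
    | (4) "b = word [Eta, Eta, Sym (\<ominus> \<one>)] \<oplus>\<^bsub>FK\<^esub> (word [Eta] \<oplus>\<^bsub>FK\<^esub> word [Eta])"
    using b unfolding KMW_rels_def by blast
  then show ?thesis
  proof cases
    case 1
    have "word_val (u @ Sym a # Sym (\<one> \<ominus> a) # v) = \<zero>\<^bsub>Khat A\<^esub>"
    proof (cases "word_degree (u @ Sym a # Sym (\<one> \<ominus> a) # v) \<ge> 2")
      case True
      then have "?k \<le> length ?u + length ?v" by (simp add: word_degree_eq)
      with True show ?thesis using KH.K_steinberg[OF 1(1,2) uv] by (simp add: word_val_def)
    qed (simp add: word_val_def)
    then show ?thesis using 1 u v by (simp add: backward_word)
  next
    case 2
    have "word u \<otimes>\<^bsub>FK\<^esub> b \<otimes>\<^bsub>FK\<^esub> word v = word (u @ Sym (a \<otimes> c) # v) \<ominus>\<^bsub>FK\<^esub>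
        (word (u @ Sym a # v) \<oplus>\<^bsub>FK\<^esub> word (u @ Sym c # v) \<oplus>\<^bsub>FK\<^esub> word (u @ Eta # Sym a # Sym c # v))"
      using 2 u v by (simp add: distr)
    moreover have "word_val (u @ Sym (a \<otimes> c) # v) =
        word_val (u @ Sym a # v) \<oplus>\<^bsub>Khat A\<^esub> word_val (u @ Sym c # v) \<oplus>\<^bsub>Khat A\<^esub> word_val (u @ Eta # Sym a # Sym c # v)"
      using KH.K_mult[OF 2(1,2) uv, of ?k] by (simp add: word_val_def word_degree_eq)
    ultimately show ?thesis
      using 2 u v by (simp add: FK.minus_eq backward_word word_val_closed KH.r_neg)
  next
    case 3
    have "word u \<otimes>\<^bsub>FK\<^esub> b \<otimes>\<^bsub>FK\<^esub> word v =
        word (u @ Eta # Sym a # v) \<ominus>\<^bsub>FK\<^esub> word (u @ Sym a # Eta # v)"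
      using 3 u v by (simp add: distr)
    moreover have "word_val (u @ Eta # Sym a # v) = word_val (u @ Sym a # Eta # v)"
      by (simp add: word_val_def word_degree_eq)
    ultimately show ?thesis
      using 3 u v by (simp add: FK.minus_eq backward_word word_val_closed KH.r_neg)
  next
    case 4
    have "word u \<otimes>\<^bsub>FK\<^esub> b \<otimes>\<^bsub>FK\<^esub> word v = word (u @ Eta # Eta # Sym (\<ominus> \<one>) # v) \<oplus>\<^bsub>FK\<^esub>
        (word (u @ Eta # v) \<oplus>\<^bsub>FK\<^esub> word (u @ Eta # v))"
      using 4 u v by (simp add: distr)
    moreover have "word_val (u @ Eta # Eta # Sym (\<ominus> \<one>) # v) \<oplus>\<^bsub>Khat A\<^esub>
        (word_val (u @ Eta # v) \<oplus>\<^bsub>Khat A\<^esub> word_val (u @ Eta # v)) = \<zero>\<^bsub>Khat A\<^esub>"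
    proof (cases "word_degree (u @ Eta # v) \<ge> 2")
      case True
      then have "?k + 3 \<le> length ?u + length ?v" by (simp add: word_degree_eq)
      with True show ?thesis
        using KR.K_hyperbolic[OF uv] by (simp add: word_val_def word_degree_eq)
    qed (simp add: word_val_def word_degree_eq)
    ultimately show ?thesis using u v by (simp add: backward_word)
  qed
qed

lemma backward_ideal:
  assumes "rich_units A" "f \<in> Idl\<^bsub>FK\<^esub> KMW_rels"
  shows "backward f = \<zero>\<^bsub>Khat A\<^esub>"
  by (rule F.vanish_on_ideal[where B = KMW_rels])
    (use backward_hom KMW_rels_closed backward_rels assms in \<open>simp_all add: F_eq Words_carrier\<close>)

lemma cw_eq_K:
  assumes "w \<in> lists (mw_gens A)" "etas w \<le> length (syms w)"
  shows "cw w = KM.K (etas w) (syms w)"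
proof -
  \<comment> \<open>Multiplication by the \<open>k\<close>-th power of \<open>\<eta>\<close>.\<close>
  let ?E = "\<lambda>k x. ((\<lambda>y. e \<otimes>\<^bsub>KMW A\<^esub> y) ^^ k) x"
  have E_closed: "?E k x \<in> carrier (KMW A)" if "x \<in> carrier (KMW A)" for k x
    using that by (induction k) auto
  have E_s: "s a \<otimes>\<^bsub>KMW A\<^esub> ?E k x = ?E k (s a \<otimes>\<^bsub>KMW A\<^esub> x)"
    if "x \<in> carrier (KMW A)" "a \<in> Units A" for k x a
    using that by (induction k) (auto simp: s_e_left E_closed)
  have 1: "cw w = ?E (etas w) (KM.K 0 (syms w))"
    using assms(1)
  proof (induction w rule: syms.induct)
    case 1
    then show ?case by (simp add: word_Nil)
  next
    case (2 a w)
    then show ?case using cw_Cons[of "Sym a" w] by (simp add: cw_gen E_s syms_units)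
  next
    case (3 w)
    then show ?case using cw_Cons[of Eta w] by (simp add: cw_gen)
  qed
  have 2: "?E k (KM.K 0 as) = KM.K k as" if "set as \<subseteq> Units A" "k \<le> length as" for k as
    using that
  proof (induction k arbitrary: as)
    case (Suc k)
    then obtain a bs where as: "as = a # bs" by (cases as) auto
    have "?E (Suc k) (KM.K 0 as) = e \<otimes>\<^bsub>KMW A\<^esub> (s a \<otimes>\<^bsub>KMW A\<^esub> ?E k (KM.K 0 bs))"
      using Suc.prems by (simp add: as E_s)
    then show ?case using Suc.IH[of bs] Suc.prems by (simp add: as KM_D KM.m_assoc)
  qed simp
  show ?thesis using 1 2 assms syms_units by simp
qed

text \<open>Richness of the units enters only through the annihilation by \<open>h\<close>, that is, in the proof that
  \<open>backward\<close> respects the relation \<open>\<eta>\<^sup>2[-1] + 2\<eta> = 0\<close>; this gives injectivity. Surjectivity rests on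
  \<open>\<eta>[a] = \<langle>a\<rangle> - 1\<close>.\<close>

theorem natural_map_iso:
  assumes rich: "rich_units A" and nat: "natural_map A \<Phi>" and n: "n \<ge> 2"
  shows "\<Phi> \<in> iso (Khat_group A n) (KMW_group A (int n))"
proof -
  interpret P: ring_hom_ring "Khat A" "KMW A" \<Phi>
    using nat by (intro ring_hom_ringI2 Khat_ring KMW_ring) (simp add: natural_map_def)
  have deg: "\<Phi> x \<in> KMW_deg A (int n)" if "x \<in> Khat_deg A n" for x
    using nat that by (auto simp: natural_map_def)
  have br: "\<Phi> (kbr a) = s a" and an: "\<Phi> (kang a) = ang a" if "a \<in> Units A" for a
    using nat that by (simp_all add: natural_map_def ang_def)
  have D: "\<Phi> (KH.D a) = KM.D a" if "a \<in> Units A" for a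
    using that by (simp add: KH.D_def KM.D_def KH.minus_eq KM.minus_eq an)
  have K: "\<Phi> (KH.K k as) = KM.K k as" if "set as \<subseteq> Units A" for k as
    using that
  proof (induction as arbitrary: k)
    case Nil
    then show ?case by (cases k) auto
  next
    case (Cons a as)
    then show ?case by (cases k) (auto simp: br D)
  qed
  \<comment> \<open>Each element of \<open>Kspan n\<close> is the value of \<open>backward\<close> at some representative of its image.\<close>
  have lift: "\<exists>f\<in>carrier FK. KMW_class A f = \<Phi> x \<and> backward f = x" if "x \<in> Kspan n" for x
    using that
  proof (induction rule: Kspan.induct)
    case zero
    then show ?case by (intro bexI[of _ "\<zero>\<^bsub>FK\<^esub>"]) auto
  next
    case (gen as)
    let ?w = "map Sym as"
    have w: "?w \<in> lists (mw_gens A)" using gen by (auto simp: subset_iff)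
    have "cw ?w = \<Phi> (KH.K 0 as)" using cw_eq_K[OF w] K gen by simp
    moreover have "backward (word ?w) = KH.K 0 as"
      using w gen n by (simp add: backward_word word_val_def word_degree_eq)
    ultimately show ?case using w by (intro bexI[of _ "word ?w"]) auto
  next
    case (add x y)
    then obtain f g where "f \<in> carrier FK" "KMW_class A f = \<Phi> x" "backward f = x"
      "g \<in> carrier FK" "KMW_class A g = \<Phi> y" "backward g = y" by blast
    then show ?case using add Kspan_closed by (intro bexI[of _ "f \<oplus>\<^bsub>FK\<^esub> g"]) auto
  next
    case (minus x)
    then obtain f where "f \<in> carrier FK" "KMW_class A f = \<Phi> x" "backward f = x" by blast
    then show ?case using minus Kspan_closed by (intro bexI[of _ "\<ominus>\<^bsub>FK\<^esub> f"]) auto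
  qed
  have "inj_on \<Phi> (Khat_deg A n)"
  proof (rule inj_onI)
    fix x y assume xy: "x \<in> Khat_deg A n" "y \<in> Khat_deg A n" "\<Phi> x = \<Phi> y"
    obtain f where f: "f \<in> carrier FK" "KMW_class A f = \<Phi> x" "backward f = x"
      using lift[OF Khat_deg_Kspan[OF xy(1)]] n by auto
    obtain g where g: "g \<in> carrier FK" "KMW_class A g = \<Phi> y" "backward g = y"
      using lift[OF Khat_deg_Kspan[OF xy(2)]] n by auto
    have "f \<ominus>\<^bsub>FK\<^esub> g \<in> Idl\<^bsub>FK\<^esub> KMW_rels"
      using KMW_class_eqD[OF f(1) g(1)] f g xy by simp
    then have "backward (f \<ominus>\<^bsub>FK\<^esub> g) = \<zero>\<^bsub>Khat A\<^esub>" by (rule backward_ideal[OF rich])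
    then have "x \<ominus>\<^bsub>Khat A\<^esub> y = \<zero>\<^bsub>Khat A\<^esub>"
      using f g by (simp add: FK.minus_eq KH.minus_eq)
    then show "x = y"
      by (rule iffD1[OF KH.r_right_minus_eq[OF Khat_deg_closed[OF xy(1)] Khat_deg_closed[OF xy(2)]]])
  qed
  moreover have "KMW_deg A (int n) \<subseteq> \<Phi> ` Khat_deg A n"
  proof
    fix y assume "y \<in> KMW_deg A (int n)"
    then obtain f where f: "f \<in> F.supported {w. word_degree w = int n}" and y: "y = KMW_class A f"
      unfolding KMW_deg_eq by (rule imageE)
    \<comment> \<open>A preimage of the class of \<open>f\<close> is given by \<open>backward f\<close>.\<close>
    have "backward f \<in> Khat_deg A n \<and> \<Phi> (backward f) = KMW_class A f"
      using f
    proof (induction rule: F.integral_supported_induct)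
      case zero
      then show ?case by (simp add: F_eq Khat_deg_zero)
    next
      case (single w)
      then have w: "w \<in> lists (mw_gens A)" "word_degree w = int n" by (simp_all add: Words_carrier)
      then have k: "etas w \<le> length (syms w)" "length (syms w) - etas w = n"
        by (simp_all add: word_degree_eq)
      have "backward (word w) = KH.K (etas w) (syms w)" using w n by (simp add: backward_word word_val_def)
      then show ?case
        using K_deg[OF syms_units[OF w(1)] k(1)] k cw_eq_K[OF w(1) k(1)] K syms_units[OF w(1)] by simp
    next
      case (add f g)
      then show ?case by (simp add: F_eq F_supported_closed Khat_deg_add)
    next
      case (minus f)
      then show ?case by (simp add: F_eq F_supported_closed Khat_deg_minus)
    qed
    then show "y \<in> \<Phi> ` Khat_deg A n" using y by (metis imageI)
  qed
  ultimately have "bij_betw \<Phi> (Khat_deg A n) (KMW_deg A (int n))"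
    using deg by (auto simp: bij_betw_def)
  then show ?thesis
    unfolding iso_def hom_def Khat_group_def KMW_group_def
    using deg by (auto simp: Khat_deg_closed)
qed

end

theorem theorem1p6:
  fixes A :: "('a, 'm) ring_scheme"
  assumes "local_ring A"
    and "\<not> field A \<Longrightarrow>
      infinite (carrier (residue_field A)) \<or> card (carrier (residue_field A)) \<ge> 4"
  shows "\<exists>\<Phi>. natural_map A \<Phi> \<and> (\<forall>\<Psi>. natural_map A \<Psi> \<longrightarrow> \<Psi> = \<Phi>) \<and>
    (\<forall>n\<ge>2. \<Phi> \<in> iso (Khat_group A n) (KMW_group A (int n)))"
proof -
  interpret units_ring A
    using assms(1) by (simp add: units_ring_def local_ring_def)
  have rich: "rich_units A" by (rule local_ring_rich_units[OF assms])
  obtain \<Phi> where nat: "natural_map A \<Phi>" using natural_map_exists by (rule exE)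
  show ?thesis
  proof (intro exI[of _ \<Phi>] conjI allI impI)
    show "natural_map A \<Phi>" by (rule nat)
    show "\<Psi> = \<Phi>" if "natural_map A \<Psi>" for \<Psi> by (rule natural_map_unique[OF that nat])
    show "\<Phi> \<in> iso (Khat_group A n) (KMW_group A (int n))" if "2 \<le> n" for n
      by (rule natural_map_iso[OF rich nat that])
  qed
qed

end
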